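(* The following equalities hold. (i) $\mathrm{Low}(\mathrm{W2R},\mathrm{MLR})=\mathrm{Low}(\mathrm{MLR})$. (ii) $\mathrm{Low}(\mathrm{W2R},\mathrm{CR})=\mathrm{Low}(\mathrm{MLR},\mathrm{CR})$. (iii) $\mathrm{Low}(\mathrm{W2R},\mathrm{SR})=\mathrm{Low}(\mathrm{MLR},\mathrm{SR})$.
   Context: $2^\omega$ is Cantor space with the uniform measure $\mu$. For an oracle $A\in 2^\omega$: an $A$-Martin-Löf test is a non-increasing sequence $(\mathcal{U}_n)_{n\in\mathbb{N}}$ of uniformly $A$-c.e. open sets with $\mu(\mathcal{U}_n)\leq 2^{-n}$ for all $n$, and it is an $A$-Schnorr test if moreover $\mu(\mathcal{U}_n)=2^{-n}$ for all $n$; $\mathrm{MLR}^A$ (resp. $\mathrm{SR}^A$) is the set of $X\in 2^\omega$ such that $X\notin\bigcap_n\mathcal{U}_n$ for every $A$-Martin-Löf (resp. $A$-Schnorr) test. A martingale is a function $d:2^{<\omega}\to\mathbb{R}^{\geq 0}$ with $d(\sigma)=\frac{d(\sigma 0)+d(\sigma 1)}{2}$ for all $\sigma$; it succeeds on $X$ if $\limsup_n d(X\upharpoonright n)=+\infty$; $\mathrm{CR}^A$ is the set of $X$ on which no $A$-computable (real-valued) martingale succeeds. $\mathrm{MLR},\mathrm{CR},\mathrm{SR}$ denote the unrelativized classes. $\mathrm{W2R}$ (weak 2-random sequences) is the set of $X$ such that $X\notin\bigcap_n\mathcal{U}_n$ for every generalized Martin-Löf test, i.e., every non-increasing sequence $(\mathcal{U}_n)_{n\in\mathbb{N}}$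 of uniformly c.e. open sets with $\lim_n\mu(\mathcal{U}_n)=0$. For randomness notions $\mathscr{R}\subseteq\mathscr{S}$, $\mathrm{Low}(\mathscr{R},\mathscr{S})=\{A\in 2^\omega:\mathscr{R}\subseteq\mathscr{S}^A\}$, and $\mathrm{Low}(\mathscr{R})=\{A\in 2^\omega:\mathscr{R}^A=\mathscr{R}\}$. *)

theory Defs
  imports "HOL-Probability.Probability"
begin

type_synonym cantor = "nat \<Rightarrow> bool"

subsection \<open>Computability relative to an oracle\<close>

text \<open>
  Kleene's partial recursive functions, with the characteristic function of the oracle as an
  additional initial function. On argument lists of a fixed length the programs compute exactly
  the partial functions that are recursive in the oracle.
\<close>

datatype prog =
    Zero
  | Succ
  | Proj nat
  | Oracle
  | Comp prog "prog list"
  | PrimRec prog prog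
  | Mu prog

fun eval :: "cantor \<Rightarrow> prog \<Rightarrow> nat list \<Rightarrow> nat option" where
  "eval A Zero xs = Some 0"
| "eval A Succ xs = (case xs of [x] \<Rightarrow> Some (Suc x) | _ \<Rightarrow> None)"
| "eval A (Proj i) xs = (if i < length xs then Some (xs ! i) else None)"
| "eval A Oracle xs = (case xs of [x] \<Rightarrow> Some (if A x then 1 else 0) | _ \<Rightarrow> None)"
| "eval A (Comp f gs) xs =
     (let rs = map (\<lambda>g. eval A g xs) gs
      in if None \<in> set rs then None else eval A f (map the rs))"
| "eval A (PrimRec f g) xs =
     (case xs of
        [] \<Rightarrow> None
      | n # ys \<Rightarrow>
          rec_nat (eval A f ys) (\<lambda>m r. Option.bind r (\<lambda>v. eval A g (m # v # ys))) n)"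
| "eval A (Mu f) xs =
     (if \<exists>n. eval A f (n # xs) = Some 0 \<and> (\<forall>m<n. eval A f (m # xs) \<noteq> None)
      then Some (LEAST n. eval A f (n # xs) = Some 0)
      else None)"

definition computable2 :: "cantor \<Rightarrow> (nat \<Rightarrow> nat \<Rightarrow> nat) \<Rightarrow> bool" where
  "computable2 A f \<longleftrightarrow> (\<exists>p. \<forall>x y. eval A p [x, y] = Some (f x y))"

definition ce2 :: "cantor \<Rightarrow> (nat \<times> nat) set \<Rightarrow> bool" where
  "ce2 A W \<longleftrightarrow> (\<exists>p. W = {(x, y). eval A p [x, y] \<noteq> None})"

text \<open>
  The usual identification of binary strings with natural numbers (length-lexicographic order):
  the string \<open>s\<close> is coded by the number \<open>n\<close> such that \<open>n + 1\<close> has binary notation \<open>1s\<close>.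
\<close>

definition string_code :: "bool list \<Rightarrow> nat" where
  "string_code \<sigma> = foldl (\<lambda>n b. 2 * n + (if b then 2 else 1)) 0 \<sigma>"

text \<open>
  A real-valued function on strings is computable in \<open>A\<close> if some double sequence of rationals
  \<open>(-1)^s * p / q\<close>, with \<open>s\<close>, \<open>p\<close>, \<open>q\<close> computable in \<open>A\<close>, approximates its values
  with error at most \<open>2^(-k)\<close>.
\<close>

definition computable_real_fun :: "cantor \<Rightarrow> (bool list \<Rightarrow> real) \<Rightarrow> bool" where
  "computable_real_fun A d \<longleftrightarrow>
     (\<exists>s p q. computable2 A s \<and> computable2 A p \<and> computable2 A q \<and>
        (\<forall>\<sigma> k. let c = string_code \<sigma> in
           q c k \<noteq> 0 \<and>
           \<bar>d \<sigma> - (-1) ^ s c k * real (p c k) / real (q c k)\<bar> \<le> (1/2) ^ k))"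

subsection \<open>Cantor space\<close>

definition prefix_of :: "cantor \<Rightarrow> nat \<Rightarrow> bool list" where
  "prefix_of X n = map X [0..<n]"

definition cylinder :: "bool list \<Rightarrow> cantor set" where
  "cylinder \<sigma> = {X. prefix_of X (length \<sigma>) = \<sigma>}"

definition coin_measure :: "cantor measure" where
  "coin_measure = Pi\<^sub>M UNIV (\<lambda>_. measure_pmf (bernoulli_pmf (1/2)))"

definition uniformly_ce_open :: "cantor \<Rightarrow> (nat \<Rightarrow> cantor set) \<Rightarrow> bool" where
  "uniformly_ce_open A U \<longleftrightarrow>
     (\<exists>W. ce2 A W \<and> (\<forall>n. U n = (\<Union>\<sigma> \<in> {\<sigma>. (n, string_code \<sigma>) \<in> W}. cylinder \<sigma>)))"

subsection \<open>Randomness notions\<close>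

text \<open>
  Every notion takes the oracle as an argument; the unrelativized notion is the one for the
  oracle \<open>\<lambda>_. False\<close>, i.e. the empty set.
\<close>

definition martin_lof_test :: "cantor \<Rightarrow> (nat \<Rightarrow> cantor set) \<Rightarrow> bool" where
  "martin_lof_test A U \<longleftrightarrow>
     decseq U \<and> uniformly_ce_open A U \<and> (\<forall>n. measure coin_measure (U n) \<le> (1/2) ^ n)"

definition schnorr_test :: "cantor \<Rightarrow> (nat \<Rightarrow> cantor set) \<Rightarrow> bool" where
  "schnorr_test A U \<longleftrightarrow>
     martin_lof_test A U \<and> (\<forall>n. measure coin_measure (U n) = (1/2) ^ n)"

definition generalized_martin_lof_test :: "cantor \<Rightarrow> (nat \<Rightarrow> cantor set) \<Rightarrow> bool" where
  "generalized_martin_lof_test A U \<longleftrightarrow>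
     decseq U \<and> uniformly_ce_open A U \<and> (\<lambda>n. measure coin_measure (U n)) \<longlonglongrightarrow> 0"

definition martingale :: "(bool list \<Rightarrow> real) \<Rightarrow> bool" where
  "martingale d \<longleftrightarrow>
     (\<forall>\<sigma>. 0 \<le> d \<sigma> \<and> d \<sigma> = (d (\<sigma> @ [False]) + d (\<sigma> @ [True])) / 2)"

definition succeeds_on :: "(bool list \<Rightarrow> real) \<Rightarrow> cantor \<Rightarrow> bool" where
  "succeeds_on d X \<longleftrightarrow> limsup (\<lambda>n. ereal (d (prefix_of X n))) = \<infinity>"

definition MLR :: "cantor \<Rightarrow> cantor set" where
  "MLR A = {X. \<forall>U. martin_lof_test A U \<longrightarrow> X \<notin> (\<Inter>n. U n)}"

definition SR :: "cantor \<Rightarrow> cantor set" where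
  "SR A = {X. \<forall>U. schnorr_test A U \<longrightarrow> X \<notin> (\<Inter>n. U n)}"

definition W2R :: "cantor \<Rightarrow> cantor set" where
  "W2R A = {X. \<forall>U. generalized_martin_lof_test A U \<longrightarrow> X \<notin> (\<Inter>n. U n)}"

definition CR :: "cantor \<Rightarrow> cantor set" where
  "CR A = {X. \<forall>d. martingale d \<and> computable_real_fun A d \<longrightarrow> \<not> succeeds_on d X}"

subsection \<open>Lowness\<close>

definition Low_pair :: "(cantor \<Rightarrow> cantor set) \<Rightarrow> (cantor \<Rightarrow> cantor set) \<Rightarrow> cantor set" where
  "Low_pair R S = {A. R (\<lambda>_. False) \<subseteq> S A}"

definition Low :: "(cantor \<Rightarrow> cantor set) \<Rightarrow> cantor set" where
  "Low R = {A. R A = R (\<lambda>_. False)}"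

end

theory Submission
  imports Defs
begin

text \<open>
  Weakly 2-random sequences are Martin-Loef random, so the only question is why \<open>W2R \<subseteq> S\<^sup>A\<close> implies
  \<open>MLR \<subseteq> S\<^sup>A\<close>. Let \<open>X\<close> be Martin-Loef random but not in \<open>S\<^sup>A\<close>. The sequence \<open>X\<close> itself need not be weakly
  2-random; the idea is to put its failure into a form that can be transplanted, piece by piece, into
  a weakly 2-random sequence.

  The form is this: there is a set \<open>D\<close> of strings, decidable in \<open>A\<close>, such that every tail of \<open>X\<close> has a
  prefix in \<open>D\<close>, while every sequence that can be cut into infinitely many consecutive blocks from \<open>D\<close>
  fails \<open>S\<^sup>A\<close>. Such a \<open>D\<close> is found for each of the three notions. If a Martin-Loef test catches \<open>X\<close>,
  translates of sufficiently late components of it form one open set \<open>U\<close> of measure below 1/2 that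
  contains all tails of \<open>X\<close>, and the sequences with at least \<open>n\<close> blocks from a generator of \<open>U\<close> form a set of measure \<open>\<mu>(U)^n\<close>
  (\<open>measure_blocks\<close>), again a test. For Schnorr randomness \<open>U\<close> is first enlarged to measure exactly 1/2
  (\<open>measure_pad\<close>). If a martingale succeeds on \<open>X\<close>, a weighted average of its translates succeeds on all
  tails of \<open>X\<close>; the blocks are strings on which it at least doubles, and the martingale that restarts
  after each block and saves the surplus succeeds on all sequences of blocks (\<open>restart_ge\<close>).

  Given \<open>D\<close>, a weakly 2-random sequence made of blocks is built by forcing with \<open>\<Pi>\<^sup>0\<^sub>1\<close> classes of positive
  measure (\<open>weakly_2_random_of_blocks\<close>). A generalized Martin-Loef test is avoided by removing a component
  of small measure from the class. A block is appended with the help of \<open>X\<close>: since \<open>X\<close> is random, some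
  tail of \<open>X\<close> belongs to the current class (\<open>random_tail_avoids\<close>), this tail starts with a block, and the
  class retains positive measure above that block because it contains a random sequence there
  (\<open>random_in_full_measure\<close>). The argument is indifferent to the complexity of \<open>D\<close>, and hence to \<open>A\<close>.

  For the first equality it remains to see that \<open>MLR\<^sup>A \<subseteq> MLR\<close>, that is, that an empty oracle can be
  computed (\<open>eval_oracle_free\<close>).
\<close>

section \<open>Functions computable in an oracle\<close>

text \<open>
  The arity \<open>k\<close> is explicit because a program such as \<open>Proj i\<close> or \<open>Succ\<close> is total only on
  lists of suitable lengths. Predicates and string-valued functions are handled through their
  characteristic function and their code, so that one set of closure rules covers all three; an
  expression under a binder refers to the bound value as \<open>ys ! 0\<close> and to the outer arguments as
  \<open>tl ys\<close>.
\<close>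

definition recfn :: "cantor \<Rightarrow> nat \<Rightarrow> (nat list \<Rightarrow> nat) \<Rightarrow> bool" where
  "recfn A k f \<longleftrightarrow> (\<exists>p. \<forall>xs. length xs = k \<longrightarrow> eval A p xs = Some (f xs))"

abbreviation decfn :: "cantor \<Rightarrow> nat \<Rightarrow> (nat list \<Rightarrow> bool) \<Rightarrow> bool" where
  "decfn A k P \<equiv> recfn A k (\<lambda>xs. of_bool (P xs))"

abbreviation strfn :: "cantor \<Rightarrow> nat \<Rightarrow> (nat list \<Rightarrow> bool list) \<Rightarrow> bool" where
  "strfn A k s \<equiv> recfn A k (\<lambda>xs. string_code (s xs))"

lemma recfnI: "(\<And>xs. length xs = k \<Longrightarrow> eval A p xs = Some (f xs)) \<Longrightarrow> recfn A k f"
  unfolding recfn_def by blast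

lemma recfn_cong:
  "recfn A k f \<Longrightarrow> (\<And>xs. length xs = k \<Longrightarrow> f xs = g xs) \<Longrightarrow> recfn A k g"
  unfolding recfn_def by auto

lemma recfn_compose:
  assumes f: "recfn A (length gs) f" and gs: "\<And>g. g \<in> set gs \<Longrightarrow> recfn A k g"
  shows "recfn A k (\<lambda>xs. f (map (\<lambda>g. g xs) gs))"
proof -
  obtain p where p: "\<And>xs. length xs = length gs \<Longrightarrow> eval A p xs = Some (f xs)"
    using f unfolding recfn_def by blast
  have "\<forall>g\<in>set gs. \<exists>q. \<forall>xs. length xs = k \<longrightarrow> eval A q xs = Some (g xs)"
    using gs unfolding recfn_def by blast
  then obtain q where q: "\<And>g xs. g \<in> set gs \<Longrightarrow> length xs = k \<Longrightarrow> eval A (q g) xs = Some (g xs)"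
    by metis
  show ?thesis
  proof (rule recfnI[of _ _ "Comp p (map q gs)"])
    fix xs :: "nat list" assume "length xs = k"
    then have "map (\<lambda>h. eval A h xs) (map q gs) = map Some (map (\<lambda>g. g xs) gs)"
      using q by simp
    then show "eval A (Comp p (map q gs)) xs = Some (f (map (\<lambda>g. g xs) gs))"
      using p by (simp add: o_def Let_def image_iff del: map_map) (simp add: o_def)
  qed
qed

lemma recfn_nth: "i < k \<Longrightarrow> recfn A k (\<lambda>xs. xs ! i)"
  by (rule recfnI[of _ _ "Proj i"]) simp

lemma recfn_tl_nth:
  "Suc i < k \<Longrightarrow> recfn A k (\<lambda>xs. tl xs ! i)"
  "Suc (Suc i) < k \<Longrightarrow> recfn A k (\<lambda>xs. tl (tl xs) ! i)"
  "Suc (Suc (Suc i)) < k \<Longrightarrow> recfn A k (\<lambda>xs. tl (tl (tl xs)) ! i)"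
  "Suc (Suc (Suc (Suc i))) < k \<Longrightarrow> recfn A k (\<lambda>xs. tl (tl (tl (tl xs))) ! i)"
  by (rule recfn_cong, rule recfn_nth, assumption, simp add: nth_tl)+

text \<open>
  Rearranging and duplicating arguments is substitution of a list-valued function, which is
  computable when its length is constant and its components are computable.
\<close>

definition reclist :: "cantor \<Rightarrow> nat \<Rightarrow> nat \<Rightarrow> (nat list \<Rightarrow> nat list) \<Rightarrow> bool" where
  "reclist A k n G \<longleftrightarrow>
     (\<forall>xs. length xs = k \<longrightarrow> length (G xs) = n) \<and> (\<forall>i<n. recfn A k (\<lambda>xs. G xs ! i))"

lemma reclistI:
  "(\<And>xs. length xs = k \<Longrightarrow> length (G xs) = n) \<Longrightarrow> (\<And>i. i < n \<Longrightarrow> recfn A k (\<lambda>xs. G xs ! i)) \<Longrightarrow>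
   reclist A k n G"
  unfolding reclist_def by blast

lemma reclistD:
  assumes "reclist A k n G"
  shows "length xs = k \<Longrightarrow> length (G xs) = n" "i < n \<Longrightarrow> recfn A k (\<lambda>xs. G xs ! i)"
  using assms unfolding reclist_def by blast+

lemma reclist_id: "reclist A k k (\<lambda>xs. xs)"
  by (simp add: reclistI recfn_nth)

lemma reclist_Nil: "reclist A k 0 (\<lambda>xs. [])"
  by (simp add: reclistI)

lemma reclist_Cons:
  assumes "recfn A k a" "reclist A k n G" shows "reclist A k (Suc n) (\<lambda>xs. a xs # G xs)"
proof (rule reclistI)
  show "recfn A k (\<lambda>xs. (a xs # G xs) ! i)" if "i < Suc n" for i
    using that assms reclistD(2)[OF assms(2)] by (cases i) simp_all
qed (simp add: reclistD(1)[OF assms(2)])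

lemma reclist_tl:
  assumes "reclist A k (Suc n) G" shows "reclist A k n (\<lambda>xs. tl (G xs))"
proof (rule reclistI)
  fix i assume "i < n"
  show "recfn A k (\<lambda>xs. tl (G xs) ! i)"
  proof (rule recfn_cong[OF reclistD(2)[OF assms, of "Suc i"]])
    show "G xs ! Suc i = tl (G xs) ! i" if "length xs = k" for xs
      using reclistD(1)[OF assms that] \<open>i < n\<close> by (simp add: nth_tl)
  qed (use \<open>i < n\<close> in simp)
qed (simp add: reclistD(1)[OF assms])

lemma recfn_reclist:
  assumes f: "recfn A n f" and G: "reclist A k n G"
  shows "recfn A k (\<lambda>xs. f (G xs))"
proof -
  have "recfn A k (\<lambda>xs. f (map (\<lambda>g. g xs) (map (\<lambda>i xs. G xs ! i) [0..<n])))"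
  proof (rule recfn_compose)
    show "recfn A k g" if "g \<in> set (map (\<lambda>i xs. G xs ! i) [0..<n])" for g
      using that reclistD(2)[OF G] by auto
  qed (use f in simp)
  then show ?thesis
  proof (rule recfn_cong)
    fix xs :: "nat list" assume "length xs = k"
    then have "map (\<lambda>g. g xs) (map (\<lambda>i xs. G xs ! i) [0..<n]) = G xs"
      using reclistD(1)[OF G] by (intro nth_equalityI) simp_all
    then show "f (map (\<lambda>g. g xs) (map (\<lambda>i xs. G xs ! i) [0..<n])) = f (G xs)" by simp
  qed
qed

lemma recfn_tl: "recfn A k f \<Longrightarrow> recfn A (Suc k) (\<lambda>ys. f (tl ys))"
  by (rule recfn_reclist[OF _ reclist_tl[OF reclist_id]])

lemma recfn_apply1:
  assumes "recfn A 1 (\<lambda>xs. f (xs ! 0))" "recfn A k a"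
  shows "recfn A k (\<lambda>xs. f (a xs))"
  using recfn_compose[of A "[a]" "\<lambda>xs. f (xs ! 0)" k] assms by simp

lemma recfn_apply2:
  assumes "recfn A 2 (\<lambda>xs. f (xs ! 0) (xs ! 1))" "recfn A k a" "recfn A k b"
  shows "recfn A k (\<lambda>xs. f (a xs) (b xs))"
proof -
  have "recfn A k (\<lambda>xs. (\<lambda>xs. f (xs ! 0) (xs ! 1)) (map (\<lambda>g. g xs) [a, b]))"
    by (rule recfn_compose) (use assms in \<open>auto simp: numeral_2_eq_2\<close>)
  then show ?thesis by simp
qed

lemma recfn_zero: "recfn A k (\<lambda>xs. 0)"
  by (rule recfnI[of _ _ Zero]) simp

lemma recfn_Suc: "recfn A k f \<Longrightarrow> recfn A k (\<lambda>xs. Suc (f xs))"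
proof (rule recfn_apply1[of A Suc])
  show "recfn A 1 (\<lambda>xs. Suc (xs ! 0))"
    by (rule recfnI[of _ _ Succ]) (auto simp: length_Suc_conv)
qed

lemma recfn_const: "recfn A k (\<lambda>xs. n)"
  by (induction n) (auto intro: recfn_zero recfn_Suc)

lemma recfn_primrec:
  assumes n: "recfn A k n" and f: "recfn A k f"
    and g: "recfn A (Suc (Suc k)) (\<lambda>ys. g (ys ! 0) (ys ! 1) (tl (tl ys)))"
  shows "recfn A k (\<lambda>xs. rec_nat (f xs) (\<lambda>m r. g m r xs) (n xs))"
proof -
  obtain pf pg where
    pf: "\<And>xs. length xs = k \<Longrightarrow> eval A pf xs = Some (f xs)" and
    pg: "\<And>ys. length ys = Suc (Suc k) \<Longrightarrow> eval A pg ys = Some (g (ys ! 0) (ys ! 1) (tl (tl ys)))"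
    using f g unfolding recfn_def by blast
  have "eval A (PrimRec pf pg) (m # xs) = Some (rec_nat (f xs) (\<lambda>m r. g m r xs) m)"
    if "length xs = k" for m xs
    using that by (induction m) (simp_all add: pf pg)
  then have "recfn A (Suc k) (\<lambda>ys. rec_nat (f (tl ys)) (\<lambda>m r. g m r (tl ys)) (ys ! 0))"
    by (intro recfnI[of _ _ "PrimRec pf pg"]) (auto simp: length_Suc_conv simp del: eval.simps)
  from recfn_reclist[OF this reclist_Cons[OF n reclist_id]] show ?thesis by simp
qed

subsection \<open>Arithmetic\<close>

lemma recfn_plus:
  assumes "recfn A k f" "recfn A k g" shows "recfn A k (\<lambda>xs. f xs + g xs)"
proof (rule recfn_apply2[OF _ assms])
  have "recfn A 2 (\<lambda>xs. rec_nat (xs ! 0) (\<lambda>m r. Suc r) (xs ! 1))"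
    by (rule recfn_primrec) (auto intro!: recfn_nth recfn_Suc)
  moreover have "rec_nat a (\<lambda>m r. Suc r) b = a + b" for a b by (induction b) auto
  ultimately show "recfn A 2 (\<lambda>xs. xs ! 0 + xs ! 1)" by simp
qed

lemma recfn_times:
  assumes "recfn A k f" "recfn A k g" shows "recfn A k (\<lambda>xs. f xs * g xs)"
proof (rule recfn_apply2[OF _ assms])
  have "recfn A 2 (\<lambda>xs. rec_nat 0 (\<lambda>m r. r + xs ! 0) (xs ! 1))"
    by (rule recfn_primrec) (auto intro!: recfn_nth recfn_tl_nth recfn_plus recfn_zero)
  moreover have "rec_nat 0 (\<lambda>m r. r + a) b = a * b" for a b :: nat by (induction b) auto
  ultimately show "recfn A 2 (\<lambda>xs. xs ! 0 * xs ! 1)" by simp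
qed

lemma recfn_power:
  assumes "recfn A k f" "recfn A k g" shows "recfn A k (\<lambda>xs. f xs ^ g xs)"
proof (rule recfn_apply2[OF _ assms])
  have "recfn A 2 (\<lambda>xs. rec_nat 1 (\<lambda>m r. xs ! 0 * r) (xs ! 1))"
    by (rule recfn_primrec) (auto intro!: recfn_nth recfn_tl_nth recfn_times recfn_const)
  moreover have "rec_nat 1 (\<lambda>m r. a * r) b = a ^ b" for a b :: nat by (induction b) auto
  ultimately show "recfn A 2 (\<lambda>xs. xs ! 0 ^ xs ! 1)" by simp
qed

lemma recfn_minus:
  assumes "recfn A k f" "recfn A k g" shows "recfn A k (\<lambda>xs. f xs - g xs)"
proof (rule recfn_apply2[OF _ assms])
  have "recfn A 1 (\<lambda>xs. rec_nat 0 (\<lambda>m r. m) (xs ! 0))"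
    by (rule recfn_primrec) (auto intro!: recfn_nth recfn_zero)
  moreover have "rec_nat 0 (\<lambda>m r. m) n = n - Suc 0" for n :: nat by (cases n) auto
  ultimately have pred: "recfn A k (\<lambda>xs. g xs - Suc 0)" if "recfn A k g" for k g
    using recfn_apply1[of A "\<lambda>n. n - Suc 0", OF _ that] by simp
  have "recfn A 2 (\<lambda>xs. rec_nat (xs ! 0) (\<lambda>m r. r - 1) (xs ! 1))"
    by (rule recfn_primrec) (auto intro!: recfn_nth pred)
  moreover have "rec_nat a (\<lambda>m r. r - 1) b = a - b" for a b :: nat by (induction b) auto
  ultimately show "recfn A 2 (\<lambda>xs. xs ! 0 - xs ! 1)" by simp
qed

text \<open>
  Bounded sums are primitive recursive, and bounded quantifiers, division and the length of a string
  are all obtained by counting, that is, as sums of truth values.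
\<close>

lemma recfn_sum:
  assumes "recfn A k b" "recfn A (Suc k) (\<lambda>ys. h (ys ! 0) (tl ys))"
  shows "recfn A k (\<lambda>xs. \<Sum>i<b xs. h i xs)"
proof -
  have "reclist A (Suc (Suc k)) (Suc k) (\<lambda>ys. ys ! 0 # tl (tl ys))"
    by (intro reclist_Cons reclist_tl reclist_id recfn_nth) simp
  from recfn_reclist[OF assms(2) this]
  have h: "recfn A (Suc (Suc k)) (\<lambda>ys. h (ys ! 0) (tl (tl ys)))" by simp
  have "recfn A k (\<lambda>xs. rec_nat 0 (\<lambda>m r. r + h m xs) (b xs))"
    by (rule recfn_primrec) (use h assms in \<open>auto intro!: recfn_plus recfn_nth recfn_zero\<close>)
  moreover have "rec_nat 0 (\<lambda>m r. r + g m) c = (\<Sum>i<c. g i)" for g :: "nat \<Rightarrow> nat" and c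
    by (induction c) auto
  ultimately show ?thesis by simp
qed

subsection \<open>Decidable predicates\<close>

lemma decfn_eq_0:
  assumes "recfn A k f" shows "decfn A k (\<lambda>xs. f xs = 0)"
  by (rule recfn_cong[OF recfn_minus[OF recfn_const[of A k 1] assms]]) simp

lemma decfn_not:
  assumes "decfn A k P" shows "decfn A k (\<lambda>xs. \<not> P xs)"
  using decfn_eq_0[OF assms] by simp

lemma decfn_and:
  assumes "decfn A k P" "decfn A k Q" shows "decfn A k (\<lambda>xs. P xs \<and> Q xs)"
  using recfn_times[OF assms] by (simp only: of_bool_conj)

lemma decfn_or:
  assumes "decfn A k P" "decfn A k Q" shows "decfn A k (\<lambda>xs. P xs \<or> Q xs)"
  using decfn_not[OF decfn_and[OF assms[THEN decfn_not]]] by simp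

lemma decfn_le:
  assumes "recfn A k f" "recfn A k g" shows "decfn A k (\<lambda>xs. f xs \<le> g xs)"
  using decfn_eq_0[OF recfn_minus[OF assms]] by simp

lemma decfn_eq:
  assumes "recfn A k f" "recfn A k g" shows "decfn A k (\<lambda>xs. f xs = g xs)"
  using decfn_and[OF decfn_le[OF assms] decfn_le[OF assms(2,1)]] by (simp add: eq_iff)

lemma recfn_if:
  assumes "decfn A k P" "recfn A k f" "recfn A k g"
  shows "recfn A k (\<lambda>xs. if P xs then f xs else g xs)"
  by (rule recfn_cong[OF recfn_plus[OF recfn_times[OF assms(1,2)]
        recfn_times[OF decfn_not[OF assms(1)] assms(3)]]]) auto

lemma decfn_ex_less:
  assumes "recfn A k b" "decfn A (Suc k) (\<lambda>ys. P (ys ! 0) (tl ys))"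
  shows "decfn A k (\<lambda>xs. \<exists>i<b xs. P i xs)"
proof -
  have "(\<exists>i<c. Q i) \<longleftrightarrow> \<not> (\<Sum>i<c. of_bool (Q i)) = (0::nat)" for c :: nat and Q
    by (simp only: sum_eq_0_iff[OF finite_lessThan]) auto
  then show ?thesis
    using decfn_not[OF decfn_eq_0[OF recfn_sum[where h = "\<lambda>i xs. of_bool (P i xs)", OF assms]]]
    by (simp only: not_not)
qed

lemma decfn_ex_le:
  assumes "recfn A k b" "decfn A (Suc k) (\<lambda>ys. P (ys ! 0) (tl ys))"
  shows "decfn A k (\<lambda>xs. \<exists>i\<le>b xs. P i xs)"
  using decfn_ex_less[OF recfn_Suc[OF assms(1)] assms(2)] by (simp add: less_Suc_eq_le)

lemma decfn_all_less:
  assumes "recfn A k b" "decfn A (Suc k) (\<lambda>ys. P (ys ! 0) (tl ys))"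
  shows "decfn A k (\<lambda>xs. \<forall>i<b xs. P i xs)"
  using decfn_not[OF decfn_ex_less[where P = "\<lambda>i xs. \<not> P i xs", OF assms(1) decfn_not[OF assms(2)]]]
  by simp

lemma decfn_all_le:
  assumes "recfn A k b" "decfn A (Suc k) (\<lambda>ys. P (ys ! 0) (tl ys))"
  shows "decfn A k (\<lambda>xs. \<forall>i\<le>b xs. P i xs)"
  using decfn_all_less[OF recfn_Suc[OF assms(1)] assms(2)] by (simp add: less_Suc_eq_le)

lemma recfn_div:
  assumes "recfn A k f" "recfn A k g" shows "recfn A k (\<lambda>xs. f xs div g xs)"
proof (rule recfn_apply2[OF _ assms])
  have "recfn A 2 (\<lambda>xs. if xs ! 1 = 0 then 0
      else \<Sum>i<xs ! 0. of_bool (Suc i * xs ! 1 \<le> xs ! 0))"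
    by (auto intro!: recfn_if decfn_eq_0 recfn_nth recfn_tl_nth recfn_sum decfn_le recfn_times
        recfn_Suc recfn_zero)
  moreover have "(if b = 0 then 0 else \<Sum>i<a. of_bool (Suc i * b \<le> a)) = a div b" for a b :: nat
  proof (cases "b = 0")
    case False
    have "i < a \<and> Suc i * b \<le> a \<longleftrightarrow> i < a div b" for i
      using False less_eq_div_iff_mult_less_eq[of b "Suc i" a]
      by (metis Suc_le_eq div_le_dividend gr0I order_less_le_trans)
    then have "{..<a} \<inter> {i. Suc i * b \<le> a} = {..<a div b}"
      unfolding set_eq_iff Int_iff mem_Collect_eq lessThan_iff by blast
    moreover have "(\<Sum>i<a. of_bool (Suc i * b \<le> a)) = card ({..<a} \<inter> {i. Suc i * b \<le> a})"
      by simp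
    ultimately show ?thesis using False by simp
  qed simp
  ultimately show "recfn A 2 (\<lambda>xs. xs ! 0 div xs ! 1)" by (simp only:)
qed

lemmas recfn_intros = recfn_nth recfn_tl_nth recfn_const recfn_Suc recfn_plus recfn_times
  recfn_power recfn_minus recfn_div recfn_sum recfn_if decfn_not decfn_and decfn_or
  decfn_le decfn_eq decfn_ex_less decfn_ex_le decfn_all_less decfn_all_le

section \<open>Binary strings\<close>

lemma string_code_Nil [simp]: "string_code [] = 0"
  by (simp add: string_code_def)

lemma string_code_snoc: "string_code (\<sigma> @ [b]) = 2 * string_code \<sigma> + (if b then 2 else 1)"
  by (simp add: string_code_def)

lemma string_code_append: "string_code (\<sigma> @ \<tau>) = string_code \<sigma> * 2 ^ length \<tau> + string_code \<tau>"
proof (induction \<tau> rule: rev_induct)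
  case (snoc b \<tau>)
  then show ?case
    using string_code_snoc[of "\<sigma> @ \<tau>" b] string_code_snoc[of \<tau> b] by (simp add: algebra_simps)
qed simp

lemma string_code_bounds: "2 ^ length \<sigma> \<le> Suc (string_code \<sigma>)" "Suc (string_code \<sigma>) < 2 ^ Suc (length \<sigma>)"
  by (induction \<sigma> rule: rev_induct) (auto simp: string_code_snoc)

lemma inj_string_code: "inj string_code"
proof (rule injI)
  fix \<sigma> \<tau> :: "bool list" assume "string_code \<sigma> = string_code \<tau>"
  then show "\<sigma> = \<tau>"
  proof (induction \<sigma> arbitrary: \<tau> rule: rev_induct)
    case Nil
    then show ?case by (cases \<tau> rule: rev_cases) (auto simp: string_code_snoc split: if_splits)
  next
    case (snoc b \<sigma>)
    then show ?case
      by (cases \<tau> rule: rev_cases) (auto simp: string_code_snoc split: if_splits; presburger)+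
  qed
qed

lemma surj_string_code: "surj string_code"
proof -
  have "\<exists>\<sigma>. string_code \<sigma> = n" for n
  proof (induction n rule: less_induct)
    case (less n)
    show ?case
    proof (cases "n = 0")
      case False
      define m where "m = (n - 1) div 2"
      from less[of m] False obtain \<sigma> where \<sigma>: "string_code \<sigma> = m" unfolding m_def by fastforce
      have "n = 2 * m + 2 \<or> n = 2 * m + 1" using False unfolding m_def by presburger
      then show ?thesis using string_code_snoc[of \<sigma> True] string_code_snoc[of \<sigma> False] \<sigma> by auto
    qed (auto intro: exI[of _ "[]"])
  qed
  then show ?thesis by (metis surjI)
qed

definition string_of :: "nat \<Rightarrow> bool list" where
  "string_of = inv string_code"

lemma string_of_code [simp]: "string_of (string_code \<sigma>) = \<sigma>"
  by (simp add: string_of_def inj_string_code)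

lemma code_string_of [simp]: "string_code (string_of n) = n"
  by (simp add: string_of_def surj_f_inv_f surj_string_code)

lemma recfn_string_of: "recfn A k f \<Longrightarrow> strfn A k (\<lambda>xs. string_of (f xs))"
  by simp

text \<open>
  The code of a string of length \<open>n\<close> lies between \<open>2^n - 1\<close> and \<open>2^(n+1) - 2\<close>, so the length counts
  the powers of two that do not exceed the successor of the code.
\<close>

lemma recfn_length:
  assumes "strfn A k s" shows "recfn A k (\<lambda>xs. length (s xs))"
proof -
  have "(\<Sum>i<string_code \<sigma>. of_bool (2 ^ Suc i \<le> Suc (string_code \<sigma>))) = length \<sigma>" for \<sigma>
  proof -
    have "i < string_code \<sigma> \<and> 2 ^ Suc i \<le> Suc (string_code \<sigma>) \<longleftrightarrow> i < length \<sigma>" for i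
    proof
      assume "i < string_code \<sigma> \<and> 2 ^ Suc i \<le> Suc (string_code \<sigma>)"
      then have "(2::nat) ^ Suc i < 2 ^ Suc (length \<sigma>)" using string_code_bounds[of \<sigma>] by linarith
      then show "i < length \<sigma>" by simp
    next
      assume i: "i < length \<sigma>"
      then have "(2::nat) ^ Suc i \<le> 2 ^ length \<sigma>" by (intro power_increasing) auto
      moreover have "Suc i < 2 ^ Suc i" by (rule less_exp)
      ultimately show "i < string_code \<sigma> \<and> 2 ^ Suc i \<le> Suc (string_code \<sigma>)"
        using string_code_bounds[of \<sigma>] by linarith
    qed
    then have "{..<string_code \<sigma>} \<inter> {i. 2 ^ Suc i \<le> Suc (string_code \<sigma>)} = {..<length \<sigma>}"
      unfolding set_eq_iff Int_iff mem_Collect_eq lessThan_iff by blast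
    moreover have "(\<Sum>i<string_code \<sigma>. of_bool (2 ^ Suc i \<le> Suc (string_code \<sigma>))) =
      card ({..<string_code \<sigma>} \<inter> {i. 2 ^ Suc i \<le> Suc (string_code \<sigma>)})" by simp
    ultimately show ?thesis by (simp only: card_lessThan)
  qed
  moreover have "recfn A k (\<lambda>xs. (\<lambda>c. \<Sum>i<c. of_bool (2 ^ Suc i \<le> Suc c)) (string_code (s xs)))"
    by (rule recfn_apply1[OF _ assms]) (intro recfn_intros; simp)
  ultimately show ?thesis by simp
qed

lemma recfn_append:
  assumes "strfn A k s" "strfn A k t" shows "strfn A k (\<lambda>xs. s xs @ t xs)"
  unfolding string_code_append by (intro recfn_intros recfn_length assms)

lemma recfn_Nil: "strfn A k (\<lambda>xs. [])"
  by (simp add: recfn_const)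

text \<open>
  With a leading 1 prepended, the successor of the code is the binary value of the string;
  truncating a string is division by a power of two.
\<close>

lemma string_code_take:
  "string_code (take i \<sigma>) = (Suc (string_code \<sigma>)) div 2 ^ (length \<sigma> - i) - 1"
proof -
  let ?l = "length \<sigma> - i"
  have "string_code \<sigma> = string_code (take i \<sigma>) * 2 ^ ?l + string_code (drop i \<sigma>)"
    using string_code_append[of "take i \<sigma>" "drop i \<sigma>"] by simp
  then have *: "Suc (string_code \<sigma>) =
      Suc (string_code (take i \<sigma>)) * 2 ^ ?l + (Suc (string_code (drop i \<sigma>)) - 2 ^ ?l)"
    using string_code_bounds(1)[of "drop i \<sigma>"] by simp
  have "Suc (string_code (drop i \<sigma>)) - 2 ^ ?l < 2 ^ ?l"
    using string_code_bounds[of "drop i \<sigma>"] by simp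
  then show ?thesis
    unfolding * by (subst div_mult_self3) simp_all
qed

lemma recfn_take:
  assumes "strfn A k s" "recfn A k f" shows "strfn A k (\<lambda>xs. take (f xs) (s xs))"
  unfolding string_code_take by (intro recfn_intros recfn_length assms)

lemma recfn_drop:
  assumes "strfn A k s" "recfn A k f" shows "strfn A k (\<lambda>xs. drop (f xs) (s xs))"
proof -
  have "string_code (drop i \<sigma>) = string_code \<sigma> - string_code (take i \<sigma>) * 2 ^ (length \<sigma> - i)" for i \<sigma>
    using string_code_append[of "take i \<sigma>" "drop i \<sigma>"] by simp
  then show ?thesis
    by (simp only:) (intro recfn_intros recfn_length recfn_take assms)
qed

lemma recfn_if_string:
  assumes "decfn A k P" "strfn A k s" "strfn A k t"
  shows "strfn A k (\<lambda>xs. if P xs then s xs else t xs)"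
  using recfn_if[OF assms] by (simp add: if_distrib[of string_code])

lemma decfn_string_eq:
  assumes "strfn A k s" "strfn A k t" shows "decfn A k (\<lambda>xs. s xs = t xs)"
  using decfn_eq[OF assms] by (simp add: inj_eq[OF inj_string_code])

lemma recfn_primrec_string:
  assumes "recfn A k n" and "strfn A k s"
    and "strfn A (Suc (Suc k)) (\<lambda>ys. g (ys ! 0) (string_of (ys ! 1)) (tl (tl ys)))"
  shows "strfn A k (\<lambda>xs. rec_nat (s xs) (\<lambda>m r. g m r xs) (n xs))"
proof -
  have "string_code (rec_nat a f m) =
      rec_nat (string_code a) (\<lambda>m r. string_code (f m (string_of r))) m" for a f m
    by (induction m) (simp, metis nat.rec(2) string_of_code)
  then show ?thesis
    by (simp only:) (rule recfn_primrec[OF assms(1,2)], rule assms(3))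
qed

abbreviation strings :: "nat \<Rightarrow> bool list set" where
  "strings n \<equiv> {\<tau>. length \<tau> = n}"

lemma finite_strings [simp]: "finite (strings n)"
  using finite_lists_length_eq[of "UNIV :: bool set" n] by simp

lemma card_strings: "card (strings n) = 2 ^ n"
  using card_lists_length_eq[of "UNIV :: bool set" n] by (simp add: card_UNIV_bool)

text \<open>
  The strings of length \<open>n\<close> have codes below \<open>2^(n+1)\<close>. Summing over them is what makes the measure
  of a clopen set computable.
\<close>

lemma recfn_sum_strings:
  assumes n: "recfn A k n"
    and g: "recfn A (Suc k) (\<lambda>ys. g (string_of (ys ! 0)) (tl ys))"
  shows "recfn A k (\<lambda>xs. \<Sum>\<tau>\<in>strings (n xs). g \<tau> xs)"
proof -
  have *: "(\<Sum>\<tau>\<in>strings m. f \<tau>) =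
      (\<Sum>i<2 ^ Suc m. if length (string_of i) = m then f (string_of i) else 0)" for m and f :: "bool list \<Rightarrow> nat"
  proof -
    have "(\<Sum>\<tau>\<in>strings m. f \<tau>) = (\<Sum>i\<in>string_code ` strings m. f (string_of i))"
      by (subst sum.reindex) (auto simp: inj_on_def inj_eq[OF inj_string_code])
    also have "\<dots> = (\<Sum>i<2 ^ Suc m. if length (string_of i) = m then f (string_of i) else 0)"
    proof (rule sum.mono_neutral_cong_left)
      show "string_code ` strings m \<subseteq> {..<2 ^ Suc m}"
        using string_code_bounds(2) Suc_lessD by blast
      show "\<forall>i\<in>{..<2 ^ Suc m} - string_code ` strings m.
          (if length (string_of i) = m then f (string_of i) else 0) = 0"
        by (auto simp: image_iff) (metis code_string_of)
    qed auto
    finally show ?thesis .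
  qed
  show ?thesis
    unfolding *
    by (intro recfn_sum recfn_if g recfn_intros recfn_length recfn_string_of recfn_tl[OF n]) (simp_all add: n)
qed

lemma recfn_card_strings:
  assumes "recfn A k n" and "decfn A (Suc k) (\<lambda>ys. P (string_of (ys ! 0)) (tl ys))"
  shows "recfn A k (\<lambda>xs. card {\<tau>\<in>strings (n xs). P \<tau> xs})"
proof -
  have "card {\<tau>\<in>strings m. Q \<tau>} = (\<Sum>\<tau>\<in>strings m. of_bool (Q \<tau>))" for m Q
    using sum.inter_filter[of "strings m" "\<lambda>_. 1::nat" Q] by (simp add: of_bool_def)
  then show ?thesis
    using recfn_sum_strings[where g = "\<lambda>\<tau> xs. of_bool (P \<tau> xs)", OF assms] by (simp only:)
qed

lemma decfn_ex_strings:
  assumes "recfn A k n" and "decfn A (Suc k) (\<lambda>ys. P (string_of (ys ! 0)) (tl ys))"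
  shows "decfn A k (\<lambda>xs. \<exists>\<tau>\<in>strings (n xs). P \<tau> xs)"
proof -
  have "(\<exists>\<tau>\<in>strings m. Q \<tau>) \<longleftrightarrow> card {\<tau>\<in>strings m. Q \<tau>} \<noteq> 0" for m Q
    by auto
  then show ?thesis
    using decfn_not[OF decfn_eq_0[OF recfn_card_strings[OF assms]]] by (simp only:)
qed

lemmas string_intros = recfn_string_of recfn_length recfn_append recfn_Nil recfn_take recfn_drop
  recfn_if_string decfn_string_eq recfn_sum_strings recfn_card_strings decfn_ex_strings

section \<open>Computably enumerable open sets\<close>

text \<open>
  Evaluation in which every minimization may search only among the numbers in \<open>B\<close>. For \<open>B = UNIV\<close>
  this is evaluation proper, and for \<open>B = {..<t}\<close> it is a total computable approximation. Allowing
  arbitrary \<open>B\<close> makes soundness of the approximations an instance of monotonicity.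
\<close>

fun beval :: "cantor \<Rightarrow> nat set \<Rightarrow> prog \<Rightarrow> nat list \<Rightarrow> nat option" where
  "beval A B Zero xs = Some 0"
| "beval A B Succ xs = (case xs of [x] \<Rightarrow> Some (Suc x) | _ \<Rightarrow> None)"
| "beval A B (Proj i) xs = (if i < length xs then Some (xs ! i) else None)"
| "beval A B Oracle xs = (case xs of [x] \<Rightarrow> Some (if A x then 1 else 0) | _ \<Rightarrow> None)"
| "beval A B (Comp f gs) xs =
     (let rs = map (\<lambda>g. beval A B g xs) gs
      in if None \<in> set rs then None else beval A B f (map the rs))"
| "beval A B (PrimRec f g) xs =
     (case xs of
        [] \<Rightarrow> None
      | n # ys \<Rightarrow>
          rec_nat (beval A B f ys) (\<lambda>m r. Option.bind r (\<lambda>v. beval A B g (m # v # ys))) n)"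
| "beval A B (Mu f) xs =
     (if \<exists>n\<in>B. beval A B f (n # xs) = Some 0 \<and> (\<forall>m<n. beval A B f (m # xs) \<noteq> None)
      then Some (LEAST n. beval A B f (n # xs) = Some 0)
      else None)"

lemma beval_UNIV: "beval A UNIV p xs = eval A p xs"
proof (induction p arbitrary: xs)
  case (Comp f gs)
  then have "map (\<lambda>g. beval A UNIV g xs) gs = map (\<lambda>g. eval A g xs) gs" by simp
  then show ?case by (simp only: beval.simps eval.simps Comp.IH(1))
qed (simp_all split: list.split)

lemma composition_eq_Some:
  "(let rs = map h gs in if None \<in> set rs then None else F (map the rs)) = Some v \<longleftrightarrow>
   (\<forall>g\<in>set gs. h g \<noteq> None) \<and> F (map (\<lambda>g. the (h g)) gs) = Some v"
proof -
  have "None \<in> set (map h gs) \<longleftrightarrow> \<not> (\<forall>g\<in>set gs. h g \<noteq> None)" by (auto simp: image_iff) metis+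
  then show ?thesis by (simp add: Let_def o_def)
qed

lemma beval_mono:
  assumes "beval A B p xs = Some v" "B \<subseteq> B'"
  shows "beval A B' p xs = Some v"
  using assms(1)
proof (induction p arbitrary: xs v)
  case (Comp f gs)
  have def: "\<forall>g\<in>set gs. beval A B g xs \<noteq> None"
    and v: "beval A B f (map (\<lambda>g. the (beval A B g xs)) gs) = Some v"
    using Comp.prems unfolding beval.simps composition_eq_Some by blast+
  have same: "\<forall>g\<in>set gs. beval A B' g xs = beval A B g xs" using Comp.IH(2) def by fastforce
  then have "map (\<lambda>g. the (beval A B' g xs)) gs = map (\<lambda>g. the (beval A B g xs)) gs" by simp
  with def same Comp.IH(1)[OF v] show ?case by (simp only: beval.simps composition_eq_Some) simp
next
  case (PrimRec f g)
  then obtain n ys where xs: "xs = n # ys" by (cases xs) auto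
  have "rec_nat (beval A B' f ys) (\<lambda>m r. Option.bind r (\<lambda>v. beval A B' g (m # v # ys))) n = Some v"
    if "rec_nat (beval A B f ys) (\<lambda>m r. Option.bind r (\<lambda>v. beval A B g (m # v # ys))) n = Some v"
    for n v
    using that
  proof (induction n arbitrary: v)
    case 0
    then show ?case using PrimRec.IH(1) by simp
  next
    case (Suc n)
    then show ?case using PrimRec.IH(2) by (auto simp: bind_eq_Some_conv)
  qed
  then show ?case using PrimRec.prems by (simp add: xs)
next
  case (Mu f)
  let ?Z = "\<lambda>B n. beval A B f (n # xs) = Some 0"
  obtain n where n: "n \<in> B" "?Z B n" and def: "\<And>m. m < n \<Longrightarrow> beval A B f (m # xs) \<noteq> None"
    and v: "v = (LEAST n. ?Z B n)"
    using Mu.prems by (auto split: if_splits)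
  have same: "beval A B' f (m # xs) = beval A B f (m # xs)" if "m \<le> n" for m
    using that n(2) def[of m] Mu.IH by (cases "m = n") auto
  have "v \<le> n" "?Z B v" unfolding v by (auto intro: Least_le LeastI n(2))
  have "(LEAST n. ?Z B' n) = v"
  proof (rule Least_equality)
    show "?Z B' v" using same[OF \<open>v \<le> n\<close>] \<open>?Z B v\<close> by simp
    show "v \<le> m" if "?Z B' m" for m
    proof (cases "m \<le> n")
      case True
      then have "?Z B m" using that same by simp
      then show ?thesis unfolding v by (rule Least_le)
    qed (use \<open>v \<le> n\<close> in simp)
  qed
  moreover have "n \<in> B'" using n(1) assms(2) by auto
  moreover have "?Z B' n \<and> (\<forall>m<n. beval A B' f (m # xs) \<noteq> None)"
    using same n(2) def by (simp add: less_imp_le)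
  ultimately have "\<exists>n\<in>B'. ?Z B' n \<and> (\<forall>m<n. beval A B' f (m # xs) \<noteq> None)" by blast
  with \<open>(LEAST n. ?Z B' n) = v\<close> show ?case by (simp only: beval.simps if_True)
qed (simp_all split: list.splits)

text \<open>
  A convergent computation performs finitely many searches, hence is unaffected by every large enough
  bound; the filter \<open>sequentially\<close> takes care of the maxima of bounds.
\<close>

lemma beval_complete:
  assumes "eval A p xs = Some v"
  shows "\<forall>\<^sub>F t in sequentially. beval A {..<t} p xs = Some v"
  using assms
proof (induction p arbitrary: xs v)
  case (Comp f gs)
  have def: "\<forall>g\<in>set gs. eval A g xs \<noteq> None"
    and v: "eval A f (map (\<lambda>g. the (eval A g xs)) gs) = Some v"
    using Comp.prems unfolding eval.simps composition_eq_Some by blast+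
  have "\<forall>\<^sub>F t in sequentially. \<forall>g\<in>set gs. beval A {..<t} g xs = eval A g xs"
    using Comp.IH(2) def by (intro eventually_ball_finite) fastforce+
  with Comp.IH(1)[OF v] show ?case
  proof eventually_elim
    case (elim t)
    then have "map (\<lambda>g. the (beval A {..<t} g xs)) gs = map (\<lambda>g. the (eval A g xs)) gs" by simp
    with elim def show ?case by (simp only: beval.simps composition_eq_Some) simp
  qed
next
  case (PrimRec f g)
  then obtain n ys where xs: "xs = n # ys" by (cases xs) auto
  have "\<forall>\<^sub>F t in sequentially. rec_nat (beval A {..<t} f ys)
      (\<lambda>m r. Option.bind r (\<lambda>v. beval A {..<t} g (m # v # ys))) n = Some v"
    if "rec_nat (eval A f ys) (\<lambda>m r. Option.bind r (\<lambda>v. eval A g (m # v # ys))) n = Some v" for n v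
    using that
  proof (induction n arbitrary: v)
    case 0
    then show ?case using PrimRec.IH(1) by simp
  next
    case (Suc n)
    then obtain r where r: "rec_nat (eval A f ys) (\<lambda>m r. Option.bind r (\<lambda>v. eval A g (m # v # ys))) n = Some r"
      "eval A g (n # r # ys) = Some v"
      by (auto simp: bind_eq_Some_conv)
    from Suc.IH[OF r(1)] PrimRec.IH(2)[OF r(2)] show ?case
      by eventually_elim simp
  qed
  then show ?case using PrimRec.prems by (simp add: xs)
next
  case (Mu f)
  let ?Z = "\<lambda>n. eval A f (n # xs) = Some 0"
  obtain n where n: "?Z n" and def: "\<And>m. m < n \<Longrightarrow> eval A f (m # xs) \<noteq> None"
    and v: "v = (LEAST n. ?Z n)"
    using Mu.prems by (auto split: if_splits)
  have "\<forall>\<^sub>F t in sequentially. \<forall>m\<in>{..n}. beval A {..<t} f (m # xs) = eval A f (m # xs)"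
  proof (intro eventually_ball_finite ballI)
    fix m assume "m \<in> {..n}"
    then have "eval A f (m # xs) \<noteq> None" using n def[of m] by (cases "m = n") auto
    then show "\<forall>\<^sub>F t in sequentially. beval A {..<t} f (m # xs) = eval A f (m # xs)"
      using Mu.IH by auto
  qed simp
  moreover have "\<forall>\<^sub>F t in sequentially. n < t" by (rule eventually_gt_at_top)
  ultimately show ?case
  proof eventually_elim
    case (elim t)
    then have "beval A {..<t} f (n # xs) = Some 0 \<and> (\<forall>m<n. beval A {..<t} f (m # xs) \<noteq> None)"
      using n def by (simp add: less_imp_le)
    with elim(2) have "\<exists>n\<in>{..<t}. beval A {..<t} f (n # xs) = Some 0 \<and>
        (\<forall>m<n. beval A {..<t} f (m # xs) \<noteq> None)"
      unfolding Bex_def lessThan_iff by blast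
    then have "beval A {..<t} (Mu f) xs \<noteq> None" by (simp only: beval.simps if_True) simp
    then obtain w where w: "beval A {..<t} (Mu f) xs = Some w" by blast
    from beval_mono[OF this subset_UNIV] have "w = v" using Mu.prems by (simp only: beval_UNIV option.inject)
    with w show ?case by simp
  qed
qed (simp_all split: list.splits)

lemma eval_neq_None_iff:
  "eval A p xs \<noteq> None \<longleftrightarrow> (\<exists>t. beval A {..<t} p xs \<noteq> None)"
proof
  assume "eval A p xs \<noteq> None"
  then obtain v where "eval A p xs = Some v" by blast
  from eventually_happens[OF beval_complete[OF this]] show "\<exists>t. beval A {..<t} p xs \<noteq> None" by auto
next
  assume "\<exists>t. beval A {..<t} p xs \<noteq> None"
  then show "eval A p xs \<noteq> None" using beval_mono[OF _ subset_UNIV] by (force simp: beval_UNIV)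
qed

definition code_opt :: "nat option \<Rightarrow> nat" where
  "code_opt r = (case r of None \<Rightarrow> 0 | Some v \<Rightarrow> Suc v)"

lemma code_opt_simps [simp]:
  "code_opt None = 0" "code_opt (Some v) = Suc v" "code_opt r = 0 \<longleftrightarrow> r = None"
  "code_opt r = Suc v \<longleftrightarrow> r = Some v"
  by (auto simp: code_opt_def split: option.split)

lemma the_code_opt: "r \<noteq> None \<Longrightarrow> code_opt r - 1 = the r"
  by auto

lemma sum_eq_Least:
  fixes n t :: nat
  assumes "Q n" "n < t" shows "(\<Sum>i<t. of_bool (\<forall>m\<le>i. \<not> Q m)) = (LEAST n. Q n)"
proof -
  define l where "l = (LEAST n. Q n)"
  have l: "Q l" "l \<le> n" unfolding l_def using assms(1) by (rule LeastI, rule Least_le)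
  have "i < t \<and> (\<forall>m\<le>i. \<not> Q m) \<longleftrightarrow> i < l" for i
  proof
    show "i < l" if "i < t \<and> (\<forall>m\<le>i. \<not> Q m)" using that l(1) not_le by blast
    show "i < t \<and> (\<forall>m\<le>i. \<not> Q m)" if "i < l"
    proof (intro conjI allI impI)
      show "i < t" using that l(2) assms(2) by linarith
      show "\<not> Q m" if "m \<le> i" for m
        using that \<open>i < l\<close> unfolding l_def by (intro not_less_Least) linarith
    qed
  qed
  then have "{..<t} \<inter> {i. \<forall>m\<le>i. \<not> Q m} = {..<l}"
    unfolding set_eq_iff Int_iff mem_Collect_eq lessThan_iff by blast
  moreover have "(\<Sum>i<t. of_bool (\<forall>m\<le>i. \<not> Q m)) = card ({..<t} \<inter> {i. \<forall>m\<le>i. \<not> Q m})" by simp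
  ultimately show ?thesis by (simp only: card_lessThan l_def)
qed

text \<open>
  By recursion on the program: the search of \<open>Mu\<close> is now bounded, so the lack of a value is decidable, can
  be signalled by the value 0 and propagated through compositions and recursions. This replaces a
  universal machine, since each program is approximated separately.
\<close>

lemma recfn_beval: "recfn A (Suc k) (\<lambda>ys. code_opt (beval A {..<ys ! 0} p (tl ys)))"
proof (induction p arbitrary: k)
  case Zero
  then show ?case by (simp add: recfn_const)
next
  case Succ
  show ?case
  proof (cases "k = 1")
    case True
    have "recfn A (Suc k) (\<lambda>ys. Suc (Suc (ys ! 1)))" by (intro recfn_intros) (use True in simp)
    then show ?thesis
      by (rule recfn_cong) (use True in \<open>auto simp: length_Suc_conv\<close>)
  next
    case False
    show ?thesis
      by (rule recfn_cong[OF recfn_zero]) (use False in \<open>auto split: list.splits dest!: arg_cong[where f = length]\<close>)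
  qed
next
  case (Proj i)
  then show ?case
    by (cases "i < k") (auto intro: recfn_cong[OF recfn_Suc[OF recfn_nth[of "Suc i"]]]
        recfn_cong[OF recfn_zero] simp: nth_tl)
next
  case Oracle
  show ?case
  proof (cases "k = 1")
    case True
    have "recfn A 1 (\<lambda>xs. of_bool (A (xs ! 0)))"
      by (rule recfnI[of _ _ Oracle]) (auto simp: length_Suc_conv)
    then have "recfn A (Suc k) (\<lambda>ys. Suc (of_bool (A (ys ! 1))))"
      by (rule recfn_Suc[OF recfn_apply1[OF _ recfn_nth]]) (use True in simp)
    then show ?thesis
      by (rule recfn_cong) (use True in \<open>auto simp: length_Suc_conv\<close>)
  next
    case False
    show ?thesis
      by (rule recfn_cong[OF recfn_zero]) (use False in \<open>auto split: list.splits dest!: arg_cong[where f = length]\<close>)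
  qed
next
  case (Comp f gs)
  let ?v = "\<lambda>g ys. code_opt (beval A {..<ys ! 0} g (tl ys))"
  have fail: "decfn A (Suc k) (\<lambda>ys. \<exists>g\<in>set gs. ?v g ys = 0)"
    using Comp.IH(2)
  proof (induction gs)
    case (Cons g gs)
    have "decfn A (Suc k) (\<lambda>ys. ?v g ys = 0 \<or> (\<exists>g\<in>set gs. ?v g ys = 0))"
      by (intro decfn_or decfn_eq_0 Cons.IH Cons.prems) simp_all
    then show ?case by simp
  qed (simp add: recfn_zero)
  have "reclist A (Suc k) (length gs) (\<lambda>ys. map (\<lambda>g. ?v g ys - 1) gs)"
    unfolding reclist_def by (auto intro!: recfn_minus recfn_const Comp.IH(2))
  from recfn_reclist[OF Comp.IH(1) reclist_Cons[OF recfn_nth this, of 0]]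
  have "recfn A (Suc k) (\<lambda>ys. code_opt (beval A {..<ys ! 0} f (map (\<lambda>g. ?v g ys - 1) gs)))"
    by simp
  from recfn_if[OF fail recfn_zero this] show ?case
  proof (rule recfn_cong)
    fix ys :: "nat list"
    let ?rs = "map (\<lambda>g. beval A {..<ys ! 0} g (tl ys)) gs"
    have "None \<in> set ?rs \<longleftrightarrow> (\<exists>g\<in>set gs. ?v g ys = 0)"
      unfolding code_opt_simps(3) set_map image_iff by metis
    moreover have "map (\<lambda>g. ?v g ys - 1) gs = map the ?rs" if "\<not> None \<in> set ?rs"
      unfolding map_map
    proof (rule map_cong[OF refl])
      fix g assume "g \<in> set gs"
      with that have "beval A {..<ys ! 0} g (tl ys) \<noteq> None" unfolding set_map image_iff by metis
      then show "?v g ys - 1 = (the \<circ> (\<lambda>g. beval A {..<ys ! 0} g (tl ys))) g"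
        unfolding comp_apply by (rule the_code_opt)
    qed
    ultimately show "(if \<exists>g\<in>set gs. ?v g ys = 0 then 0
        else code_opt (beval A {..<ys ! 0} f (map (\<lambda>g. ?v g ys - 1) gs))) = ?v (Comp f gs) ys"
      unfolding beval.simps Let_def by (cases "None \<in> set ?rs") (simp_all only: if_True if_False not_False_eq_True True_implies_equals code_opt_simps)
  qed
next
  case (PrimRec f g)
  show ?case
  proof (cases k)
    case 0
    show ?thesis by (rule recfn_cong[OF recfn_zero]) (auto simp: 0 length_Suc_conv)
  next
    case (Suc j)
    let ?f = "\<lambda>t ys. code_opt (beval A {..<t} f ys)"
    let ?g = "\<lambda>t m r ys. if r = 0 then 0 else code_opt (beval A {..<t} g (m # (r - 1) # ys))"
    have "recfn A (Suc k) (\<lambda>zs. rec_nat (?f (zs ! 0) (tl (tl zs)))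
        (\<lambda>m r. ?g (zs ! 0) m r (tl (tl zs))) (zs ! 1))"
    proof (rule recfn_primrec)
      have "reclist A (Suc k) (Suc j) (\<lambda>zs. zs ! 0 # tl (tl zs))"
        using Suc by (intro reclist_Cons reclist_tl reclist_id recfn_nth) (auto intro: reclist_id)
      from recfn_reclist[OF PrimRec.IH(1) this]
      show "recfn A (Suc k) (\<lambda>zs. ?f (zs ! 0) (tl (tl zs)))" by simp
      let ?k = "Suc (Suc (Suc k))"
      have "reclist A ?k (Suc (Suc (Suc j)))
          (\<lambda>zs. tl (tl zs) ! 0 # zs ! 0 # (zs ! 1 - 1) # tl (tl (tl (tl zs))))"
        using Suc by (intro reclist_Cons reclist_tl reclist_id recfn_intros) (auto intro: reclist_id)
      from recfn_reclist[OF PrimRec.IH(2) this]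
      show "recfn A ?k (\<lambda>ys. ?g (tl (tl ys) ! 0) (ys ! 0) (ys ! 1) (tl (tl (tl (tl ys)))))"
        by (intro recfn_intros) simp_all
    qed (auto intro: recfn_nth simp: Suc)
    then show ?thesis
    proof (rule recfn_cong)
      fix zs :: "nat list" assume "length zs = Suc k"
      then obtain t n ys where zs: "zs = t # n # ys" using Suc by (auto simp: length_Suc_conv)
      have "rec_nat (?f t ys) (\<lambda>m r. ?g t m r ys) n =
        code_opt (rec_nat (beval A {..<t} f ys) (\<lambda>m r. Option.bind r (\<lambda>v. beval A {..<t} g (m # v # ys))) n)"
      proof (induction n)
        case (Suc n)
        then show ?case
          by (cases "rec_nat (beval A {..<t} f ys)
              (\<lambda>m r. Option.bind r (\<lambda>v. beval A {..<t} g (m # v # ys))) n") simp_all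
      qed simp
      moreover have "zs ! 0 = t" "zs ! 1 = n" "tl (tl zs) = ys" "tl zs = n # ys" by (simp_all add: zs)
      ultimately show "rec_nat (?f (zs ! 0) (tl (tl zs))) (\<lambda>m r. ?g (zs ! 0) m r (tl (tl zs))) (zs ! 1) =
         code_opt (beval A {..<zs ! 0} (PrimRec f g) (tl zs))"
        by (simp only: beval.simps list.case)
    qed
  qed
next
  case (Mu f)
  let ?v = "\<lambda>t n xs. code_opt (beval A {..<t} f (n # xs))"
  have "recfn A (Suc k) (\<lambda>ys. if \<exists>n<ys ! 0. ?v (ys ! 0) n (tl ys) = 1 \<and> (\<forall>m<n. ?v (ys ! 0) m (tl ys) \<noteq> 0)
    then Suc (\<Sum>n<ys ! 0. of_bool (\<forall>m\<le>n. ?v (ys ! 0) m (tl ys) \<noteq> 1)) else 0)"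
  proof -
    have v: "recfn A (Suc (Suc k)) (\<lambda>zs. ?v (tl zs ! 0) (zs ! 0) (tl (tl zs)))"
    proof -
      have "reclist A (Suc (Suc k)) (Suc (Suc k)) (\<lambda>zs. tl zs ! 0 # zs ! 0 # tl (tl zs))"
        by (intro reclist_Cons reclist_tl reclist_id recfn_intros) simp_all
      from recfn_reclist[OF Mu.IH this] show ?thesis by simp
    qed
    have v': "recfn A (Suc (Suc (Suc k))) (\<lambda>zs. ?v (tl (tl zs) ! 0) (zs ! 0) (tl (tl (tl zs))))"
    proof -
      have "reclist A (Suc (Suc (Suc k))) (Suc (Suc k)) (\<lambda>zs. tl (tl zs) ! 0 # zs ! 0 # tl (tl (tl zs)))"
        by (intro reclist_Cons reclist_tl reclist_id recfn_intros) simp_all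
      from recfn_reclist[OF Mu.IH this] show ?thesis by simp
    qed
    show ?thesis by (intro recfn_intros v v') simp_all
  qed
  then show ?case
  proof (rule recfn_cong)
    fix ys :: "nat list"
    define t xs where "t = ys ! 0" and "xs = tl ys"
    let ?P = "\<exists>n<t. ?v t n xs = 1 \<and> (\<forall>m<n. ?v t m xs \<noteq> 0)"
    let ?L = "LEAST n. beval A {..<t} f (n # xs) = Some 0"
    have one: "code_opt r = 1 \<longleftrightarrow> r = Some 0" for r by simp
    have least: "(\<Sum>n<t. of_bool (\<forall>m\<le>n. ?v t m xs \<noteq> 1)) = ?L" if ?P
      using that sum_eq_Least[of "\<lambda>n. beval A {..<t} f (n # xs) = Some 0"]
      unfolding one by blast
    have "?P \<longleftrightarrow> (\<exists>n\<in>{..<t}. beval A {..<t} f (n # xs) = Some 0 \<and>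
        (\<forall>m<n. beval A {..<t} f (m # xs) \<noteq> None))" (is "_ \<longleftrightarrow> ?P'")
      unfolding one code_opt_simps by (simp only: Bex_def lessThan_iff)
    then have "(if ?P then Suc (\<Sum>n<t. of_bool (\<forall>m\<le>n. ?v t m xs \<noteq> 1)) else 0) =
        code_opt (if ?P' then Some ?L else None)"
      using least by (cases ?P) (simp_all only: if_True if_False code_opt_simps True_implies_equals)
    then have "(if ?P then Suc (\<Sum>n<t. of_bool (\<forall>m\<le>n. ?v t m xs \<noteq> 1)) else 0) =
        code_opt (beval A {..<t} (Mu f) xs)"
      by (simp only: beval.simps)
    then show "(if \<exists>n<ys ! 0. ?v (ys ! 0) n (tl ys) = 1 \<and> (\<forall>m<n. ?v (ys ! 0) m (tl ys) \<noteq> 0)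
        then Suc (\<Sum>n<ys ! 0. of_bool (\<forall>m\<le>n. ?v (ys ! 0) m (tl ys) \<noteq> 1)) else 0) =
        code_opt (beval A {..<ys ! 0} (Mu f) (tl ys))"
      by (simp only: t_def xs_def)
  qed
qed

definition decidable_family :: "cantor \<Rightarrow> (nat \<Rightarrow> bool list \<Rightarrow> bool) \<Rightarrow> bool" where
  "decidable_family A D \<longleftrightarrow> decfn A 2 (\<lambda>xs. D (xs ! 0) (string_of (xs ! 1)))"

definition decidable :: "cantor \<Rightarrow> (bool list \<Rightarrow> bool) \<Rightarrow> bool" where
  "decidable A D \<longleftrightarrow> decfn A 1 (\<lambda>xs. D (string_of (xs ! 0)))"

lemma decfn_decidable_family:
  assumes "decidable_family A D" "recfn A k n" "strfn A k s"
  shows "decfn A k (\<lambda>xs. D (n xs) (s xs))"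
  using recfn_apply2[of A "\<lambda>x y. of_bool (D x (string_of y))", OF _ assms(2,3)] assms(1)
  by (simp add: decidable_family_def)

lemma decfn_decidable:
  assumes "decidable A D" "strfn A k s" shows "decfn A k (\<lambda>xs. D (s xs))"
  using recfn_apply1[of A "\<lambda>y. of_bool (D (string_of y))", OF _ assms(2)] assms(1)
  by (simp add: decidable_def)

text \<open>
  Every c.e. open set is generated by a decidable set of strings that is closed under extension. With
  such generators, membership of a sequence can be tested at any sufficiently long prefix.
\<close>

definition upward :: "(bool list \<Rightarrow> bool) \<Rightarrow> bool" where
  "upward D \<longleftrightarrow> (\<forall>\<sigma> \<tau>. D \<sigma> \<longrightarrow> D (\<sigma> @ \<tau>))"

lemma upwardD: "upward D \<Longrightarrow> D \<sigma> \<Longrightarrow> D (\<sigma> @ \<tau>)"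
  by (simp add: upward_def)

definition open_of :: "(bool list \<Rightarrow> bool) \<Rightarrow> cantor set" where
  "open_of D = {X. \<exists>m. D (prefix_of X m)}"

lemma length_prefix_of [simp]: "length (prefix_of X m) = m"
  by (simp add: prefix_of_def)

lemma prefix_of_0 [simp]: "prefix_of X 0 = []"
  by (simp add: prefix_of_def)

lemma prefix_of_Suc: "prefix_of X (Suc m) = prefix_of X m @ [X m]"
  by (simp add: prefix_of_def)

lemma take_prefix_of: "i \<le> m \<Longrightarrow> take i (prefix_of X m) = prefix_of X i"
  by (simp add: prefix_of_def take_map)

lemma upward_prefix_of:
  assumes "upward D" "D (prefix_of X m)" "m \<le> n" shows "D (prefix_of X n)"
  using upwardD[OF assms(1,2), of "drop m (prefix_of X n)"] assms(3)
  by (metis append_take_drop_id take_prefix_of)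

lemma in_cylinder_iff: "X \<in> cylinder \<sigma> \<longleftrightarrow> prefix_of X (length \<sigma>) = \<sigma>"
  by (simp add: cylinder_def)

text \<open>
  A string is accepted as soon as one of its prefixes is seen to be enumerated within a number of
  steps equal to the length of the string. Waiting in this way loses no sequence and turns an
  enumeration into a decision.
\<close>

lemma uniformly_ce_open_decidable:
  assumes "uniformly_ce_open A U"
  obtains D where "decidable_family A D" "\<And>n. upward (D n)" "\<And>n. U n = open_of (D n)"
proof -
  obtain p where U: "\<And>n. U n = (\<Union>\<sigma> \<in> {\<sigma>. eval A p [n, string_code \<sigma>] \<noteq> None}. cylinder \<sigma>)"
    using assms unfolding uniformly_ce_open_def ce2_def by auto
  define D where "D n \<sigma> \<longleftrightarrow>
    (\<exists>i\<le>length \<sigma>. code_opt (beval A {..<length \<sigma>} p [n, string_code (take i \<sigma>)]) \<noteq> 0)" for n \<sigma>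
  have beval_mono': "beval A {..<t} p ys \<noteq> None \<Longrightarrow> t \<le> t' \<Longrightarrow> beval A {..<t'} p ys \<noteq> None" for t t' ys
    using beval_mono[of A "{..<t}" p ys _ "{..<t'}"] by auto
  show ?thesis
  proof
    have "reclist A (Suc (Suc (Suc 0))) (Suc (Suc (Suc 0))) (\<lambda>xs. length (string_of (tl xs ! 1)) # tl xs ! 0 #
        [string_code (take (xs ! 0) (string_of (tl xs ! 1)))])"
      by (intro reclist_Cons reclist_Nil string_intros recfn_intros) simp_all
    from recfn_reclist[OF recfn_beval this]
    have "recfn A (Suc (Suc (Suc 0))) (\<lambda>xs. code_opt (beval A {..<length (string_of (tl xs ! 1))} p
        [tl xs ! 0, string_code (take (xs ! 0) (string_of (tl xs ! 1)))]))"
      by simp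
    then have "decfn A (Suc (Suc 0)) (\<lambda>xs. D (xs ! 0) (string_of (xs ! 1)))"
      unfolding D_def
      by (intro decfn_ex_le decfn_not decfn_eq_0 string_intros recfn_intros) simp_all
    then show "decidable_family A D" by (simp add: decidable_family_def numeral_2_eq_2)
    show "upward (D n)" for n
      unfolding upward_def D_def code_opt_simps
    proof (intro allI impI, elim exE conjE)
      fix \<sigma> \<tau> i assume i: "i \<le> length \<sigma>"
        "beval A {..<length \<sigma>} p [n, string_code (take i \<sigma>)] \<noteq> None"
      have "take i (\<sigma> @ \<tau>) = take i \<sigma>" "length \<sigma> \<le> length (\<sigma> @ \<tau>)" using i(1) by simp_all
      with i beval_mono'[OF i(2)]
      show "\<exists>i\<le>length (\<sigma> @ \<tau>). beval A {..<length (\<sigma> @ \<tau>)} p [n, string_code (take i (\<sigma> @ \<tau>))] \<noteq> None"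
        by (intro exI[of _ i] conjI) (linarith, simp only:)
    qed
    show "U n = open_of (D n)" for n
    proof (intro set_eqI iffI)
      fix X assume "X \<in> U n"
      then obtain \<sigma> where \<sigma>: "X \<in> cylinder \<sigma>" "eval A p [n, string_code \<sigma>] \<noteq> None"
        unfolding U by blast
      then obtain t where t: "beval A {..<t} p [n, string_code \<sigma>] \<noteq> None"
        using eval_neq_None_iff by blast
      define m where "m = max t (length \<sigma>)"
      have "take (length \<sigma>) (prefix_of X m) = \<sigma>"
        using \<sigma>(1) by (simp add: take_prefix_of m_def in_cylinder_iff)
      moreover have "beval A {..<m} p [n, string_code \<sigma>] \<noteq> None"
        by (rule beval_mono'[OF t]) (simp add: m_def)
      moreover have "length \<sigma> \<le> m" by (simp add: m_def)
      ultimately have "D n (prefix_of X m)"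
        unfolding D_def code_opt_simps length_prefix_of
        by (intro exI[of _ "length \<sigma>"] conjI) (simp_all only: not_False_eq_True)
      then show "X \<in> open_of (D n)" by (auto simp: open_of_def)
    next
      fix X assume "X \<in> open_of (D n)"
      then obtain m i where "i \<le> m" "beval A {..<m} p [n, string_code (prefix_of X i)] \<noteq> None"
        unfolding open_of_def D_def code_opt_simps by (auto simp del: not_None_eq simp: take_prefix_of)
      then have "eval A p [n, string_code (prefix_of X i)] \<noteq> None"
        using eval_neq_None_iff by blast
      moreover have "X \<in> cylinder (prefix_of X i)" by (simp add: in_cylinder_iff)
      ultimately show "X \<in> U n" unfolding U by blast
    qed
  qed
qed

lemma decidable_uniformly_ce_open:
  assumes "decidable_family A D" shows "uniformly_ce_open A (\<lambda>n. open_of (D n))"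
proof -
  have "decfn A 3 (\<lambda>xs. \<not> D (xs ! 1) (string_of (xs ! 2)))"
    by (intro decfn_not decfn_decidable_family[OF assms] string_intros recfn_intros) simp_all
  then obtain q where "\<And>xs. length xs = 3 \<Longrightarrow>
      eval A q xs = Some (of_bool (\<not> D (xs ! 1) (string_of (xs ! 2))))"
    unfolding recfn_def by blast
  then have q: "eval A (Mu q) [n, c] \<noteq> None \<longleftrightarrow> D n (string_of c)" for n c
    by (simp add: numeral_3_eq_3 numeral_2_eq_2)
  have "open_of (D n) = (\<Union>\<sigma> \<in> {\<sigma>. (n, string_code \<sigma>) \<in> {(n, c). D n (string_of c)}}. cylinder \<sigma>)" for n
    by (auto simp: open_of_def in_cylinder_iff) (metis length_prefix_of)
  moreover have "ce2 A {(n, c). D n (string_of c)}"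
    unfolding ce2_def q[symmetric] by blast
  ultimately show ?thesis unfolding uniformly_ce_open_def by blast
qed

subsection \<open>Removing an empty oracle\<close>

fun oracle_free :: "prog \<Rightarrow> prog" where
  "oracle_free Oracle = Comp Zero [Succ]"
| "oracle_free (Comp f gs) = Comp (oracle_free f) (map oracle_free gs)"
| "oracle_free (PrimRec f g) = PrimRec (oracle_free f) (oracle_free g)"
| "oracle_free (Mu f) = Mu (oracle_free f)"
| "oracle_free p = p"

lemma eval_oracle_free: "eval A (oracle_free p) xs = eval (\<lambda>_. False) p xs"
proof (induction p arbitrary: xs)
  case (Comp f gs)
  then have "map (\<lambda>g. eval A g xs) (map oracle_free gs) = map (\<lambda>g. eval (\<lambda>_. False) g xs) gs"
    by simp
  then show ?case by (simp only: oracle_free.simps eval.simps Comp.IH(1))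
qed (simp_all split: list.split)

lemma uniformly_ce_open_oracle:
  assumes "uniformly_ce_open (\<lambda>_. False) U" shows "uniformly_ce_open A U"
proof -
  have "ce2 A W" if "ce2 (\<lambda>_. False) W" for W
    using that unfolding ce2_def eval_oracle_free[of A, symmetric] by blast
  then show ?thesis using assms unfolding uniformly_ce_open_def by blast
qed

lemma MLR_oracle: "MLR A \<subseteq> MLR (\<lambda>_. False)"
  using uniformly_ce_open_oracle unfolding MLR_def martin_lof_test_def by blast

section \<open>The coin-tossing measure\<close>

interpretation coin_sequence: sequence_space "measure_pmf (bernoulli_pmf (1/2))"
  by unfold_locales

lemma coin_measure_eq: "coin_measure = coin_sequence.S"
  by (simp add: coin_measure_def)

interpretation coin: prob_space coin_measure
  unfolding coin_measure_eq by (rule coin_sequence.P.prob_space_axioms)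

lemma space_coin [simp]: "space coin_measure = UNIV"
  by (simp add: coin_measure_def space_PiM PiE_UNIV_domain)

primrec prepend :: "bool list \<Rightarrow> cantor \<Rightarrow> cantor" where
  "prepend [] Z = Z"
| "prepend (b # \<sigma>) Z = case_nat b (prepend \<sigma> Z)"

definition tail :: "nat \<Rightarrow> cantor \<Rightarrow> cantor" where
  "tail k X = (\<lambda>i. X (i + k))"

lemma prefix_of_case_nat: "prefix_of (case_nat b Z) (Suc m) = b # prefix_of Z m"
  by (simp add: prefix_of_def map_upt_Suc del: upt_Suc)

lemma prefix_of_prepend: "prefix_of (prepend \<sigma> Z) (length \<sigma> + m) = \<sigma> @ prefix_of Z m"
  by (induction \<sigma>) (simp_all add: prefix_of_case_nat)

lemma prefix_of_prepend': "prefix_of (prepend \<sigma> Z) (length \<sigma>) = \<sigma>"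
  using prefix_of_prepend[of \<sigma> Z 0] by simp

lemma prepend_append: "prepend (\<sigma> @ \<tau>) Z = prepend \<sigma> (prepend \<tau> Z)"
  by (induction \<sigma>) simp_all

lemma tail_tail: "tail k (tail l X) = tail (k + l) X"
  by (simp add: tail_def add.assoc)

lemma tail_0 [simp]: "tail 0 X = X"
  by (simp add: tail_def)

lemma tail_case_nat: "tail (Suc k) (case_nat b Z) = tail k Z"
  by (simp add: tail_def)

lemma tail_prepend: "tail (length \<sigma>) (prepend \<sigma> Z) = Z"
  by (induction \<sigma>) (simp_all add: tail_case_nat)

lemma prepend_prefix_tail: "prepend (prefix_of X k) (tail k X) = X"
proof (induction k arbitrary: X)
  case (Suc k)
  have "prefix_of X (Suc k) = X 0 # prefix_of (tail 1 X) k"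
    by (simp add: prefix_of_def map_upt_Suc tail_def del: upt_Suc)
  moreover have "tail (Suc k) X = tail k (tail 1 X)" by (simp add: tail_tail)
  moreover have "case_nat (X 0) (tail 1 X) = X"
    by (rule ext) (simp add: tail_def split: nat.split)
  ultimately show ?case using Suc by simp
qed simp

lemma prefix_of_tail: "prefix_of X (k + m) = prefix_of X k @ prefix_of (tail k X) m"
  using prefix_of_prepend[of "prefix_of X k" "tail k X" m] by (simp add: prepend_prefix_tail)

lemma measurable_case_nat_coin: "case_nat b \<in> measurable coin_measure coin_measure"
  unfolding coin_measure_def by (rule measurable_case_nat') (auto simp: measurable_ident)

lemma measurable_prepend: "prepend \<sigma> \<in> measurable coin_measure coin_measure"
proof (induction \<sigma>)
  case Nil
  have "prepend [] = (\<lambda>Z. Z)" by auto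
  then show ?case by (simp only: measurable_ident_sets)
next
  case (Cons b \<sigma>)
  have "prepend (b # \<sigma>) = case_nat b \<circ> prepend \<sigma>" by auto
  then show ?case using measurable_comp[OF Cons measurable_case_nat_coin] by (simp only:)
qed

lemma sets_prepend: "B \<in> sets coin_measure \<Longrightarrow> prepend \<sigma> -` B \<in> sets coin_measure"
  using measurable_sets[OF measurable_prepend] by simp

lemma measurable_prefix_of: "(\<lambda>X. prefix_of X k) \<in> measurable coin_measure (count_space UNIV)"
proof (induction k)
  case (Suc k)
  have "(\<lambda>X. X k) \<in> measurable coin_measure (measure_pmf (bernoulli_pmf (1/2)))"
    unfolding coin_measure_def by (rule measurable_component_singleton) simp
  then have "(\<lambda>X. X k) \<in> measurable coin_measure (count_space UNIV)" by simp
  then have "(\<lambda>X. \<tau> @ [X k]) \<in> measurable coin_measure (count_space UNIV)" for \<tau>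
    by (rule measurable_compose) simp
  from measurable_compose_countable[OF this Suc] show ?case by (simp add: prefix_of_Suc)
qed simp

lemma sets_clopen: "{X. Q (prefix_of X k)} \<in> sets coin_measure"
  using measurable_sets[OF measurable_prefix_of, of "{\<sigma>. Q \<sigma>}" k] by (simp add: vimage_def)

lemma sets_open_of [simp]: "open_of D \<in> sets coin_measure"
proof -
  have "open_of D = (\<Union>m. {X. D (prefix_of X m)})" by (auto simp: open_of_def)
  then show ?thesis using sets_clopen by auto
qed

text \<open>
  The coin sequence is a first bit followed by an independent coin sequence.
\<close>

lemma measure_split_bit:
  assumes "B \<in> sets coin_measure"
  shows "measure coin_measure B =
    (measure coin_measure (case_nat True -` B) + measure coin_measure (case_nat False -` B)) / 2"
proof -
  have S: "B \<in> sets coin_sequence.S" using assms by (simp add: coin_measure_eq)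
  let ?f = "\<lambda>(s, \<omega>). case_nat s \<omega> :: cantor"
  let ?M = "measure_pmf (bernoulli_pmf (1/2))"
  have f: "?f \<in> measurable (?M \<Otimes>\<^sub>M coin_sequence.S) coin_sequence.S"
    by measurable
  have "emeasure coin_measure B = emeasure (distr (?M \<Otimes>\<^sub>M coin_sequence.S) coin_sequence.S ?f) B"
    by (simp add: coin_sequence.PiM_iter coin_measure_eq)
  also have "\<dots> = emeasure (?M \<Otimes>\<^sub>M coin_sequence.S) (?f -` B \<inter> space (?M \<Otimes>\<^sub>M coin_sequence.S))"
    using f S by (rule emeasure_distr)
  also have "\<dots> = (\<integral>\<^sup>+b. emeasure coin_sequence.S
      (Pair b -` (?f -` B \<inter> space (?M \<Otimes>\<^sub>M coin_sequence.S))) \<partial>?M)"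
    by (rule coin_sequence.P.emeasure_pair_measure_alt[OF measurable_sets[OF f S]])
  also have "\<dots> = (\<integral>\<^sup>+b. emeasure coin_measure (case_nat b -` B) \<partial>?M)"
    by (intro nn_integral_cong arg_cong2[where f = emeasure])
       (auto simp: coin_measure_eq space_pair_measure space_PiM PiE_UNIV_domain)
  also have "\<dots> = emeasure coin_measure (case_nat True -` B) * ennreal (1/2) +
      emeasure coin_measure (case_nat False -` B) * ennreal (1/2)"
    by simp
  also have "\<dots> = ennreal ((measure coin_measure (case_nat True -` B) +
      measure coin_measure (case_nat False -` B)) / 2)"
  proof -
    have "ennreal a * ennreal (1/2) + ennreal b * ennreal (1/2) = ennreal ((a + b) / 2)"
      if "0 \<le> a" "0 \<le> b" for a b
    proof -
      have "ennreal ((a + b) / 2) = ennreal (a * (1/2) + b * (1/2))" by (simp add: add_divide_distrib)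
      also have "\<dots> = ennreal (a * (1/2)) + ennreal (b * (1/2))" using that by (intro ennreal_plus) auto
      also have "\<dots> = ennreal a * ennreal (1/2) + ennreal b * ennreal (1/2)"
        using that by (intro arg_cong2[where f = "(+)"] ennreal_mult) auto
      finally show ?thesis by (rule sym)
    qed
    then show ?thesis unfolding coin.emeasure_eq_measure by (simp only: measure_nonneg)
  qed
  finally have "ennreal (measure coin_measure B) =
    ennreal ((measure coin_measure (case_nat True -` B) + measure coin_measure (case_nat False -` B)) / 2)"
    by (simp only: coin.emeasure_eq_measure)
  then show ?thesis
    by (subst (asm) ennreal_inj) simp_all
qed

lemma strings_Suc: "strings (Suc k) = (#) True ` strings k \<union> (#) False ` strings k"
  by (auto simp: length_Suc_conv image_iff)

lemma sum_strings_Suc: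
  "(\<Sum>\<tau>\<in>strings (Suc k). f \<tau>) = (\<Sum>\<sigma>\<in>strings k. f (True # \<sigma>) + f (False # \<sigma>))"
  for f :: "bool list \<Rightarrow> 'a::comm_monoid_add"
proof -
  have "(\<Sum>\<tau>\<in>strings (Suc k). f \<tau>) =
      (\<Sum>\<tau>\<in>(#) True ` strings k. f \<tau>) + (\<Sum>\<tau>\<in>(#) False ` strings k. f \<tau>)"
    unfolding strings_Suc by (rule sum.union_disjoint) auto
  then show ?thesis by (simp add: sum.reindex sum.distrib)
qed

text \<open>
  All facts about the measure that are needed (scaling under \<open>prepend\<close>, invariance under \<open>tail\<close>, the
  measure of clopen sets) are read off from this formula by computing the preimages on the right.
\<close>

lemma measure_split:
  assumes "B \<in> sets coin_measure"
  shows "measure coin_measure B = (\<Sum>\<sigma>\<in>strings k. measure coin_measure (prepend \<sigma> -` B)) / 2 ^ k"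
  using assms
proof (induction k arbitrary: B)
  case 0
  have "strings 0 = {[]}" by auto
  then show ?case by (simp add: vimage_def)
next
  case (Suc k)
  have *: "prepend (b # \<sigma>) -` B = prepend \<sigma> -` (case_nat b -` B)" for b \<sigma>
    by auto
  have "case_nat b -` B \<in> sets coin_measure" for b
    using measurable_sets[OF measurable_case_nat_coin Suc.prems] by simp
  note IH = Suc.IH[OF this]
  show ?case
    unfolding measure_split_bit[OF Suc.prems] sum_strings_Suc * IH[of True] IH[of False]
    by (simp add: sum.distrib add_divide_distrib)
qed

lemma measure_clopen:
  "measure coin_measure {X. Q (prefix_of X k)} = card {\<sigma>\<in>strings k. Q \<sigma>} / 2 ^ k"
proof -
  have "measure coin_measure (prepend \<sigma> -` {X. Q (prefix_of X k)}) = of_bool (Q \<sigma>)"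
    if "length \<sigma> = k" for \<sigma>
    using that prefix_of_prepend'[of \<sigma>] coin.prob_space by (auto simp: vimage_def)
  then have "(\<Sum>\<sigma>\<in>strings k. measure coin_measure (prepend \<sigma> -` {X. Q (prefix_of X k)})) =
      (\<Sum>\<sigma>\<in>strings k. of_bool (Q \<sigma>))"
    by (intro sum.cong) auto
  then show ?thesis
    by (subst measure_split[OF sets_clopen, of _ _ k]) (simp add: Int_def)
qed

lemma measure_vimage_prepend_le:
  assumes "B \<in> sets coin_measure"
  shows "measure coin_measure (prepend \<sigma> -` B) \<le> 2 ^ length \<sigma> * measure coin_measure B"
proof -
  have "measure coin_measure (prepend \<sigma> -` B) \<le>
      (\<Sum>\<sigma>\<in>strings (length \<sigma>). measure coin_measure (prepend \<sigma> -` B))"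
    by (rule member_le_sum) auto
  then show ?thesis
    by (subst measure_split[OF assms, of "length \<sigma>"]) simp
qed

lemma measure_vimage_tail:
  assumes "B \<in> sets coin_measure" "tail k -` B \<in> sets coin_measure"
  shows "measure coin_measure (tail k -` B) = measure coin_measure B"
proof -
  have "prepend \<sigma> -` (tail k -` B) = B" if "\<sigma> \<in> strings k" for \<sigma>
    using that tail_prepend[of \<sigma>] by auto
  then show ?thesis
    by (subst measure_split[OF assms(2), of k]) (simp add: card_strings)
qed

lemma measure_tails_le:
  assumes "B \<in> sets coin_measure"
  shows "measure coin_measure (\<Union>\<tau>\<in>strings k. prepend \<tau> -` B) \<le> 2 ^ k * measure coin_measure B"
proof -
  have "measure coin_measure (\<Union>\<tau>\<in>strings k. prepend \<tau> -` B) \<le>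
      (\<Sum>\<tau>\<in>strings k. measure coin_measure (prepend \<tau> -` B))"
    by (intro measure_UNION_le) (use sets_prepend[OF assms] in auto)
  then show ?thesis by (subst measure_split[OF assms, of k]) simp
qed

lemma prepend_image_eq: "prepend \<sigma> ` B = {X. prefix_of X (length \<sigma>) = \<sigma> \<and> tail (length \<sigma>) X \<in> B}"
proof (intro set_eqI iffI)
  fix X assume "X \<in> {X. prefix_of X (length \<sigma>) = \<sigma> \<and> tail (length \<sigma>) X \<in> B}"
  then show "X \<in> prepend \<sigma> ` B"
    using prepend_prefix_tail[of X "length \<sigma>"] by (auto intro: image_eqI[of _ _ "tail (length \<sigma>) X"])
qed (auto simp: prefix_of_prepend' tail_prepend)

lemma measurable_tail: "tail k \<in> measurable coin_measure coin_measure"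
  unfolding coin_measure_def tail_def
  by (rule measurable_PiM_single') (auto intro!: measurable_component_singleton simp: PiE_UNIV_domain)

lemma sets_prepend_image:
  assumes "B \<in> sets coin_measure" shows "prepend \<sigma> ` B \<in> sets coin_measure"
proof -
  have "prepend \<sigma> ` B = {X. prefix_of X (length \<sigma>) = \<sigma>} \<inter> tail (length \<sigma>) -` B"
    by (auto simp: prepend_image_eq)
  then show ?thesis
    using sets_clopen[of "\<lambda>x. x = \<sigma>" "length \<sigma>"] measurable_sets[OF measurable_tail assms] by auto
qed

lemma measure_prepend_image:
  assumes "B \<in> sets coin_measure"
  shows "measure coin_measure (prepend \<sigma> ` B) = measure coin_measure B / 2 ^ length \<sigma>"
proof -
  have "prepend \<tau> -` (prepend \<sigma> ` B) = (if \<tau> = \<sigma> then B else {})" if "\<tau> \<in> strings (length \<sigma>)" for \<tau>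
    using that prefix_of_prepend'[of \<tau>] tail_prepend[of \<tau>] by (auto simp: prepend_image_eq)
  then have "(\<Sum>\<tau>\<in>strings (length \<sigma>). measure coin_measure (prepend \<tau> -` (prepend \<sigma> ` B))) =
      (\<Sum>\<tau>\<in>strings (length \<sigma>). if \<tau> = \<sigma> then measure coin_measure B else 0)"
    by (intro sum.cong) auto
  then show ?thesis
    by (subst measure_split[OF sets_prepend_image[OF assms], of _ "length \<sigma>"]) simp
qed

section \<open>Cutting a sequence into blocks\<close>

text \<open>
  A sequence is read from left to right and cut greedily: a block ends as soon as it is a nonempty
  string satisfying \<open>D\<close>, and reading then starts afresh. \<open>current_block\<close> is the unfinished block at the
  end of a string; it is empty exactly after a cut.
\<close>

definition current_block :: "(bool list \<Rightarrow> bool) \<Rightarrow> bool list \<Rightarrow> bool list" where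
  "current_block D \<sigma> = foldl (\<lambda>\<rho> b. if D (\<rho> @ [b]) then [] else \<rho> @ [b]) [] \<sigma>"

definition block_count :: "(bool list \<Rightarrow> bool) \<Rightarrow> bool list \<Rightarrow> nat" where
  "block_count D \<sigma> = (\<Sum>i<length \<sigma>. of_bool (current_block D (take (Suc i) \<sigma>) = []))"

definition blocks :: "(bool list \<Rightarrow> bool) \<Rightarrow> nat \<Rightarrow> cantor set" where
  "blocks D n = open_of (\<lambda>\<sigma>. n \<le> block_count D \<sigma>)"

lemma current_block_Nil [simp]: "current_block D [] = []"
  by (simp add: current_block_def)

lemma current_block_snoc: "current_block D (\<sigma> @ [b]) = (if D (current_block D \<sigma> @ [b]) then [] else current_block D \<sigma> @ [b])"
  by (simp add: current_block_def)

lemma block_count_Nil [simp]: "block_count D [] = 0"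
  by (simp add: block_count_def)

lemma block_count_snoc: "block_count D (\<sigma> @ [b]) = block_count D \<sigma> + of_bool (current_block D (\<sigma> @ [b]) = [])"
proof -
  have "(\<Sum>i<length \<sigma>. of_bool (current_block D (take (Suc i) (\<sigma> @ [b])) = [])) = block_count D \<sigma>"
    unfolding block_count_def by (intro sum.cong refl) simp
  then show ?thesis by (simp add: block_count_def[of D "\<sigma> @ [b]"])
qed

lemma current_block_append:
  assumes "current_block D \<sigma> = []"
  shows "current_block D (\<sigma> @ \<tau>) = current_block D \<tau>"
  using assms
  by (induction \<tau> rule: rev_induct) (simp_all add: current_block_snoc flip: append_assoc)

lemma block_count_append:
  assumes "current_block D \<sigma> = []"
  shows "block_count D (\<sigma> @ \<tau>) = block_count D \<sigma> + block_count D \<tau>"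
proof (induction \<tau> rule: rev_induct)
  case (snoc b \<tau>)
  have "current_block D (\<sigma> @ \<tau> @ [b]) = current_block D (\<tau> @ [b])" by (rule current_block_append[OF assms])
  then show ?case using snoc block_count_snoc[of D "\<sigma> @ \<tau>" b] block_count_snoc[of D \<tau> b] by simp
qed simp

lemma block_count_prefix_mono: "m \<le> m' \<Longrightarrow> block_count D (prefix_of X m) \<le> block_count D (prefix_of X m')"
  by (induction m' rule: nat_induct_at_least[of m]) (auto simp: prefix_of_Suc block_count_snoc)

definition first_hit :: "(bool list \<Rightarrow> bool) \<Rightarrow> bool list \<Rightarrow> bool" where
  "first_hit D \<tau> \<longleftrightarrow> \<tau> \<noteq> [] \<and> D \<tau> \<and> (\<forall>i. 0 < i \<and> i < length \<tau> \<longrightarrow> \<not> D (take i \<tau>))"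

lemma no_hit:
  assumes "\<And>i. 0 < i \<Longrightarrow> i \<le> length \<rho> \<Longrightarrow> \<not> D (take i \<rho>)"
  shows "current_block D \<rho> = \<rho> \<and> block_count D \<rho> = 0"
  using assms
proof (induction \<rho> rule: rev_induct)
  case (snoc b \<rho>)
  have "\<not> D (take i \<rho>)" if "0 < i" "i \<le> length \<rho>" for i
    using snoc.prems[of i] that by simp
  then have "current_block D \<rho> = \<rho> \<and> block_count D \<rho> = 0" using snoc.IH by blast
  moreover have "\<not> D (\<rho> @ [b])" using snoc.prems[of "Suc (length \<rho>)"] by simp
  ultimately show ?case by (simp add: current_block_snoc block_count_snoc)
qed simp

lemma first_hit_current_block:
  assumes "first_hit D \<tau>" shows "current_block D \<tau> = []" "block_count D \<tau> = 1"
proof -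
  obtain \<rho> b where \<tau>: "\<tau> = \<rho> @ [b]" using assms by (cases \<tau> rule: rev_cases) (auto simp: first_hit_def)
  have "\<not> D (take i \<rho>)" if "0 < i" "i \<le> length \<rho>" for i
    using assms that unfolding first_hit_def \<tau> by (metis le_imp_less_Suc length_append_singleton take_append
        diff_is_0_eq take0 append_Nil2)
  then have "current_block D \<rho> = \<rho> \<and> block_count D \<rho> = 0" by (rule no_hit)
  then show "current_block D \<tau> = []" "block_count D \<tau> = 1"
    using assms by (simp_all add: \<tau> current_block_snoc block_count_snoc first_hit_def)
qed

lemma hit_first_hit:
  assumes "0 < m" "D (prefix_of X m)"
  obtains i where "i \<le> m" "first_hit D (prefix_of X i)"
proof -
  define i where "i = (LEAST i. 0 < i \<and> D (prefix_of X i))"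
  have i: "0 < i" "D (prefix_of X i)" "i \<le> m"
    using LeastI[of "\<lambda>i. 0 < i \<and> D (prefix_of X i)" m] Least_le[of "\<lambda>i. 0 < i \<and> D (prefix_of X i)" m] assms
    unfolding i_def by auto
  have "\<not> D (prefix_of X j)" if "0 < j" "j < i" for j
    using not_less_Least[of j "\<lambda>i. 0 < i \<and> D (prefix_of X i)"] that unfolding i_def by blast
  then have "first_hit D (prefix_of X i)"
    using i unfolding first_hit_def by (auto simp: take_prefix_of dest: arg_cong[where f = length])
  then show ?thesis using that i(3) by blast
qed

lemma first_hit_disjoint:
  assumes "first_hit D \<sigma>" "first_hit D \<tau>" "\<sigma> \<noteq> \<tau>"
  shows "prepend \<sigma> ` B \<inter> prepend \<tau> ` C = {}"
proof -
  have *: False if "first_hit D \<sigma>" "first_hit D \<tau>" "length \<sigma> < length \<tau>"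
    "prefix_of X (length \<sigma>) = \<sigma>" "prefix_of X (length \<tau>) = \<tau>" for X \<sigma> \<tau>
  proof -
    have "take (length \<sigma>) \<tau> = \<sigma>" using that(3-5) by (metis less_imp_le take_prefix_of)
    then show False using that(1-3) unfolding first_hit_def by (metis length_greater_0_conv)
  qed
  have False if X: "prefix_of X (length \<sigma>) = \<sigma>" "prefix_of X (length \<tau>) = \<tau>" for X
    using *[OF assms(1,2) _ X] *[OF assms(2,1) _ X(2,1)] X assms(3)
    by (metis linorder_neqE_nat)
  then show ?thesis unfolding prepend_image_eq by blast
qed

lemma blocks_0: "blocks D 0 = UNIV"
  by (simp add: blocks_def open_of_def)

text \<open>
  The first block splits off, and what remains is an arbitrary sequence with \<open>n\<close> blocks.
\<close>

lemma blocks_Suc: "blocks D (Suc n) = (\<Union>\<tau>\<in>{\<tau>. first_hit D \<tau>}. prepend \<tau> ` blocks D n)"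
proof (intro set_eqI iffI)
  fix X assume "X \<in> blocks D (Suc n)"
  then obtain m where m: "Suc n \<le> block_count D (prefix_of X m)" by (auto simp: blocks_def open_of_def)
  have "\<exists>i. 0 < i \<and> i \<le> m \<and> D (prefix_of X i)"
  proof (rule ccontr)
    assume "\<not> ?thesis"
    then have "block_count D (prefix_of X m) = 0"
      using no_hit[of "prefix_of X m" D] by (auto simp: take_prefix_of)
    with m show False by simp
  qed
  then obtain i where i: "i \<le> m" and hit: "first_hit D (prefix_of X i)"
    using hit_first_hit by (metis le_trans)
  have "prefix_of X m = prefix_of X i @ prefix_of (tail i X) (m - i)"
    using prefix_of_tail[of X i "m - i"] i by simp
  then have "n \<le> block_count D (prefix_of (tail i X) (m - i))"
    using m first_hit_current_block[OF hit] by (simp add: block_count_append)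
  then have "tail i X \<in> blocks D n" by (auto simp: blocks_def open_of_def)
  then show "X \<in> (\<Union>\<tau>\<in>{\<tau>. first_hit D \<tau>}. prepend \<tau> ` blocks D n)"
    using hit prepend_prefix_tail[of X i] by (metis UN_I image_eqI mem_Collect_eq)
next
  fix X assume "X \<in> (\<Union>\<tau>\<in>{\<tau>. first_hit D \<tau>}. prepend \<tau> ` blocks D n)"
  then obtain \<tau> Z m where \<tau>: "first_hit D \<tau>" "X = prepend \<tau> Z" "n \<le> block_count D (prefix_of Z m)"
    by (auto simp: blocks_def open_of_def)
  then have "Suc n \<le> block_count D (prefix_of X (length \<tau> + m))"
    using first_hit_current_block[OF \<tau>(1)] by (simp add: prefix_of_prepend block_count_append)
  then show "X \<in> blocks D (Suc n)" by (auto simp: blocks_def open_of_def)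
qed

lemma decseq_blocks: "decseq (blocks D)"
  unfolding decseq_def blocks_def open_of_def by (auto intro: le_trans)

lemma sets_blocks [simp]: "blocks D n \<in> sets coin_measure"
  by (simp add: blocks_def)

text \<open>
  The possible first blocks are incomparable strings, so the union in the previous decomposition is
  disjoint and the number of blocks behaves like a renewal process: each further block costs the
  same factor.
\<close>

lemma measure_blocks: "measure coin_measure (blocks D n) = measure coin_measure (blocks D 1) ^ n"
proof -
  let ?I = "{\<tau>. first_hit D \<tau>}"
  let ?s = "\<integral>\<^sup>+\<tau>. ennreal (1 / 2 ^ length \<tau>) \<partial>count_space ?I"
  have *: "emeasure coin_measure (blocks D (Suc n)) = ?s * emeasure coin_measure (blocks D n)" for n
  proof -
    have "emeasure coin_measure (blocks D (Suc n)) =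
        (\<integral>\<^sup>+\<tau>. emeasure coin_measure (prepend \<tau> ` blocks D n) \<partial>count_space ?I)"
      unfolding blocks_Suc
      by (rule emeasure_UN_countable)
         (auto simp: sets_prepend_image disjoint_family_on_def first_hit_disjoint)
    also have "\<dots> = (\<integral>\<^sup>+\<tau>. ennreal (1 / 2 ^ length \<tau>) * emeasure coin_measure (blocks D n) \<partial>count_space ?I)"
      by (intro nn_integral_cong)
         (simp add: coin.emeasure_eq_measure measure_prepend_image ennreal_mult'[symmetric])
    also have "\<dots> = ?s * emeasure coin_measure (blocks D n)"
      by (rule nn_integral_multc) simp
    finally show ?thesis .
  qed
  have 1: "?s = emeasure coin_measure (blocks D 1)"
    using *[of 0] coin.emeasure_space_1 by (simp add: blocks_0)
  show ?thesis
  proof (induction n)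
    case 0
    then show ?case using coin.prob_space by (simp add: blocks_0)
  next
    case (Suc n)
    have "ennreal (measure coin_measure (blocks D (Suc n))) =
        ennreal (measure coin_measure (blocks D 1) * measure coin_measure (blocks D n))"
      using *[of n] unfolding 1 by (simp add: coin.emeasure_eq_measure ennreal_mult')
    then show ?case by (subst (asm) ennreal_inj) (simp_all add: Suc)
  qed
qed

lemma blocks_1: "blocks D 1 = {X. \<exists>m>0. D (prefix_of X m)}"
proof -
  have "blocks D 1 = {X. \<exists>\<tau>. first_hit D \<tau> \<and> prefix_of X (length \<tau>) = \<tau>}"
    using blocks_Suc[of D 0] by (auto simp: blocks_0 prepend_image_eq)
  moreover have "(\<exists>\<tau>. first_hit D \<tau> \<and> prefix_of X (length \<tau>) = \<tau>) \<longleftrightarrow> (\<exists>m>0. D (prefix_of X m))" for X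
  proof
    assume "\<exists>\<tau>. first_hit D \<tau> \<and> prefix_of X (length \<tau>) = \<tau>"
    then obtain \<tau> where "first_hit D \<tau>" "prefix_of X (length \<tau>) = \<tau>" by blast
    then show "\<exists>m>0. D (prefix_of X m)"
      by (intro exI[of _ "length \<tau>"]) (simp add: first_hit_def)
  next
    assume "\<exists>m>0. D (prefix_of X m)"
    then obtain m where "0 < m" "D (prefix_of X m)" by blast
    then obtain i where "first_hit D (prefix_of X i)" by (rule hit_first_hit)
    then show "\<exists>\<tau>. first_hit D \<tau> \<and> prefix_of X (length \<tau>) = \<tau>"
      by (intro exI[of _ "prefix_of X i"]) simp
  qed
  ultimately show ?thesis by simp
qed

text \<open>
  Whatever remains after a cut is a tail again, so the cutting never stops.
\<close>

lemma all_tails_blocks: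
  assumes "\<And>k. tail k X \<in> blocks D 1" shows "X \<in> blocks D n"
  using assms
proof (induction n arbitrary: X)
  case (Suc n)
  from Suc.prems[of 0] obtain m where "0 < m" "D (prefix_of X m)" unfolding blocks_1 by auto
  then obtain i where hit: "first_hit D (prefix_of X i)" using hit_first_hit by blast
  have "tail i X \<in> blocks D n"
    using Suc.prems by (intro Suc.IH) (simp add: tail_tail)
  then show ?case
    unfolding blocks_Suc using hit prepend_prefix_tail[of X i] by (metis UN_I image_eqI mem_Collect_eq)
qed (simp add: blocks_0)

lemma recfn_current_block:
  assumes D: "decidable A D" and s: "strfn A k s" shows "strfn A k (\<lambda>xs. current_block D (s xs))"
proof -
  let ?g = "\<lambda>\<sigma> i \<rho>. if D (\<rho> @ drop i (take (Suc i) \<sigma>)) then [] else \<rho> @ drop i (take (Suc i) \<sigma>)"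
  have "current_block D (take n \<sigma>) = rec_nat [] (?g \<sigma>) n" if "n \<le> length \<sigma>" for n \<sigma>
    using that
  proof (induction n)
    case (Suc n)
    then have "take (Suc n) \<sigma> = take n \<sigma> @ [\<sigma> ! n]" "drop n (take (Suc n) \<sigma>) = [\<sigma> ! n]"
      by (simp_all add: take_Suc_conv_app_nth)
    with Suc show ?case by (simp add: current_block_snoc)
  qed simp
  from this[OF order.refl] have current_block: "current_block D \<sigma> = rec_nat [] (?g \<sigma>) (length \<sigma>)" for \<sigma> by simp
  have "strfn A 1 (\<lambda>xs. rec_nat [] (\<lambda>i \<rho>. ?g (string_of (xs ! 0)) i \<rho>) (length (string_of (xs ! 0))))"
    by (rule recfn_primrec_string)
       (intro string_intros recfn_intros decfn_decidable[OF D]; simp)+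
  then have "strfn A 1 (\<lambda>xs. current_block D (string_of (xs ! 0)))" by (simp only: current_block)
  from recfn_apply1[of A "\<lambda>c. string_code (current_block D (string_of c))", OF this s] show ?thesis by simp
qed

lemma recfn_block_count:
  assumes D: "decidable A D" and s: "strfn A k s" shows "recfn A k (\<lambda>xs. block_count D (s xs))"
proof -
  have "recfn A 1 (\<lambda>xs. \<Sum>i<length (string_of (xs ! 0)). of_bool (current_block D (take (Suc i) (string_of (xs ! 0))) = []))"
    by (intro recfn_sum recfn_length decfn_string_eq recfn_current_block[OF D] string_intros recfn_intros) simp_all
  from recfn_apply1[of A "\<lambda>c. block_count D (string_of c)", OF this[folded block_count_def] s] show ?thesis by simp
qed

lemma uniformly_ce_open_blocks:
  assumes "decidable A D" shows "uniformly_ce_open A (\<lambda>n. blocks D (j * n))"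
  unfolding blocks_def
  by (rule decidable_uniformly_ce_open, unfold decidable_family_def)
     (intro recfn_block_count[OF assms] string_intros recfn_intros; simp)

section \<open>Random sequences and c.e. open sets\<close>

definition ce_open :: "cantor \<Rightarrow> cantor set \<Rightarrow> bool" where
  "ce_open A G \<longleftrightarrow> (\<exists>D. decidable A D \<and> upward D \<and> G = open_of D)"

lemma decidable_section:
  assumes "decidable_family A D" shows "decidable A (D n)"
  unfolding decidable_def
  by (intro decfn_decidable_family[OF assms] string_intros recfn_intros) simp_all

lemma ce_open_component:
  assumes "uniformly_ce_open A U" shows "ce_open A (U n)"
  using assms by (rule uniformly_ce_open_decidable) (auto simp: ce_open_def intro: decidable_section)

lemma ce_open_sets: "ce_open A G \<Longrightarrow> G \<in> sets coin_measure"
  by (auto simp: ce_open_def)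

lemma open_of_Un: "open_of D \<union> open_of E = open_of (\<lambda>\<sigma>. D \<sigma> \<or> E \<sigma>)"
  by (auto simp: open_of_def)

lemma ce_open_Un:
  assumes "ce_open A G" "ce_open A H" shows "ce_open A (G \<union> H)"
proof -
  obtain D E where D: "decidable A D" "upward D" "G = open_of D"
    and E: "decidable A E" "upward E" "H = open_of E"
    using assms unfolding ce_open_def by blast
  have "decidable A (\<lambda>\<sigma>. D \<sigma> \<or> E \<sigma>)"
    using D(1) E(1) unfolding decidable_def by (rule decfn_or)
  moreover have "upward (\<lambda>\<sigma>. D \<sigma> \<or> E \<sigma>)" using D(2) E(2) by (auto simp: upward_def)
  ultimately show ?thesis
    using open_of_Un[of D E] unfolding ce_open_def D(3) E(3) by blast
qed

lemma vimage_prepend_open_of: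
  assumes "upward D" shows "prepend \<sigma> -` open_of D = open_of (\<lambda>\<rho>. D (\<sigma> @ \<rho>))"
proof (intro set_eqI iffI)
  fix Z assume "Z \<in> prepend \<sigma> -` open_of D"
  then obtain m where "D (prefix_of (prepend \<sigma> Z) m)" by (auto simp: open_of_def)
  then have "D (prefix_of (prepend \<sigma> Z) (length \<sigma> + m))" 
    by (rule upward_prefix_of[OF assms]) simp
  then show "Z \<in> open_of (\<lambda>\<rho>. D (\<sigma> @ \<rho>))" by (auto simp: open_of_def prefix_of_prepend)
next
  fix Z assume "Z \<in> open_of (\<lambda>\<rho>. D (\<sigma> @ \<rho>))"
  then show "Z \<in> prepend \<sigma> -` open_of D"
    by (auto simp: open_of_def prefix_of_prepend[symmetric])
qed

lemma ce_open_prepend: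
  assumes "ce_open A G" shows "ce_open A (prepend \<sigma> -` G)"
proof -
  obtain D where D: "decidable A D" "upward D" "G = open_of D"
    using assms unfolding ce_open_def by blast
  have "decidable A (\<lambda>\<rho>. D (\<sigma> @ \<rho>))"
    unfolding decidable_def by (intro decfn_decidable[OF D(1)] recfn_append recfn_const string_intros recfn_intros) simp
  moreover have "upward (\<lambda>\<rho>. D (\<sigma> @ \<rho>))" using upwardD[OF D(2), of "\<sigma> @ _"] by (simp add: upward_def)
  ultimately show ?thesis
    unfolding ce_open_def D(3) vimage_prepend_open_of[OF D(2)] by blast
qed

lemma drop_prefix_of: "drop k (prefix_of X m) = prefix_of (tail k X) (m - k)"
proof (cases "k \<le> m")
  case True
  then show ?thesis using prefix_of_tail[of X k "m - k"] by simp
qed simp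

lemma ce_open_tail:
  assumes "ce_open A G" shows "ce_open A (tail k -` G)"
proof -
  obtain D where D: "decidable A D" "upward D" "G = open_of D"
    using assms unfolding ce_open_def by blast
  have "decidable A (\<lambda>\<rho>. D (drop k \<rho>))"
    unfolding decidable_def by (intro decfn_decidable[OF D(1)] recfn_drop recfn_const string_intros recfn_intros) simp
  moreover have "upward (\<lambda>\<rho>. D (drop k \<rho>))" using upwardD[OF D(2)] by (simp add: upward_def)
  moreover have "tail k -` G = open_of (\<lambda>\<rho>. D (drop k \<rho>))"
    unfolding D(3) open_of_def drop_prefix_of by (auto intro: exI[of _ "_ + k"] simp: add_diff_cancel_right')
  ultimately show ?thesis unfolding ce_open_def by blast
qed

lemma blocks_1_upward:
  assumes "upward D" shows "blocks D 1 = open_of D"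
proof (intro set_eqI iffI)
  fix X assume "X \<in> open_of D"
  then obtain m where "D (prefix_of X m)" by (auto simp: open_of_def)
  from upward_prefix_of[OF assms this, of "Suc m"] show "X \<in> blocks D 1"
    unfolding blocks_1 by auto
qed (unfold blocks_1 open_of_def, blast)

lemma MLR_avoids_test:
  assumes "X \<in> MLR A" "decseq U" "uniformly_ce_open A U" "\<And>n. measure coin_measure (U n) \<le> (1/2) ^ n"
  obtains n where "X \<notin> U n"
  using assms unfolding MLR_def martin_lof_test_def by blast

text \<open>
  Kucera's theorem: if all tails of \<open>X\<close> were in \<open>G\<close>, then \<open>X\<close> would split into infinitely many blocks
  with respect to a generator of \<open>G\<close>. The sets of sequences with \<open>n\<close> blocks have measure \<open>\<mu>(G)^n\<close>, and a
  subsequence of them is a Martin-Loef test.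
\<close>

lemma random_tail_avoids:
  assumes X: "X \<in> MLR A" and G: "ce_open A G" and less: "measure coin_measure G < 1"
  obtains k where "tail k X \<notin> G"
proof (rule ccontr)
  assume "\<not> thesis"
  with that have tails: "tail k X \<in> G" for k by blast
  obtain D where D: "decidable A D" "upward D" "G = open_of D"
    using G unfolding ce_open_def by blast
  have G_blocks: "G = blocks D 1" by (simp only: D(3) blocks_1_upward[OF D(2)])
  \<comment> \<open>Only every \<open>j\<close>-th number of blocks is used, so that each step halves the measure.\<close>
  obtain j where j: "measure coin_measure G ^ j < 1/2"
    using real_arch_pow_inv[of "1/2" "measure coin_measure G"] less by auto
  obtain n where "X \<notin> blocks D (j * n)"
  proof (rule MLR_avoids_test[OF X])
    show "decseq (\<lambda>n. blocks D (j * n))"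
      using decseq_blocks[of D] by (simp add: decseq_def)
    show "uniformly_ce_open A (\<lambda>n. blocks D (j * n))"
      by (rule uniformly_ce_open_blocks[OF D(1)])
    show "measure coin_measure (blocks D (j * n)) \<le> (1/2) ^ n" for n
    proof -
      have "measure coin_measure (blocks D (j * n)) = (measure coin_measure G ^ j) ^ n"
        unfolding G_blocks by (subst measure_blocks) (simp only: power_mult)
      also have "\<dots> \<le> (1/2) ^ n" using j by (intro power_mono) simp_all
      finally show ?thesis .
    qed
  qed
  moreover have "X \<in> blocks D (j * n)"
    using tails unfolding G_blocks by (rule all_tails_blocks)
  ultimately show False by blast
qed

text \<open>
  The complement of \<open>G\<close> is a decreasing intersection of clopen sets \<open>N m\<close> whose measures are computable
  and tend to 0. Hence the \<open>n\<close>-th test component may be the first \<open>N m\<close> of measure at most \<open>2^(-n)\<close>;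
  it is written as the union of all such \<open>N m\<close>, since these are nested.
\<close>

lemma random_in_full_measure:
  assumes X: "X \<in> MLR A" and G: "ce_open A G" and full: "measure coin_measure G = 1"
  shows "X \<in> G"
proof (rule ccontr)
  assume "X \<notin> G"
  obtain D where D: "decidable A D" "upward D" "G = open_of D"
    using G unfolding ce_open_def by blast
  define N where "N m = {Z. \<not> D (prefix_of Z m)}" for m
  define c where "c m = card {\<tau>\<in>strings m. \<not> D \<tau>}" for m
  have sets_N: "N m \<in> sets coin_measure" for m
    unfolding N_def by (rule sets_clopen)
  have meas_N: "measure coin_measure (N m) = c m / 2 ^ m" for m
    unfolding N_def c_def by (rule measure_clopen)
  have dec_N: "N m' \<subseteq> N m" if "m \<le> m'" for m m'
    using upward_prefix_of[OF D(2) _ that] by (auto simp: N_def)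
  define V where "V n \<sigma> \<longleftrightarrow> \<not> D \<sigma> \<and> 2 ^ n * c (length \<sigma>) \<le> 2 ^ length \<sigma>" for n \<sigma>
  have good: "2 ^ n * c m \<le> 2 ^ m \<longleftrightarrow> measure coin_measure (N m) \<le> (1/2) ^ n" for m n
  proof -
    have "2 ^ n * c m \<le> 2 ^ m \<longleftrightarrow> real (2 ^ n * c m) \<le> real (2 ^ m)" by (simp only: of_nat_le_iff)
    then show ?thesis by (simp add: meas_N power_one_over field_simps)
  qed
  obtain n where "X \<notin> open_of (V n)"
  proof (rule MLR_avoids_test[OF X])
    have "(2::nat) ^ n * c m \<le> 2 ^ n' * c m" if "n \<le> n'" for n n' m
      using that by (intro mult_right_mono power_increasing) auto
    then show "decseq (\<lambda>n. open_of (V n))"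
      unfolding decseq_def open_of_def V_def by (blast intro: order_trans)
    show "uniformly_ce_open A (\<lambda>n. open_of (V n))"
      unfolding V_def c_def
      by (rule decidable_uniformly_ce_open, unfold decidable_family_def)
         (intro decfn_decidable[OF D(1)] string_intros recfn_intros; simp)
    show "measure coin_measure (open_of (V n)) \<le> (1/2) ^ n" for n
    proof (cases "\<exists>m. 2 ^ n * c m \<le> 2 ^ m")
      case True
      define m where "m = (LEAST m. 2 ^ n * c m \<le> 2 ^ m)"
      have m: "2 ^ n * c m \<le> 2 ^ m" unfolding m_def using True by (rule LeastI_ex)
      have "open_of (V n) \<subseteq> N m"
      proof
        fix Z assume "Z \<in> open_of (V n)"
        then obtain l where l: "\<not> D (prefix_of Z l)" "2 ^ n * c l \<le> 2 ^ l"
          by (auto simp: open_of_def V_def)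
        then have "m \<le> l" unfolding m_def by (intro Least_le)
        with l(1) dec_N show "Z \<in> N m" by (auto simp: N_def)
      qed
      then have "measure coin_measure (open_of (V n)) \<le> measure coin_measure (N m)"
        by (rule coin.finite_measure_mono[OF _ sets_N])
      also have "\<dots> \<le> (1/2) ^ n" using m good by blast
      finally show ?thesis .
    next
      case False
      then have "open_of (V n) = {}" by (auto simp: open_of_def V_def)
      then show ?thesis by simp
    qed
  qed
  moreover have "X \<in> open_of (V n)"
  proof -
    have "(\<Inter>m. N m) = - G" by (auto simp: N_def D(3) open_of_def)
    moreover have "measure coin_measure (- G) = 0"
      using coin.prob_compl[OF ce_open_sets[OF G]] full by (simp add: Compl_eq_Diff_UNIV)
    moreover have "(\<lambda>m. measure coin_measure (N m)) \<longlonglongrightarrow> measure coin_measure (\<Inter>m. N m)"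
      using sets_N dec_N by (intro coin.finite_Lim_measure_decseq) (auto simp: decseq_def)
    ultimately have "(\<lambda>m. measure coin_measure (N m)) \<longlonglongrightarrow> 0" by simp
    then have "\<forall>\<^sub>F m in sequentially. measure coin_measure (N m) < (1/2) ^ n"
      by (rule order_tendstoD) simp
    then obtain m where "measure coin_measure (N m) < (1/2) ^ n"
      by (auto simp: eventually_sequentially)
    then have "2 ^ n * c m \<le> 2 ^ m" by (simp add: good)
    moreover have "\<not> D (prefix_of X m)" using \<open>X \<notin> G\<close> by (auto simp: D(3) open_of_def)
    ultimately show ?thesis unfolding open_of_def V_def by (intro CollectI exI[of _ m]) simp
  qed
  ultimately show False by blast
qed

section \<open>A weakly 2-random sequence made of blocks\<close>

instance prog :: countable
  by countable_datatype

lemma uniformly_ce_open_enumeration: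
  obtains E :: "nat \<Rightarrow> nat \<Rightarrow> cantor set" where "\<And>U. uniformly_ce_open A U \<Longrightarrow> \<exists>n. U = E n"
proof
  fix U assume "uniformly_ce_open A U"
  then obtain W p where "\<And>n. U n = (\<Union>\<sigma> \<in> {\<sigma>. (n, string_code \<sigma>) \<in> W}. cylinder \<sigma>)"
      "W = {(x, y). eval A p [x, y] \<noteq> None}"
    unfolding uniformly_ce_open_def ce2_def by blast
  then have "U = (\<lambda>n. \<Union>\<sigma> \<in> {\<sigma>. eval A p [n, string_code \<sigma>] \<noteq> None}. cylinder \<sigma>)"
    by (intro ext) simp
  then show "\<exists>i. U = (\<lambda>n. \<Union>\<sigma> \<in> {\<sigma>. eval A (from_nat i) [n, string_code \<sigma>] \<noteq> None}. cylinder \<sigma>)"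
    by (intro exI[of _ "to_nat p"]) simp
qed

lemma limit_of_prefixes:
  fixes \<sigma> :: "nat \<Rightarrow> bool list"
  assumes step: "\<And>n. \<exists>\<tau>. \<tau> \<noteq> [] \<and> \<sigma> (Suc n) = \<sigma> n @ \<tau>"
  obtains Y where "\<And>n. prefix_of Y (length (\<sigma> n)) = \<sigma> n" "\<And>n. n \<le> length (\<sigma> n)"
proof
  have ext: "\<exists>\<tau>. \<sigma> n = \<sigma> m @ \<tau>" if "m \<le> n" for m n
    using that
  proof (induction n rule: nat_induct_at_least)
    case (Suc n)
    then show ?case using step[of n] by auto
  qed simp
  have nth: "\<sigma> m ! i = \<sigma> n ! i" if "i < length (\<sigma> m)" "i < length (\<sigma> n)" for m n i
    using ext[of m n] ext[of n m] that by (cases "m \<le> n") (auto simp: nth_append)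
  show len: "n \<le> length (\<sigma> n)" for n
  proof (induction n)
    case (Suc n)
    then show ?case using step[of n] by (auto simp: Suc_le_eq less_Suc_eq_le neq_Nil_conv)
  qed simp
  show "prefix_of (\<lambda>i. \<sigma> (Suc i) ! i) (length (\<sigma> n)) = \<sigma> n" for n
  proof (rule nth_equalityI)
    fix i assume "i < length (prefix_of (\<lambda>i. \<sigma> (Suc i) ! i) (length (\<sigma> n)))"
    then show "prefix_of (\<lambda>i. \<sigma> (Suc i) ! i) (length (\<sigma> n)) ! i = \<sigma> n ! i"
      using nth[of i "Suc i" n] len[of "Suc i"] by (simp add: prefix_of_def Suc_le_eq)
  qed simp
qed

text \<open>
  Forcing with pairs of a string \<open>\<sigma>\<close> consisting of \<open>n\<close> blocks and a c.e. open set \<open>G\<close> such that \<open>[\<sigma>] - G\<close> has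
  positive measure; the sequence under construction extends \<open>\<sigma>\<close> and stays outside \<open>G\<close>. To defeat the
  next generalized test, a component of it is added to \<open>G\<close>; as the measures of the components tend
  to 0, one of them is small enough to preserve positive measure. To add a block, take a tail of \<open>X\<close>
  such that \<open>\<sigma>\<close> followed by this tail avoids \<open>G\<close>. By hypothesis the tail starts with a block \<open>\<tau>\<close>, and
  \<open>[\<sigma>\<tau>] - G\<close> is not null because it contains a sequence with a random tail.
\<close>

theorem weakly_2_random_of_blocks:
  assumes X: "X \<in> MLR A" and tails: "\<And>k. tail k X \<in> blocks D 1"
  obtains Y where "Y \<in> W2R A" "\<And>n. Y \<in> blocks D n"
proof -
  obtain E :: "nat \<Rightarrow> nat \<Rightarrow> cantor set" where E: "\<And>U. uniformly_ce_open A U \<Longrightarrow> \<exists>n. U = E n"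
    using uniformly_ce_open_enumeration by blast
  define P where "P n s \<longleftrightarrow> current_block D (fst s) = [] \<and> block_count D (fst s) = n \<and> ce_open A (snd s) \<and>
    measure coin_measure (prepend (fst s) -` snd s) < 1" for n :: nat and s
  define Q where "Q n s s' \<longleftrightarrow> (\<exists>\<tau>. \<tau> \<noteq> [] \<and> fst s' = fst s @ \<tau>) \<and> snd s \<subseteq> snd s' \<and>
    (generalized_martin_lof_test A (E n) \<longrightarrow> (\<exists>j. E n j \<subseteq> snd s'))" for n and s s' :: "bool list \<times> cantor set"
  have init: "\<exists>s. P 0 s"
  proof -
    have "decidable A (\<lambda>_. False)" unfolding decidable_def by (simp add: recfn_const)
    then have "ce_open A {}" unfolding ce_open_def by (auto simp: upward_def open_of_def)
    then show ?thesis by (intro exI[of _ "([], {})"]) (simp add: P_def)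
  qed
  have step: "\<exists>s'. P (Suc n) s' \<and> Q n s s'" if "P n s" for n s
  proof -
    obtain \<sigma> G where s: "s = (\<sigma>, G)" by (cases s)
    have \<sigma>: "current_block D \<sigma> = []" "block_count D \<sigma> = n" and G: "ce_open A G" "measure coin_measure (prepend \<sigma> -` G) < 1"
      using that by (auto simp: P_def s)
    obtain G' where G': "ce_open A G'" "measure coin_measure (prepend \<sigma> -` G') < 1" "G \<subseteq> G'"
      and test: "generalized_martin_lof_test A (E n) \<Longrightarrow> \<exists>j. E n j \<subseteq> G'"
    proof (cases "generalized_martin_lof_test A (E n)")
      case True
      then have ce: "ce_open A (E n j)" for j
        unfolding generalized_martin_lof_test_def using ce_open_component by blast
      \<comment> \<open>Below the string \<open>\<sigma>\<close>, measures are magnified by at most \<open>2 ^ length \<sigma>\<close>.\<close>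
      define e where "e = (1 - measure coin_measure (prepend \<sigma> -` G)) / 2 ^ length \<sigma>"
      have "0 < e" using G(2) by (simp add: e_def)
      then have "\<forall>\<^sub>F j in sequentially. measure coin_measure (E n j) < e"
        using True unfolding generalized_martin_lof_test_def by (intro order_tendstoD(2)) blast+
      then obtain j where "measure coin_measure (E n j) < e" by (auto simp: eventually_sequentially)
      then have "2 ^ length \<sigma> * measure coin_measure (E n j) < 1 - measure coin_measure (prepend \<sigma> -` G)"
        by (simp add: e_def field_simps)
      then have "measure coin_measure (prepend \<sigma> -` E n j) < 1 - measure coin_measure (prepend \<sigma> -` G)"
        using measure_vimage_prepend_le[OF ce_open_sets[OF ce]] by (rule le_less_trans[rotated])
      moreover have "measure coin_measure (prepend \<sigma> -` (G \<union> E n j)) \<le>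
          measure coin_measure (prepend \<sigma> -` G) + measure coin_measure (prepend \<sigma> -` E n j)"
        unfolding vimage_Un by (intro measure_Un_le sets_prepend ce_open_sets[OF G(1)] ce_open_sets[OF ce])
      ultimately have "measure coin_measure (prepend \<sigma> -` (G \<union> E n j)) < 1" by linarith
      then show ?thesis using that[of "G \<union> E n j"] ce_open_Un[OF G(1) ce] by blast
    qed (use G that in blast)
    obtain k where k: "tail k X \<notin> prepend \<sigma> -` G'"
      using random_tail_avoids[OF X ce_open_prepend[OF G'(1)] G'(2)] by blast
    obtain m where "0 < m" "D (prefix_of (tail k X) m)"
      using tails[of k] unfolding blocks_1 by blast
    then obtain i where hit: "first_hit D (prefix_of (tail k X) i)" by (rule hit_first_hit)
    define \<tau> where "\<tau> = prefix_of (tail k X) i"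
    \<comment> \<open>Otherwise \<open>X\<close>, being random, would have the tail from \<open>i + k\<close> on in this c.e. open set.\<close>
    have "measure coin_measure (prepend (\<sigma> @ \<tau>) -` G') \<noteq> 1"
    proof
      let ?H = "prepend (\<sigma> @ \<tau>) -` G'"
      assume full: "measure coin_measure ?H = 1"
      have H: "ce_open A (tail (i + k) -` ?H)"
        by (intro ce_open_tail ce_open_prepend G'(1))
      have "X \<in> tail (i + k) -` ?H"
      proof (rule random_in_full_measure[OF X H])
        show "measure coin_measure (tail (i + k) -` ?H) = 1"
          using measure_vimage_tail[OF ce_open_sets[OF ce_open_prepend[OF G'(1)]] ce_open_sets[OF H]] full
          by simp
      qed
      then have "prepend \<sigma> (prepend \<tau> (tail i (tail k X))) \<in> G'"
        by (simp add: prepend_append tail_tail)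
      with k show False by (simp add: \<tau>_def prepend_prefix_tail)
    qed
    then have "measure coin_measure (prepend (\<sigma> @ \<tau>) -` G') < 1"
      using coin.prob_le_1[of "prepend (\<sigma> @ \<tau>) -` G'"] by linarith
    moreover have "current_block D (\<sigma> @ \<tau>) = []" "block_count D (\<sigma> @ \<tau>) = Suc n"
      using first_hit_current_block[OF hit] \<sigma> by (simp_all add: \<tau>_def current_block_append block_count_append)
    moreover have "\<tau> \<noteq> []" using hit by (simp add: \<tau>_def first_hit_def)
    ultimately show ?thesis
      using G' test by (intro exI[of _ "(\<sigma> @ \<tau>, G')"]) (simp add: P_def Q_def s)
  qed
  obtain f where f: "\<And>n. P n (f n)" "\<And>n. Q n (f n) (f (Suc n))"
    using dependent_nat_choice[of P Q, OF init step] by blast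
  have "\<exists>\<tau>. \<tau> \<noteq> [] \<and> fst (f (Suc n)) = fst (f n) @ \<tau>" for n
    using f(2) by (simp add: Q_def)
  then obtain Y where Y: "\<And>n. prefix_of Y (length (fst (f n))) = fst (f n)" and len: "\<And>n. n \<le> length (fst (f n))"
    using limit_of_prefixes[of "\<lambda>n. fst (f n)"] by blast
  have mono: "snd (f m) \<subseteq> snd (f n)" if "m \<le> n" for m n
    using that
  proof (induction n rule: nat_induct_at_least)
    case (Suc n)
    then show ?case using f(2)[of n] by (auto simp: Q_def)
  qed simp
  have avoid: "Y \<notin> snd (f n)" for n
  proof
    assume in_G: "Y \<in> snd (f n)"
    obtain C where C: "upward C" "snd (f n) = open_of C"
      using f(1)[of n] unfolding P_def ce_open_def by blast
    then obtain m where "C (prefix_of Y m)" using in_G by (auto simp: open_of_def)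
    define N where "N = max m n"
    have "m \<le> length (fst (f N))" using len[of N] by (simp add: N_def)
    then have "C (prefix_of Y (length (fst (f N))))"
      by (rule upward_prefix_of[OF C(1) \<open>C (prefix_of Y m)\<close>])
    then have "C (fst (f N))" by (simp only: Y)
    then have "prepend (fst (f N)) Z \<in> snd (f n)" for Z
      unfolding C(2) open_of_def using prefix_of_prepend'[of "fst (f N)" Z] by (metis (mono_tags) mem_Collect_eq)
    then have "prepend (fst (f N)) -` snd (f N) = UNIV"
      using mono[of n N] by (auto simp: N_def)
    moreover have "measure coin_measure (prepend (fst (f N)) -` snd (f N)) < 1"
      using f(1)[of N] by (simp add: P_def)
    ultimately show False using coin.prob_space by simp
  qed
  show ?thesis
  proof
    show "Y \<in> blocks D n" for n
      unfolding blocks_def open_of_def using f(1)[of n] Y[of n]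
      by (intro CollectI exI[of _ "length (fst (f n))"]) (simp add: P_def)
    show "Y \<in> W2R A"
      unfolding W2R_def
    proof (intro CollectI allI impI)
      fix U assume U: "generalized_martin_lof_test A U"
      then obtain n where n: "U = E n" using E unfolding generalized_martin_lof_test_def by blast
      then obtain j where "U j \<subseteq> snd (f (Suc n))" using f(2)[of n] U by (auto simp: Q_def)
      then show "Y \<notin> (\<Inter>n. U n)" using avoid by blast
    qed
  qed
qed

lemma W2R_subset_MLR: "W2R A \<subseteq> MLR A"
proof -
  have "generalized_martin_lof_test A U" if "martin_lof_test A U" for U
  proof -
    have "(\<lambda>n. measure coin_measure (U n)) \<longlonglongrightarrow> 0"
    proof (rule tendsto_sandwich[of "\<lambda>_. 0" _ _ "\<lambda>n. (1/2) ^ n"])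
      show "(\<lambda>n. (1/2) ^ n :: real) \<longlonglongrightarrow> 0" by (rule LIMSEQ_power_zero) simp
    qed (use that in \<open>auto simp: martin_lof_test_def\<close>)
    then show ?thesis using that by (simp add: martin_lof_test_def generalized_martin_lof_test_def)
  qed
  then show ?thesis unfolding W2R_def MLR_def by blast
qed

text \<open>
  The hypothesis says that failing \<open>S\<close> is witnessed by a condition on prefixes that holds for all tails
  of the failing sequence, and that any infinite concatenation of such prefixes fails \<open>S\<close> as well.
\<close>

theorem lowness_transfer:
  assumes S: "\<And>X. X \<notin> S \<Longrightarrow> \<exists>D. (\<forall>k. tail k X \<in> blocks D 1) \<and> (\<forall>Y. (\<forall>n. Y \<in> blocks D n) \<longrightarrow> Y \<notin> S)"
    and low: "W2R A \<subseteq> S"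
  shows "MLR A \<subseteq> S"
proof (rule subsetI, rule ccontr)
  fix X assume X: "X \<in> MLR A" "X \<notin> S"
  then obtain D where D: "\<And>k. tail k X \<in> blocks D 1" "\<And>Y. (\<And>n. Y \<in> blocks D n) \<Longrightarrow> Y \<notin> S"
    using S by blast
  obtain Y where "Y \<in> W2R A" "\<And>n. Y \<in> blocks D n"
    using weakly_2_random_of_blocks[OF X(1) D(1)] by blast
  with D(2) low show False by blast
qed

section \<open>Catching all tails of a sequence that fails a test\<close>

text \<open>
  The string \<open>\<tau>\<close> guesses the initial segment that was cut off to obtain the tail. The guesses of length
  \<open>k\<close> together contribute at most \<open>2^k\<close> times the measure of the component that is used for them; the
  index \<open>3k + 3\<close> makes the sum over \<open>k\<close> small even after multiplication by a further \<open>2^k\<close>.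
\<close>

definition tail_cover :: "(nat \<Rightarrow> bool list \<Rightarrow> bool) \<Rightarrow> bool list \<Rightarrow> bool" where
  "tail_cover D \<sigma> \<longleftrightarrow> (\<exists>k\<le>length \<sigma>. \<exists>\<tau>\<in>strings k. D (3 * k + 3) (\<tau> @ \<sigma>))"

lemma decidable_tail_cover:
  assumes "decidable_family A D" shows "decidable A (tail_cover D)"
  unfolding decidable_def tail_cover_def
  by (intro decfn_decidable_family[OF assms] string_intros recfn_intros) simp_all

lemma upward_tail_cover:
  assumes "\<And>n. upward (D n)" shows "upward (tail_cover D)"
  unfolding upward_def tail_cover_def
proof (intro allI impI, elim exE conjE bexE)
  fix \<sigma> \<rho> k \<tau> assume *: "k \<le> length \<sigma>" "\<tau> \<in> strings k" "D (3 * k + 3) (\<tau> @ \<sigma>)"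
  have "D (3 * k + 3) (\<tau> @ \<sigma> @ \<rho>)" using upwardD[OF assms *(3), of \<rho>] by simp
  with * show "\<exists>k\<le>length (\<sigma> @ \<rho>). \<exists>\<tau>\<in>strings k. D (3 * k + 3) (\<tau> @ \<sigma> @ \<rho>)"
    by (intro exI[of _ k] conjI bexI[of _ \<tau>]) simp_all
qed

lemma open_of_tail_cover:
  assumes "\<And>n. upward (D n)"
  shows "open_of (tail_cover D) = (\<Union>k. \<Union>\<tau>\<in>strings k. prepend \<tau> -` open_of (D (3 * k + 3)))"
proof (intro set_eqI iffI)
  fix Z assume "Z \<in> open_of (tail_cover D)"
  then show "Z \<in> (\<Union>k. \<Union>\<tau>\<in>strings k. prepend \<tau> -` open_of (D (3 * k + 3)))"
    unfolding vimage_prepend_open_of[OF assms] by (auto simp: open_of_def tail_cover_def)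
next
  fix Z assume "Z \<in> (\<Union>k. \<Union>\<tau>\<in>strings k. prepend \<tau> -` open_of (D (3 * k + 3)))"
  then obtain \<tau> m where *: "D (3 * length \<tau> + 3) (\<tau> @ prefix_of Z m)"
    unfolding vimage_prepend_open_of[OF assms] by (auto simp: open_of_def)
  then have "D (3 * length \<tau> + 3) (prefix_of (prepend \<tau> Z) (length \<tau> + m))"
    by (simp add: prefix_of_prepend)
  then have "D (3 * length \<tau> + 3) (prefix_of (prepend \<tau> Z) (length \<tau> + max m (length \<tau>)))"
    by (rule upward_prefix_of[OF assms]) simp
  then have "tail_cover D (prefix_of Z (max m (length \<tau>)))"
    unfolding tail_cover_def prefix_of_prepend
    by (intro exI[of _ "length \<tau>"] conjI bexI[of _ \<tau>]) simp_all
  then show "Z \<in> open_of (tail_cover D)" by (auto simp: open_of_def)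
qed

lemma tail_in_tail_cover:
  assumes "\<And>n. upward (D n)" "\<And>n. X \<in> open_of (D n)"
  shows "tail k X \<in> open_of (tail_cover D)"
  unfolding open_of_tail_cover[OF assms(1)]
  by (intro UN_I[of k] UN_I[of "prefix_of X k"]) (simp_all add: prepend_prefix_tail assms(2))

text \<open>
  The averaging over \<open>\<tau>\<close> in \<open>measure_split\<close> bounds the contribution of all strings of length \<open>k\<close> at once;
  the rest is a geometric series.
\<close>

lemma measure_tails_UN_le:
  assumes B: "\<And>k. B k \<in> sets coin_measure"
    and le: "\<And>k. 2 ^ k * measure coin_measure (B k) \<le> c / 8 * (1/2) ^ k"
  shows "measure coin_measure (\<Union>k. \<Union>\<tau>\<in>strings k. prepend \<tau> -` B k) \<le> c / 4"
proof -
  let ?T = "\<lambda>k. \<Union>\<tau>\<in>strings k. prepend \<tau> -` B k"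
  have sets: "?T k \<in> sets coin_measure" for k
    by (intro sets.finite_UN sets_prepend B) simp
  have bound: "measure coin_measure (?T k) \<le> c / 8 * (1/2) ^ k" for k
    using measure_tails_le[OF B] le by (rule order_trans)
  have geo: "(\<lambda>k. c / 8 * (1/2) ^ k) sums (c / 8 * 2)"
    using geometric_sums[of "1/2 :: real"] by (intro sums_mult) simp
  have summable: "summable (\<lambda>k. measure coin_measure (?T k))"
    by (rule summable_comparison_test[OF _ sums_summable[OF geo]]) (use bound in auto)
  have "measure coin_measure (\<Union>k. ?T k) \<le> (\<Sum>k. measure coin_measure (?T k))"
    using sets by (intro coin.finite_measure_subadditive_countably summable) auto
  also have "\<dots> \<le> (\<Sum>k. c / 8 * (1/2) ^ k)"
    by (rule suminf_le[OF bound summable sums_summable[OF geo]])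
  also have "\<dots> = c / 4" using sums_unique[OF geo] by simp
  finally show ?thesis .
qed

lemma measure_tail_cover:
  assumes up: "\<And>n. upward (D n)" and le: "\<And>n. measure coin_measure (open_of (D n)) \<le> (1/2) ^ n"
  shows "measure coin_measure (open_of (tail_cover D)) \<le> 1/4"
  unfolding open_of_tail_cover[OF up]
proof (rule measure_tails_UN_le)
  fix k
  have "2 ^ k * measure coin_measure (open_of (D (3 * k + 3))) \<le> 2 ^ k * (1/2) ^ (3 * k + 3)"
    by (intro mult_left_mono le) simp
  also have "\<dots> = 1 / 8 * (1/2) ^ k * (1/2) ^ k"
  proof -
    have "3 * k + 3 = k + (k + (k + 3))" by simp
    then have "(1/2 :: real) ^ (3 * k + 3) = (1/2) ^ k * ((1/2) ^ k * ((1/2) ^ k * (1/8)))"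
      by (simp only: power_add) (simp add: power3_eq_cube)
    moreover have "(2 :: real) ^ k * (1/2) ^ k = 1" by (simp add: power_one_over)
    moreover have "x * (a * (a * (a * (1/8)))) = 1/8 * a * a" if "x * a = 1" for x a :: real
      using that by (simp add: mult.assoc[symmetric])
    ultimately show ?thesis by (simp only:)
  qed
  also have "\<dots> \<le> 1 / 8 * (1/2) ^ k * 1" by (intro mult_left_mono power_le_one) simp_all
  finally show "2 ^ k * measure coin_measure (open_of (D (3 * k + 3))) \<le> 1 / 8 * (1/2) ^ k" by simp
qed simp

text \<open>
  The tail cover of a test that catches \<open>X\<close> contains all tails of \<open>X\<close> and has measure at most 1/4, so
  counting its blocks gives a Martin-Loef test.
\<close>

theorem MLR_failure_by_blocks:
  assumes "X \<notin> MLR A"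
  shows "\<exists>D. (\<forall>k. tail k X \<in> blocks D 1) \<and> (\<forall>Y. (\<forall>n. Y \<in> blocks D n) \<longrightarrow> Y \<notin> MLR A)"
proof -
  obtain U where U: "martin_lof_test A U" "\<And>n. X \<in> U n" using assms by (auto simp: MLR_def)
  then have "uniformly_ce_open A U" by (simp add: martin_lof_test_def)
  then obtain D where D: "decidable_family A D" "\<And>n. upward (D n)" "\<And>n. U n = open_of (D n)"
    by (rule uniformly_ce_open_decidable) blast
  let ?T = "tail_cover D"
  have open_T: "blocks ?T 1 = open_of ?T"
    by (rule blocks_1_upward[OF upward_tail_cover[OF D(2)]])
  have "measure coin_measure (blocks ?T 1) \<le> 1/4"
    unfolding open_T using U(1) D(3) by (intro measure_tail_cover D(2)) (simp add: martin_lof_test_def)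
  then have "measure coin_measure (blocks ?T n) \<le> (1/2) ^ n" for n
    unfolding measure_blocks[of _ n] by (intro power_mono) simp_all
  moreover have "uniformly_ce_open A (blocks ?T)"
    using uniformly_ce_open_blocks[OF decidable_tail_cover[OF D(1)], of 1] by simp
  ultimately have "martin_lof_test A (blocks ?T)"
    unfolding martin_lof_test_def using decseq_blocks by blast
  then have "\<forall>Y. (\<forall>n. Y \<in> blocks ?T n) \<longrightarrow> Y \<notin> MLR A" unfolding MLR_def by blast
  moreover have "\<forall>k. tail k X \<in> blocks ?T 1"
    unfolding open_T using U(2) D(3) by (intro allI tail_in_tail_cover D(2)) simp
  ultimately show ?thesis by blast
qed

section \<open>Padding an open set to measure one half\<close>

text \<open>
  The lexicographic order of Cantor space: strings of equal length are ordered by their codes.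
\<close>

definition lex_le :: "cantor \<Rightarrow> cantor \<Rightarrow> bool" where
  "lex_le Z Z' \<longleftrightarrow> (\<forall>n. string_code (prefix_of Z n) \<le> string_code (prefix_of Z' n))"

lemma lex_le_linear: "lex_le Z Z' \<or> lex_le Z' Z"
proof (rule disjCI)
  assume "\<not> lex_le Z' Z"
  then obtain n where n: "string_code (prefix_of Z n) < string_code (prefix_of Z' n)"
    by (auto simp: lex_le_def not_le)
  have mono: "string_code (prefix_of W m') < string_code (prefix_of W' m')"
    if "string_code (prefix_of W m) < string_code (prefix_of W' m)" "m \<le> m'" for W W' m m'
    using that(2,1) by (induction m' rule: nat_induct_at_least) (auto simp: prefix_of_Suc string_code_snoc)
  show "lex_le Z Z'"
    unfolding lex_le_def
  proof
    fix m
    show "string_code (prefix_of Z m) \<le> string_code (prefix_of Z' m)"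
    proof (rule ccontr)
      assume m: "\<not> ?thesis"
      then show False
        using mono[of Z n Z' m] mono[of Z' m Z n] n by (cases "m \<le> n") auto
    qed
  qed
qed

lemma lex_closed_linear:
  assumes "\<And>Z Z'. lex_le Z Z' \<Longrightarrow> Z' \<in> L \<Longrightarrow> Z \<in> L" "\<And>Z Z'. lex_le Z Z' \<Longrightarrow> Z' \<in> M \<Longrightarrow> Z \<in> M"
  shows "L \<subseteq> M \<or> M \<subseteq> L"
  using assms lex_le_linear by (metis subsetI)

text \<open>
  A Schnorr test must have measures exactly \<open>2^(-n)\<close>, so the number of blocks gives one only if the
  generating set has measure exactly 1/2. The open set generated by \<open>T\<close> is therefore enlarged by an
  initial segment of the lexicographic order. The predicate \<open>good m t\<close> certifies that the strings of
  length \<open>t\<close> already determine all but \<open>2^(-m)\<close> of its measure; then the initial segment may safely be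
  filled up to total measure \<open>1/2 - 2^(-m)\<close> at level \<open>t\<close>.
\<close>

locale padding =
  fixes T :: "bool list \<Rightarrow> bool" and good :: "nat \<Rightarrow> nat \<Rightarrow> bool"
  assumes upward_T: "upward T"
    and small: "measure coin_measure (open_of T) \<le> 1/4"
    and good_le: "good m t \<Longrightarrow> m \<le> t"
    and good_approx: "good m t \<Longrightarrow>
       measure coin_measure (open_of T - {Z. T (prefix_of Z t)}) \<le> (1/2) ^ m"
    and good_ex: "\<exists>t\<ge>s. good m t"
begin

text \<open>
  The string \<open>\<sigma>\<close> can be filled in together with everything to its left if the result, joined with the
  part of \<open>T\<close> visible at level \<open>t\<close>, has measure at most \<open>1/2 - 2^(-m)\<close>; the inequality is multiplied out
  to avoid fractions.
\<close>

definition below :: "nat \<Rightarrow> nat \<Rightarrow> bool list \<Rightarrow> bool" where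
  "below m t \<sigma> \<longleftrightarrow>
     2 ^ Suc m * card {\<tau>\<in>strings t. string_code \<tau> \<le> string_code \<sigma> \<or> T \<tau>} + 2 ^ Suc t \<le> 2 ^ (m + t)"

definition pad :: "bool list \<Rightarrow> bool" where
  "pad \<sigma> \<longleftrightarrow> (\<exists>t\<le>length \<sigma>. \<exists>m\<le>t. good m t \<and> (T (take t \<sigma>) \<or> below m t (take t \<sigma>)))"

definition left_part :: "nat \<Rightarrow> nat \<Rightarrow> cantor set" where
  "left_part m t = {Z. below m t (prefix_of Z t)}"

lemma below_iff:
  "below m t \<sigma> \<longleftrightarrow>
   real (card {\<tau>\<in>strings t. string_code \<tau> \<le> string_code \<sigma> \<or> T \<tau>}) / 2 ^ t \<le> 1/2 - (1/2) ^ m"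
  (is "_ \<longleftrightarrow> real ?c / _ \<le> _")
proof -
  have "below m t \<sigma> \<longleftrightarrow> real (2 ^ Suc m * ?c + 2 ^ Suc t) \<le> real (2 ^ (m + t))"
    unfolding below_def by (simp only: of_nat_le_iff)
  then show ?thesis by (simp add: power_add power_one_over field_simps)
qed

lemma below_mono: "string_code \<sigma> \<le> string_code \<sigma>' \<Longrightarrow> below m t \<sigma>' \<Longrightarrow> below m t \<sigma>"
proof -
  assume *: "string_code \<sigma> \<le> string_code \<sigma>'" "below m t \<sigma>'"
  have "card {\<tau>\<in>strings t. string_code \<tau> \<le> string_code \<sigma> \<or> T \<tau>} \<le>
      card {\<tau>\<in>strings t. string_code \<tau> \<le> string_code \<sigma>' \<or> T \<tau>}"
    by (rule card_mono) (use * in auto)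
  then have "(2::nat) ^ Suc m * card {\<tau>\<in>strings t. string_code \<tau> \<le> string_code \<sigma> \<or> T \<tau>} \<le>
      2 ^ Suc m * card {\<tau>\<in>strings t. string_code \<tau> \<le> string_code \<sigma>' \<or> T \<tau>}"
    by (rule mult_left_mono) simp
  then show ?thesis using *(2) unfolding below_def by linarith
qed

lemma upward_pad: "upward pad"
  unfolding upward_def pad_def
proof (intro allI impI, elim exE conjE)
  fix \<sigma> \<tau> t m
  assume "t \<le> length \<sigma>" "m \<le> t" "good m t" "T (take t \<sigma>) \<or> below m t (take t \<sigma>)"
  then show "\<exists>t\<le>length (\<sigma> @ \<tau>). \<exists>m\<le>t. good m t \<and> (T (take t (\<sigma> @ \<tau>)) \<or> below m t (take t (\<sigma> @ \<tau>)))"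
    by (intro exI[of _ t] conjI exI[of _ m]) simp_all
qed

lemma open_of_pad: "open_of pad = open_of T \<union> (\<Union>(m, t)\<in>{(m, t). good m t}. left_part m t)"
proof (intro set_eqI iffI)
  fix Z assume "Z \<in> open_of pad"
  then show "Z \<in> open_of T \<union> (\<Union>(m, t)\<in>{(m, t). good m t}. left_part m t)"
    by (force simp: open_of_def pad_def left_part_def take_prefix_of)
next
  have padI: "Z \<in> open_of pad" if "good m t" "T (prefix_of Z t) \<or> below m t (prefix_of Z t)" for Z m t
    unfolding open_of_def pad_def
    by (intro CollectI exI[of _ t] exI[of _ m] conjI) (use that good_le in \<open>auto simp: take_prefix_of\<close>)
  fix Z assume "Z \<in> open_of T \<union> (\<Union>(m, t)\<in>{(m, t). good m t}. left_part m t)"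
  then show "Z \<in> open_of pad"
  proof
    assume "Z \<in> open_of T"
    then obtain s where "T (prefix_of Z s)" by (auto simp: open_of_def)
    moreover obtain t where "s \<le> t" "good 0 t" using good_ex[of s 0] by blast
    ultimately show ?thesis using padI upward_prefix_of[OF upward_T] by blast
  qed (auto simp: left_part_def intro: padI)
qed

lemma measure_left_part:
  "measure coin_measure ({Z. T (prefix_of Z t)} \<union> left_part m t) =
   card {\<sigma>\<in>strings t. T \<sigma> \<or> below m t \<sigma>} / 2 ^ t"
  using measure_clopen[of "\<lambda>\<sigma>. T \<sigma> \<or> below m t \<sigma>" t] by (simp add: left_part_def Un_def)

lemma sets_left_part [simp]: "left_part m t \<in> sets coin_measure"
  unfolding left_part_def by (rule sets_clopen)

text \<open>
  The rightmost string that is filled in bounds the visible measure by \<open>1/2 - 2^(-m)\<close>, and at most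
  \<open>2^(-m)\<close> of the open set is not yet visible.
\<close>

lemma measure_left_part_le:
  assumes "good m t" shows "measure coin_measure (open_of T \<union> left_part m t) \<le> 1/2"
proof (cases "\<exists>\<sigma>\<in>strings t. below m t \<sigma>")
  case False
  then have "left_part m t = {}" by (auto simp: left_part_def)
  then show ?thesis using small by simp
next
  case True
  let ?B = "{\<sigma>\<in>strings t. below m t \<sigma>}"
  have fin: "finite (string_code ` ?B)" "string_code ` ?B \<noteq> {}" using True by auto
  from Max_in[OF fin] obtain \<mu> where \<mu>: "Max (string_code ` ?B) = string_code \<mu>" "\<mu> \<in> ?B"
    by (rule imageE)
  have "string_code \<sigma> \<le> string_code \<mu>" if "\<sigma> \<in> ?B" for \<sigma>
    unfolding \<mu>(1)[symmetric] using that fin by (intro Max_ge) auto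
  then have "card {\<sigma>\<in>strings t. T \<sigma> \<or> below m t \<sigma>} \<le> card {\<tau>\<in>strings t. string_code \<tau> \<le> string_code \<mu> \<or> T \<tau>}"
    by (intro card_mono) auto
  then have "real (card {\<sigma>\<in>strings t. T \<sigma> \<or> below m t \<sigma>}) / 2 ^ t \<le>
      real (card {\<tau>\<in>strings t. string_code \<tau> \<le> string_code \<mu> \<or> T \<tau>}) / 2 ^ t"
    by (simp add: divide_right_mono)
  also have "\<dots> \<le> 1/2 - (1/2) ^ m" using \<mu>(2) below_iff by blast
  finally have "measure coin_measure ({Z. T (prefix_of Z t)} \<union> left_part m t) \<le> 1/2 - (1/2) ^ m"
    by (simp only: measure_left_part)
  moreover have "open_of T \<union> left_part m t \<subseteq>
      ({Z. T (prefix_of Z t)} \<union> left_part m t) \<union> (open_of T - {Z. T (prefix_of Z t)})" by blast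
  then have "measure coin_measure (open_of T \<union> left_part m t) \<le>
      measure coin_measure (({Z. T (prefix_of Z t)} \<union> left_part m t) \<union> (open_of T - {Z. T (prefix_of Z t)}))"
    by (rule coin.finite_measure_mono) (intro sets.Un sets.Diff sets_clopen sets_open_of sets_left_part)
  moreover have "\<dots> \<le> measure coin_measure ({Z. T (prefix_of Z t)} \<union> left_part m t) +
      measure coin_measure (open_of T - {Z. T (prefix_of Z t)})"
    by (rule measure_Un_le) (intro sets.Un sets.Diff sets_clopen sets_open_of sets_left_part)+
  ultimately show ?thesis using good_approx[OF assms] by linarith
qed

text \<open>
  The leftmost string that is not filled in would exceed the bound \<open>1/2 - 2^(-m)\<close>, and its own
  contribution is only \<open>2^(-t)\<close>.
\<close>

lemma measure_left_part_ge:
  "1/2 - (1/2) ^ m - (1/2) ^ t \<le> measure coin_measure ({Z. T (prefix_of Z t)} \<union> left_part m t)"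
proof -
  let ?S = "{\<sigma>\<in>strings t. T \<sigma> \<or> below m t \<sigma>}"
  let ?N = "{\<sigma>\<in>strings t. \<not> below m t \<sigma>}"
  have "?N \<noteq> {}"
  proof
    assume "?N = {}"
    define \<mu> where "\<mu> = replicate t True"
    have all: "string_code \<tau> \<le> string_code (replicate (length \<tau>) True)" for \<tau>
    proof (induction \<tau> rule: rev_induct)
      case (snoc b \<tau>)
      then show ?case by (simp add: string_code_snoc replicate_append_same[symmetric])
    qed simp
    then have "{\<tau>\<in>strings t. string_code \<tau> \<le> string_code \<mu> \<or> T \<tau>} = strings t"
      by (auto simp: \<mu>_def)
    moreover have "below m t \<mu>" using \<open>?N = {}\<close> by (auto simp: \<mu>_def)
    ultimately have "real (card (strings t)) / 2 ^ t \<le> 1/2 - (1/2) ^ m" by (simp only: below_iff)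
    then have "1 \<le> 1/2 - (1/2 :: real) ^ m" by (simp add: card_strings)
    moreover have "0 \<le> (1/2 :: real) ^ m" by simp
    ultimately show False by linarith
  qed
  then have fin: "finite (string_code ` ?N)" "string_code ` ?N \<noteq> {}" by auto
  from Min_in[OF fin] obtain \<nu> where \<nu>: "Min (string_code ` ?N) = string_code \<nu>" "\<nu> \<in> ?N"
    by (rule imageE)
  have least: "string_code \<nu> \<le> string_code \<sigma>" if "\<sigma> \<in> ?N" for \<sigma>
    unfolding \<nu>(1)[symmetric] using that fin by (intro Min_le) auto
  have "{\<tau>\<in>strings t. string_code \<tau> \<le> string_code \<nu> \<or> T \<tau>} \<subseteq> insert \<nu> ?S"
  proof
    fix \<tau> assume \<tau>: "\<tau> \<in> {\<tau>\<in>strings t. string_code \<tau> \<le> string_code \<nu> \<or> T \<tau>}"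
    show "\<tau> \<in> insert \<nu> ?S"
    proof (cases "T \<tau> \<or> below m t \<tau>")
      case False
      then have "\<tau> \<in> ?N" using \<tau> by simp
      from least[OF this] \<tau> False have "string_code \<tau> = string_code \<nu>" by simp
      then show ?thesis by (simp add: inj_eq[OF inj_string_code])
    qed (use \<tau> in simp)
  qed
  then have "card {\<tau>\<in>strings t. string_code \<tau> \<le> string_code \<nu> \<or> T \<tau>} \<le> card (insert \<nu> ?S)"
    by (intro card_mono) auto
  also have "\<dots> \<le> Suc (card ?S)" by (simp add: card_insert_if)
  finally have "real (card {\<tau>\<in>strings t. string_code \<tau> \<le> string_code \<nu> \<or> T \<tau>}) / 2 ^ t \<le> (card ?S + 1) / 2 ^ t"
    by (intro divide_right_mono) simp_all
  moreover have "1/2 - (1/2) ^ m \<le> real (card {\<tau>\<in>strings t. string_code \<tau> \<le> string_code \<nu> \<or> T \<tau>}) / 2 ^ t"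
    using \<nu>(2) below_iff[of m t \<nu>] by simp
  ultimately show ?thesis unfolding measure_left_part by (simp add: add_divide_distrib power_one_over)
qed

lemma left_part_linear: "left_part m t \<subseteq> left_part m' t' \<or> left_part m' t' \<subseteq> left_part m t"
  by (rule lex_closed_linear) (auto simp: left_part_def lex_le_def intro: below_mono)

text \<open>
  Initial segments are linearly ordered by inclusion, so each finite stage of the union is the original
  set together with a single one of them.
\<close>

lemma measure_pad: "measure coin_measure (open_of pad) = 1/2"
proof (rule antisym)
  \<comment> \<open>Enumerate the pairs with \<open>good m t\<close>, so that the union becomes an increasing one.\<close>
  define J where "J = {i. case_prod good (prod_decode i)}"
  define l where "l i = case_prod left_part (prod_decode i)" for i
  define F where "F N = open_of T \<union> (\<Union>i\<in>J \<inter> {..<N}. l i)" for N :: nat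
  have l_linear: "l i \<subseteq> l j \<or> l j \<subseteq> l i" for i j
    unfolding l_def by (simp add: split_beta left_part_linear)
  have F: "F N = open_of T \<or> (\<exists>i\<in>J. F N = open_of T \<union> l i)" for N
  proof (induction N)
    case (Suc N)
    show ?case
    proof (cases "N \<in> J")
      case True
      then have "F (Suc N) = F N \<union> l N" by (auto simp: F_def lessThan_Suc)
      moreover have "F N \<union> l N = open_of T \<union> l N \<or> F N \<union> l N = F N"
        using Suc l_linear[of N] by blast
      ultimately show ?thesis using Suc True by metis
    next
      case False
      then have "F (Suc N) = F N" by (simp add: F_def lessThan_Suc)
      then show ?thesis using Suc by simp
    qed
  qed (simp add: F_def)
  have sets: "F N \<in> sets coin_measure" for N
    using F[of N] by (auto intro!: sets.Un simp: l_def split_beta)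
  have "measure coin_measure (open_of T \<union> l i) \<le> 1/2" if "i \<in> J" for i
    using that measure_left_part_le by (simp add: J_def l_def split_beta)
  then have le: "measure coin_measure (F N) \<le> 1/2" for N
    using F[of N] small by auto
  have "(\<Union>N. F N) = open_of pad"
  proof -
    have "(\<Union>N. F N) = open_of T \<union> (\<Union>i\<in>J. l i)"
      by (auto simp: F_def)
    also have "(\<Union>i\<in>J. l i) = (\<Union>(m, t)\<in>{(m, t). good m t}. left_part m t)"
    proof (intro set_eqI iffI)
      fix Z assume "Z \<in> (\<Union>(m, t)\<in>{(m, t). good m t}. left_part m t)"
      then obtain m t where "good m t" "Z \<in> left_part m t" by auto
      then show "Z \<in> (\<Union>i\<in>J. l i)"
        by (intro UN_I[of "prod_encode (m, t)"]) (simp_all add: J_def l_def)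
    qed (auto simp: J_def l_def, blast)
    finally show ?thesis by (simp only: open_of_pad)
  qed
  moreover have "(\<lambda>N. measure coin_measure (F N)) \<longlonglongrightarrow> measure coin_measure (\<Union>N. F N)"
  proof (rule coin.finite_Lim_measure_incseq)
    show "incseq F" by (auto simp: incseq_def F_def)
  qed (use sets in auto)
  ultimately have "(\<lambda>N. measure coin_measure (F N)) \<longlonglongrightarrow> measure coin_measure (open_of pad)" by simp
  then show "measure coin_measure (open_of pad) \<le> 1/2"
    by (rule LIMSEQ_le_const2) (use le in blast)
next
  have "1/2 - 2 * (1/2) ^ m \<le> measure coin_measure (open_of pad)" for m
  proof -
    obtain t where t: "good m t" using good_ex by blast
    have "{Z. T (prefix_of Z t)} \<union> left_part m t \<subseteq> open_of pad"
      unfolding open_of_pad using t by (auto simp: open_of_def)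
    then have "measure coin_measure ({Z. T (prefix_of Z t)} \<union> left_part m t) \<le> measure coin_measure (open_of pad)"
      by (rule coin.finite_measure_mono) simp
    moreover have "(1/2) ^ t \<le> (1/2 :: real) ^ m"
      using good_le[OF t] by (intro power_decreasing) simp_all
    ultimately show ?thesis using measure_left_part_ge[of m t] by linarith
  qed
  moreover have "(\<lambda>m. 1/2 - 2 * (1/2) ^ m :: real) \<longlonglongrightarrow> 1/2 - 2 * 0"
    by (intro tendsto_intros LIMSEQ_power_zero) simp
  ultimately show "1/2 \<le> measure coin_measure (open_of pad)"
    using LIMSEQ_le_const2[of _ "1/2 - 2 * 0" "measure coin_measure (open_of pad)"] by fastforce
qed

end

text \<open>
  For the tail cover of a Schnorr test the certificate required by \<open>padding\<close> is decidable, because the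
  exact measure \<open>2^(-n)\<close> of each component is known and can be compared with what is visible at a given
  level. Guesses longer than \<open>m\<close> need no inspection, as they contribute little.
\<close>

definition settled :: "(nat \<Rightarrow> bool list \<Rightarrow> bool) \<Rightarrow> nat \<Rightarrow> nat \<Rightarrow> bool" where
  "settled D m t \<longleftrightarrow> m \<le> t \<and> (\<forall>k\<le>m.
     2 ^ m * 2 ^ (k + t) \<le> 2 ^ (3 * k + 3 + m) * card {\<rho>\<in>strings (k + t). D (3 * k + 3) \<rho>} + 2 ^ (k + t))"

lemma decfn_settled:
  assumes "decidable_family A D" "recfn A k m" "recfn A k t"
  shows "decfn A k (\<lambda>xs. settled D (m xs) (t xs))"
proof (rule recfn_apply2[OF _ assms(2,3)])
  show "decfn A 2 (\<lambda>xs. settled D (xs ! 0) (xs ! 1))"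
    unfolding settled_def
    by (intro decfn_decidable_family[OF assms(1)] string_intros recfn_intros) simp_all
qed

lemma settled_iff:
  "settled D m t \<longleftrightarrow> m \<le> t \<and> (\<forall>k\<le>m.
     (1/2) ^ (3 * k + 3) - (1/2) ^ (3 * k + 3 + m) \<le>
     measure coin_measure {Z. D (3 * k + 3) (prefix_of Z (k + t))})"
proof -
  have "2 ^ m * 2 ^ l \<le> 2 ^ (n + m) * c + 2 ^ l \<longleftrightarrow> (1/2) ^ n - (1/2) ^ (n + m) \<le> real c / 2 ^ l"
    for l n c :: nat
  proof -
    have "2 ^ m * 2 ^ l \<le> 2 ^ (n + m) * c + 2 ^ l \<longleftrightarrow>
        real (2 ^ m * 2 ^ l) \<le> real (2 ^ (n + m) * c + 2 ^ l)"
      by (simp only: of_nat_le_iff)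
    then show ?thesis by (simp add: power_add power_one_over field_simps)
  qed
  then show ?thesis unfolding settled_def measure_clopen by blast
qed

lemma settled_ex:
  assumes up: "\<And>n. upward (D n)" and meas: "\<And>n. measure coin_measure (open_of (D n)) = (1/2) ^ n"
  shows "\<exists>t\<ge>s. settled D m t"
proof -
  have "\<forall>\<^sub>F t in sequentially. (1/2) ^ n - (1/2) ^ (n + m) <
      measure coin_measure {Z. D n (prefix_of Z (k + t))}" for n k
  proof (rule order_tendstoD(1))
    let ?L = "\<lambda>t. {Z. D n (prefix_of Z (k + t))}"
    have "(\<Union>t. ?L t) = open_of (D n)"
    proof (intro set_eqI iffI)
      fix Z assume "Z \<in> open_of (D n)"
      then obtain l where "D n (prefix_of Z l)" by (auto simp: open_of_def)
      from upward_prefix_of[OF up this, of "k + l"] show "Z \<in> (\<Union>t. ?L t)" by auto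
    qed (auto simp: open_of_def)
    moreover have "(\<lambda>t. measure coin_measure (?L t)) \<longlonglongrightarrow> measure coin_measure (\<Union>t. ?L t)"
      using sets_clopen upward_prefix_of[OF up]
      by (intro coin.finite_Lim_measure_incseq) (auto simp: incseq_def)
    ultimately show "(\<lambda>t. measure coin_measure (?L t)) \<longlonglongrightarrow> (1/2) ^ n" by (simp add: meas)
  qed simp
  then have "\<forall>\<^sub>F t in sequentially. \<forall>k\<in>{..m}. (1/2) ^ (3 * k + 3) - (1/2) ^ (3 * k + 3 + m) <
      measure coin_measure {Z. D (3 * k + 3) (prefix_of Z (k + t))}"
    by (intro eventually_ball_finite) simp_all
  moreover have "\<forall>\<^sub>F t in sequentially. max m s \<le> t" by (rule eventually_ge_at_top)
  ultimately have "\<forall>\<^sub>F t in sequentially. s \<le> t \<and> settled D m t"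
    by eventually_elim (force simp: settled_iff intro: less_imp_le)
  then show ?thesis by (auto simp: eventually_sequentially)
qed

lemma settled_approx:
  assumes up: "\<And>n. upward (D n)" and meas: "\<And>n. measure coin_measure (open_of (D n)) = (1/2) ^ n"
    and settled: "settled D m t"
  shows "measure coin_measure (open_of (tail_cover D) - {Z. tail_cover D (prefix_of Z t)}) \<le> (1/2) ^ m"
proof -
  let ?n = "\<lambda>k. 3 * k + 3 :: nat"
  let ?L = "\<lambda>k. {Z. D (?n k) (prefix_of Z (k + t))}"
  define B where "B k = open_of (D (?n k)) - (if k \<le> m then ?L k else {})" for k
  have sets: "B k \<in> sets coin_measure" for k
    unfolding B_def using sets_clopen[of "D (?n k)" "k + t"] by (intro sets.Diff) auto
  have "open_of (tail_cover D) - {Z. tail_cover D (prefix_of Z t)} \<subseteq> (\<Union>k. \<Union>\<tau>\<in>strings k. prepend \<tau> -` B k)"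
  proof
    fix Z assume Z: "Z \<in> open_of (tail_cover D) - {Z. tail_cover D (prefix_of Z t)}"
    then obtain k \<tau> where \<tau>: "length \<tau> = k" "prepend \<tau> Z \<in> open_of (D (?n k))"
      unfolding open_of_tail_cover[OF up] by blast
    have "prepend \<tau> Z \<notin> ?L k" if "k \<le> m"
    proof
      assume "prepend \<tau> Z \<in> ?L k"
      then have "D (?n k) (\<tau> @ prefix_of Z t)" using prefix_of_prepend[of \<tau> Z t] \<tau>(1) by simp
      moreover have "k \<le> t" using that settled by (simp add: settled_def)
      ultimately have "tail_cover D (prefix_of Z t)"
        unfolding tail_cover_def using \<tau>(1) by auto
      with Z show False by simp
    qed
    then have "prepend \<tau> Z \<in> B k" using \<tau>(2) by (simp add: B_def)
    then show "Z \<in> (\<Union>k. \<Union>\<tau>\<in>strings k. prepend \<tau> -` B k)" using \<tau>(1) by blast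
  qed
  then have "measure coin_measure (open_of (tail_cover D) - {Z. tail_cover D (prefix_of Z t)}) \<le>
      measure coin_measure (\<Union>k. \<Union>\<tau>\<in>strings k. prepend \<tau> -` B k)"
    by (rule coin.finite_measure_mono) (intro sets.countable_UN'' sets.finite_UN sets_prepend sets; simp)
  also have "\<dots> \<le> (1/2) ^ m / 4"
  proof (rule measure_tails_UN_le[OF sets])
    fix k
    have split: "(1/2 :: real) ^ ?n k = (1/2) ^ k * ((1/2) ^ k * ((1/2) ^ k * (1/8)))"
    proof -
      have "?n k = k + (k + (k + 3))" by simp
      then show ?thesis by (simp only: power_add) (simp add: power3_eq_cube)
    qed
    have one: "(2 :: real) ^ k * (1/2) ^ k = 1" by (simp add: power_one_over)
    show "2 ^ k * measure coin_measure (B k) \<le> (1/2) ^ m / 8 * (1/2) ^ k"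
    proof (cases "k \<le> m")
      case True
      have "?L k \<subseteq> open_of (D (?n k))" by (auto simp: open_of_def)
      then have "measure coin_measure (B k) = (1/2) ^ ?n k - measure coin_measure (?L k)"
        unfolding B_def using True sets_clopen[of "D (?n k)" "k + t"]
        by (simp add: coin.finite_measure_Diff meas)
      also have "\<dots> \<le> (1/2) ^ (?n k + m)" using settled True unfolding settled_iff by force
      finally have "2 ^ k * measure coin_measure (B k) \<le> 2 ^ k * (1/2) ^ (?n k + m)"
        by (rule mult_left_mono) simp
      also have "\<dots> = (1/2) ^ m / 8 * (1/2) ^ k * (1/2) ^ k"
      proof -
        have "x * (a * (a * (a * (1/8))) * b) = b / 8 * a * a" if "x * a = 1" for x a b :: real
          using that by (simp add: mult.assoc[symmetric])
        from this[OF one] show ?thesis by (simp only: power_add[of _ "?n k" m] split)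
      qed
      also have "\<dots> \<le> (1/2) ^ m / 8 * (1/2) ^ k * 1"
        by (intro mult_left_mono power_le_one) simp_all
      finally show ?thesis by simp
    next
      case False
      have "2 ^ k * measure coin_measure (B k) = 2 ^ k * (1/2) ^ ?n k"
        using False by (simp add: B_def meas)
      also have "\<dots> = 1/8 * (1/2) ^ k * (1/2) ^ k"
      proof -
        have "x * (a * (a * (a * (1/8)))) = 1/8 * a * a" if "x * a = 1" for x a :: real
          using that by (simp add: mult.assoc[symmetric])
        from this[OF one] show ?thesis by (simp only: split)
      qed
      also have "\<dots> \<le> 1/8 * (1/2) ^ k * (1/2) ^ m"
        using False by (intro mult_left_mono power_decreasing) simp_all
      finally show ?thesis by (simp add: mult.commute)
    qed
  qed
  also have "\<dots> \<le> (1/2) ^ m" by simp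
  finally show ?thesis .
qed

text \<open>
  As for Martin-Loef randomness, but with the tail cover padded to measure 1/2, so that the set of
  sequences with \<open>n\<close> blocks has measure exactly \<open>2^(-n)\<close>.
\<close>

theorem SR_failure_by_blocks:
  assumes "X \<notin> SR A"
  shows "\<exists>D. (\<forall>k. tail k X \<in> blocks D 1) \<and> (\<forall>Y. (\<forall>n. Y \<in> blocks D n) \<longrightarrow> Y \<notin> SR A)"
proof -
  obtain U where U: "schnorr_test A U" "\<And>n. X \<in> U n" using assms by (auto simp: SR_def)
  then have "uniformly_ce_open A U" by (simp add: schnorr_test_def martin_lof_test_def)
  then obtain D where D: "decidable_family A D" "\<And>n. upward (D n)" "\<And>n. U n = open_of (D n)"
    by (rule uniformly_ce_open_decidable) blast
  have meas: "measure coin_measure (open_of (D n)) = (1/2) ^ n" for n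
    using U(1) D(3) by (simp add: schnorr_test_def)
  let ?T = "tail_cover D"
  interpret padding ?T "settled D"
  proof
    show "measure coin_measure (open_of ?T) \<le> 1/4"
      by (rule measure_tail_cover[OF D(2)]) (simp add: meas)
    show "upward ?T" by (rule upward_tail_cover[OF D(2)])
  qed (use settled_approx[OF D(2) meas] settled_ex[OF D(2) meas] in \<open>auto simp: settled_def\<close>)
  have open_pad: "blocks pad 1 = open_of pad" by (rule blocks_1_upward[OF upward_pad])
  have meas_pad: "measure coin_measure (blocks pad n) = (1/2) ^ n" for n
    unfolding measure_blocks[of _ n] open_pad measure_pad ..
  have "decfn A 1 (\<lambda>xs. pad (string_of (xs ! 0)))"
    unfolding pad_def below_def
    by (intro decfn_decidable[OF decidable_tail_cover[OF D(1)]] decfn_settled[OF D(1)]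
        string_intros recfn_intros) simp_all
  then have "decidable A pad" by (simp only: decidable_def)
  from uniformly_ce_open_blocks[OF this, of 1] have "uniformly_ce_open A (blocks pad)" by simp
  then have "schnorr_test A (blocks pad)"
    unfolding schnorr_test_def martin_lof_test_def using decseq_blocks meas_pad by simp
  then have "\<forall>Y. (\<forall>n. Y \<in> blocks pad n) \<longrightarrow> Y \<notin> SR A" unfolding SR_def by blast
  moreover have "\<forall>k. tail k X \<in> blocks pad 1"
    unfolding open_pad open_of_pad using U(2) D(3) by (intro allI UnI1 tail_in_tail_cover D(2)) simp
  ultimately show ?thesis by blast
qed

section \<open>Martingales\<close>

text \<open>
  Approximation by dyadic rationals \<open>f \<sigma> k / 2^k\<close> with error \<open>c / 2^k\<close>. The constant \<open>c\<close> allows rounding and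
  summation errors to be added up without adjusting precisions.
\<close>

definition approximates :: "cantor \<Rightarrow> (bool list \<Rightarrow> nat \<Rightarrow> nat) \<Rightarrow> (bool list \<Rightarrow> real) \<Rightarrow> real \<Rightarrow> bool" where
  "approximates A f h c \<longleftrightarrow> recfn A 2 (\<lambda>xs. f (string_of (xs ! 0)) (xs ! 1)) \<and>
     (\<forall>\<sigma> k. \<bar>2 ^ k * h \<sigma> - real (f \<sigma> k)\<bar> \<le> c)"

lemma recfn_approximates:
  assumes "approximates A f h c" "strfn A k s" "recfn A k n"
  shows "recfn A k (\<lambda>xs. f (s xs) (n xs))"
  using recfn_apply2[of A "\<lambda>x y. f (string_of x) y", OF _ assms(2,3)] assms(1)
  by (simp add: approximates_def)

lemma approximatesD: "approximates A f h c \<Longrightarrow> \<bar>2 ^ k * h \<sigma> - real (f \<sigma> k)\<bar> \<le> c"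
  by (simp add: approximates_def)

lemma nat_div_error: "\<bar>real n / real q - real (n div q)\<bar> \<le> 1"
proof (cases "q = 0")
  case False
  have "real n = real (n div q) * real q + real (n mod q)"
    by (simp only: of_nat_mult[symmetric] of_nat_add[symmetric] div_mult_mod_eq)
  then have "real n / real q - real (n div q) = real (n mod q) / real q"
    using False by (simp add: field_simps)
  moreover have "0 \<le> real (n mod q) / real q" "real (n mod q) / real q \<le> 1"
    using False by (simp_all add: less_imp_le)
  ultimately show ?thesis by simp
qed simp

lemma computable2_recfn: "computable2 A f \<longleftrightarrow> recfn A 2 (\<lambda>xs. f (xs ! 0) (xs ! 1))"
proof
  assume "computable2 A f"
  then obtain p where "\<And>x y. eval A p [x, y] = Some (f x y)" unfolding computable2_def by blast
  then show "recfn A 2 (\<lambda>xs. f (xs ! 0) (xs ! 1))"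
    by (intro recfnI[of _ _ p]) (auto simp: numeral_2_eq_2 length_Suc_conv simp del: eval.simps)
next
  assume "recfn A 2 (\<lambda>xs. f (xs ! 0) (xs ! 1))"
  then obtain p where "\<And>xs. length xs = 2 \<Longrightarrow> eval A p xs = Some (f (xs ! 0) (xs ! 1))"
    unfolding recfn_def by blast
  then have "eval A p [x, y] = Some (f x y)" for x y by simp
  then show "computable2 A f" unfolding computable2_def by blast
qed

lemma computable_real_fun_approximates:
  assumes d: "computable_real_fun A d" and nonneg: "\<And>\<sigma>. 0 \<le> d \<sigma>"
  obtains f where "approximates A f d 2"
proof -
  obtain s p q where spq: "computable2 A s" "computable2 A p" "computable2 A q"
    and q: "\<And>\<sigma> k. q (string_code \<sigma>) k \<noteq> 0"
    and err: "\<And>\<sigma> k. \<bar>d \<sigma> - (-1) ^ s (string_code \<sigma>) k * real (p (string_code \<sigma>) k) / real (q (string_code \<sigma>) k)\<bar> \<le> (1/2) ^ k"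
    using d unfolding computable_real_fun_def Let_def by blast
  define f where "f \<sigma> k = (let c = string_code \<sigma> in
    if s c k div 2 * 2 = s c k then 2 ^ k * p c k div q c k else 0)" for \<sigma> k
  have "recfn A 2 (\<lambda>xs. f (string_of (xs ! 0)) (xs ! 1))"
    using spq unfolding computable2_recfn f_def Let_def code_string_of by (intro recfn_intros) simp_all
  moreover have "\<bar>2 ^ k * d \<sigma> - real (f \<sigma> k)\<bar> \<le> 2" for \<sigma> k
  proof -
    define c where "c = string_code \<sigma>"
    define r where "r = (-1) ^ s c k * real (p c k) / real (q c k)"
    have "\<bar>2 ^ k * d \<sigma> - 2 ^ k * r\<bar> = 2 ^ k * \<bar>d \<sigma> - r\<bar>"
      by (simp only: right_diff_distrib[symmetric] abs_mult) simp
    also have "\<dots> \<le> 2 ^ k * (1/2) ^ k"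
      unfolding r_def c_def by (intro mult_left_mono err) simp
    also have "\<dots> = 1" by (simp add: power_one_over)
    finally have 1: "\<bar>2 ^ k * d \<sigma> - 2 ^ k * r\<bar> \<le> 1" .
    show ?thesis
    proof (cases "even (s c k)")
      case True
      then have f: "f \<sigma> k = 2 ^ k * p c k div q c k" by (simp add: f_def c_def Let_def)
      have r: "2 ^ k * r = real (2 ^ k * p c k) / real (q c k)" using True by (simp add: r_def)
      have "\<bar>2 ^ k * r - real (f \<sigma> k)\<bar> \<le> 1"
        unfolding f r by (rule nat_div_error)
      with 1 show ?thesis by linarith
    next
      case False
      then have f: "f \<sigma> k = 0" by (simp add: f_def c_def Let_def) (metis dvd_triv_right)
      have "2 ^ k * r \<le> 0" using False by (simp add: r_def mult_nonneg_nonpos)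
      moreover have "0 \<le> 2 ^ k * d \<sigma>" using nonneg by simp
      ultimately show ?thesis using 1 f by linarith
    qed
  qed
  ultimately show ?thesis using that unfolding approximates_def by blast
qed

text \<open>
  An error that grows with the length of the string is compensated by asking for more precision.
\<close>

lemma computable_real_fun_of_error:
  assumes f: "recfn A 2 (\<lambda>xs. f (string_of (xs ! 0)) (xs ! 1))"
    and err: "\<And>\<sigma> k. \<bar>2 ^ k * h \<sigma> - real (f \<sigma> k)\<bar> \<le> 2 ^ (length \<sigma> + j)"
  shows "computable_real_fun A h"
proof -
  define e where "e c k = k + (length (string_of c) + j)" for c k
  have e: "recfn A 2 (\<lambda>xs. e (xs ! 0) (xs ! 1))"
    unfolding e_def by (intro recfn_intros string_intros) simp_all
  have "computable2 A (\<lambda>_ _. 0)" unfolding computable2_recfn by (rule recfn_const)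
  moreover have "computable2 A (\<lambda>c k. f (string_of c) (e c k))"
    unfolding computable2_recfn
    using recfn_apply2[of A "\<lambda>x y. f (string_of x) y", OF f recfn_nth e] by simp
  moreover have "computable2 A (\<lambda>c k. 2 ^ e c k)"
    unfolding computable2_recfn by (intro recfn_intros e)
  moreover have "\<bar>h \<sigma> - real (f \<sigma> (e c k)) / 2 ^ e c k\<bar> \<le> (1/2) ^ k" if "c = string_code \<sigma>" for \<sigma> c k
  proof -
    let ?e = "length \<sigma> + j"
    have e: "e c k = k + ?e" by (simp add: e_def that)
    have "h \<sigma> - real (f \<sigma> (k + ?e)) / 2 ^ (k + ?e) =
        (2 ^ (k + ?e) * h \<sigma> - real (f \<sigma> (k + ?e))) / 2 ^ (k + ?e)"
      by (simp add: diff_divide_distrib)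
    then have "\<bar>h \<sigma> - real (f \<sigma> (k + ?e)) / 2 ^ (k + ?e)\<bar> =
        \<bar>2 ^ (k + ?e) * h \<sigma> - real (f \<sigma> (k + ?e))\<bar> / 2 ^ (k + ?e)"
      by (simp only: abs_divide) simp
    also have "\<dots> \<le> 2 ^ ?e / 2 ^ (k + ?e)" by (intro divide_right_mono err) simp
    also have "\<dots> = (1/2) ^ k" by (simp add: power_add power_one_over)
    finally show ?thesis by (simp only: e)
  qed
  ultimately show ?thesis
    unfolding computable_real_fun_def
    by (intro exI[of _ "\<lambda>_ _. 0"] exI[of _ "\<lambda>c k. f (string_of c) (e c k)"] exI[of _ "\<lambda>c k. 2 ^ e c k"])
       (simp add: Let_def)
qed

lemma martingaleD:
  assumes "martingale d" shows "0 \<le> d \<sigma>" "d (\<sigma> @ [False]) + d (\<sigma> @ [True]) = 2 * d \<sigma>"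
  using assms unfolding martingale_def by (auto simp: field_simps)

lemma martingale_sum:
  assumes "martingale d" shows "(\<Sum>\<tau>\<in>strings k. d \<tau>) = 2 ^ k * d []"
  using assms
proof (induction k arbitrary: d)
  case 0
  have "strings 0 = {[]}" by auto
  then show ?case by simp
next
  case (Suc k)
  have "martingale (\<lambda>\<sigma>. d (b # \<sigma>))" for b
    using Suc.prems unfolding martingale_def by (metis append_Cons)
  from Suc.IH[OF this] have "(\<Sum>\<tau>\<in>strings (Suc k). d \<tau>) = 2 ^ k * d [True] + 2 ^ k * d [False]"
    unfolding sum_strings_Suc by (simp add: sum.distrib)
  also have "\<dots> = 2 ^ k * (d ([] @ [False]) + d ([] @ [True]))" by (simp add: algebra_simps)
  also have "\<dots> = 2 ^ Suc k * d []" unfolding martingaleD(2)[OF Suc.prems] by simp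
  finally show ?case .
qed

lemma martingale_growth:
  assumes "martingale d" shows "d (\<tau> @ \<sigma>) \<le> 2 ^ length \<sigma> * d \<tau>"
proof (induction \<sigma> rule: rev_induct)
  case (snoc b \<sigma>)
  have "d (\<tau> @ \<sigma> @ [b]) \<le> 2 * d (\<tau> @ \<sigma>)"
    using martingaleD(2)[OF assms, of "\<tau> @ \<sigma>"] martingaleD(1)[OF assms, of "\<tau> @ \<sigma> @ [\<not> b]"]
    by (cases b) auto
  with snoc show ?case by simp
qed simp

text \<open>
  The average of \<open>d\<close> over all initial segments \<open>\<tau>\<close> of length \<open>k\<close> is a martingale with the same initial
  capital as \<open>d\<close>; the weights \<open>2^(-k-1-e)\<close> combine these averages into one martingale.
\<close>

definition tail_term :: "nat \<Rightarrow> (bool list \<Rightarrow> real) \<Rightarrow> nat \<Rightarrow> bool list \<Rightarrow> real" where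
  "tail_term e d k \<sigma> = (1/2) ^ (2 * k + 1 + e) * (\<Sum>\<tau>\<in>strings k. d (\<tau> @ \<sigma>))"

definition tail_martingale :: "nat \<Rightarrow> (bool list \<Rightarrow> real) \<Rightarrow> bool list \<Rightarrow> real" where
  "tail_martingale e d \<sigma> = (\<Sum>k. tail_term e d k \<sigma>)"

text \<open>
  The mixture succeeds on every tail of every sequence on which \<open>d\<close> succeeds, and the number \<open>e\<close>
  normalizes its initial capital to at most 1.
\<close>

locale tail_mixture =
  fixes d :: "bool list \<Rightarrow> real" and e :: nat
  assumes martingale: "martingale d" and start: "d [] \<le> 2 ^ e"
begin

lemma term_nonneg: "0 \<le> tail_term e d k \<sigma>"
  unfolding tail_term_def by (intro mult_nonneg_nonneg sum_nonneg martingaleD[OF martingale]) simp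

lemma term_le: "tail_term e d k \<sigma> \<le> 2 ^ length \<sigma> * (1/2) ^ Suc k"
proof -
  have "(\<Sum>\<tau>\<in>strings k. d (\<tau> @ \<sigma>)) \<le> (\<Sum>\<tau>\<in>strings k. 2 ^ length \<sigma> * d \<tau>)"
    by (intro sum_mono martingale_growth martingale)
  also have "\<dots> = 2 ^ length \<sigma> * (2 ^ k * d [])"
    by (simp only: sum_distrib_left[symmetric] martingale_sum[OF martingale])
  also have "\<dots> \<le> 2 ^ length \<sigma> * (2 ^ k * 2 ^ e)"
    by (intro mult_left_mono start) simp_all
  finally have "tail_term e d k \<sigma> \<le> (1/2) ^ (2 * k + 1 + e) * (2 ^ length \<sigma> * (2 ^ k * 2 ^ e))"
    unfolding tail_term_def by (rule mult_left_mono) simp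
  also have "(1/2 :: real) ^ (2 * k + 1 + e) = (1/2) ^ k * ((1/2) ^ Suc k * (1/2) ^ e)"
    by (simp add: power_add[symmetric] mult_2 add.assoc)
  also have "\<dots> * (2 ^ length \<sigma> * (2 ^ k * 2 ^ e)) = 2 ^ length \<sigma> * (1/2) ^ Suc k"
    by (simp add: power_one_over field_simps)
  finally show ?thesis .
qed

lemma geometric_tail: "(\<lambda>k. 2 ^ l * (1/2 :: real) ^ Suc (k + n)) sums (2 ^ l * (1/2) ^ n)"
proof -
  have "(\<lambda>k. (2 ^ l * (1/2) ^ Suc n) * (1/2 :: real) ^ k) sums ((2 ^ l * (1/2) ^ Suc n) * 2)"
    using geometric_sums[of "1/2 :: real"] by (intro sums_mult) simp
  then show ?thesis by (simp add: power_add mult_ac)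
qed

lemma summable: "summable (\<lambda>k. tail_term e d k \<sigma>)"
  by (rule summable_comparison_test[OF _ sums_summable[OF geometric_tail[of "length \<sigma>" 0]]])
     (use term_le term_nonneg in auto)

lemma tail_martingale: "martingale (tail_martingale e d)"
  unfolding martingale_def
proof (intro allI conjI)
  fix \<sigma>
  show "0 \<le> tail_martingale e d \<sigma>"
    unfolding tail_martingale_def by (rule suminf_nonneg[OF summable term_nonneg])
  have "tail_term e d k (\<sigma> @ [False]) + tail_term e d k (\<sigma> @ [True]) = 2 * tail_term e d k \<sigma>" for k
  proof -
    have "(\<Sum>\<tau>\<in>strings k. d (\<tau> @ \<sigma> @ [False])) + (\<Sum>\<tau>\<in>strings k. d (\<tau> @ \<sigma> @ [True])) =
        (\<Sum>\<tau>\<in>strings k. 2 * d (\<tau> @ \<sigma>))"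
      unfolding sum.distrib[symmetric]
      by (intro sum.cong refl) (simp only: append_assoc[symmetric] martingaleD(2)[OF martingale])
    then show ?thesis
      unfolding tail_term_def distrib_left[symmetric] by (simp add: sum_distrib_left[symmetric])
  qed
  then have "tail_martingale e d (\<sigma> @ [False]) + tail_martingale e d (\<sigma> @ [True]) =
      2 * tail_martingale e d \<sigma>"
    unfolding tail_martingale_def suminf_add[OF summable summable] by (simp add: suminf_mult summable)
  then show "tail_martingale e d \<sigma> =
      (tail_martingale e d (\<sigma> @ [False]) + tail_martingale e d (\<sigma> @ [True])) / 2"
    by simp
qed

lemma tail_martingale_Nil: "tail_martingale e d [] \<le> 1"
proof -
  have "tail_martingale e d [] \<le> (\<Sum>k. 2 ^ length ([] :: bool list) * (1/2) ^ Suc (k + 0))"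
    unfolding tail_martingale_def
    by (rule suminf_le[OF _ summable sums_summable[OF geometric_tail]]) (use term_le[of _ "[]"] in simp)
  also have "\<dots> = 1" using sums_unique[OF geometric_tail[of 0 0]] by simp
  finally show ?thesis .
qed

lemma tail_martingale_ge:
  "(1/2) ^ (2 * length \<tau> + 1 + e) * d (\<tau> @ \<sigma>) \<le> tail_martingale e d \<sigma>"
proof -
  have "d (\<tau> @ \<sigma>) \<le> (\<Sum>\<tau>\<in>strings (length \<tau>). d (\<tau> @ \<sigma>))"
    by (rule member_le_sum) (use martingaleD[OF martingale] in auto)
  then have "(1/2) ^ (2 * length \<tau> + 1 + e) * d (\<tau> @ \<sigma>) \<le> tail_term e d (length \<tau>) \<sigma>"
    unfolding tail_term_def by (rule mult_left_mono) simp
  also have "\<dots> = (\<Sum>k\<in>{length \<tau>}. tail_term e d k \<sigma>)" by simp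
  also have "\<dots> \<le> tail_martingale e d \<sigma>"
    unfolding tail_martingale_def by (rule sum_le_suminf[OF summable]) (use term_nonneg in auto)
  finally show ?thesis .
qed

text \<open>
  The terms beyond \<open>K = j + |\<sigma>|\<close> contribute at most \<open>2^(-j)\<close>, since a martingale at most doubles with every
  bit. The remaining error consists of 2 from the approximations of \<open>d\<close> and 1 from rounding.
\<close>

lemma tail_martingale_approximates:
  assumes f: "approximates A f d 2"
  obtains F where "approximates A F (tail_martingale e d) 4"
proof -
  define K where "K \<sigma> j = j + length \<sigma>" for \<sigma> :: "bool list" and j :: nat
  define N where "N \<sigma> j = (\<Sum>k<K \<sigma> j. 2 ^ (2 * (K \<sigma> j - k)) * (\<Sum>\<tau>\<in>strings k. f (\<tau> @ \<sigma>) j))" for \<sigma> j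
  define F where "F \<sigma> j = N \<sigma> j div 2 ^ (2 * K \<sigma> j + 1 + e)" for \<sigma> j
  have "recfn A 2 (\<lambda>xs. F (string_of (xs ! 0)) (xs ! 1))"
    unfolding F_def N_def K_def
    by (intro recfn_approximates[OF f] string_intros recfn_intros) simp_all
  moreover have "\<bar>2 ^ j * tail_martingale e d \<sigma> - real (F \<sigma> j)\<bar> \<le> 4" for \<sigma> j
  proof -
    let ?K = "K \<sigma> j"
    let ?w = "\<lambda>k. (1/2 :: real) ^ (2 * k + 1 + e)"
    define R where "R = (\<Sum>k<?K. ?w k * (\<Sum>\<tau>\<in>strings k. real (f (\<tau> @ \<sigma>) j)))"
    have tail: "0 \<le> 2 ^ j * (\<Sum>k. tail_term e d (k + ?K) \<sigma>)" "2 ^ j * (\<Sum>k. tail_term e d (k + ?K) \<sigma>) \<le> 1"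
    proof -
      have summ: "summable (\<lambda>k. tail_term e d (k + ?K) \<sigma>)" using summable by (rule summable_ignore_initial_segment)
      show "0 \<le> 2 ^ j * (\<Sum>k. tail_term e d (k + ?K) \<sigma>)"
        by (intro mult_nonneg_nonneg suminf_nonneg[OF summ term_nonneg]) simp
      have "(\<Sum>k. tail_term e d (k + ?K) \<sigma>) \<le> (\<Sum>k. 2 ^ length \<sigma> * (1/2) ^ Suc (k + ?K))"
        by (rule suminf_le[OF term_le summ sums_summable[OF geometric_tail]])
      also have "\<dots> = 2 ^ length \<sigma> * (1/2) ^ ?K" by (rule sums_unique[OF geometric_tail, symmetric])
      finally have "2 ^ j * (\<Sum>k. tail_term e d (k + ?K) \<sigma>) \<le> 2 ^ j * (2 ^ length \<sigma> * (1/2) ^ ?K)"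
        by (rule mult_left_mono) simp
      also have "\<dots> = 1" by (simp add: K_def power_add power_one_over)
      finally show "2 ^ j * (\<Sum>k. tail_term e d (k + ?K) \<sigma>) \<le> 1" .
    qed
    have split: "2 ^ j * tail_martingale e d \<sigma> =
        2 ^ j * (\<Sum>k. tail_term e d (k + ?K) \<sigma>) + 2 ^ j * (\<Sum>k<?K. tail_term e d k \<sigma>)"
      unfolding tail_martingale_def using suminf_split_initial_segment[OF summable, of \<sigma> ?K]
      by (simp only: distrib_left)
    have "\<bar>2 ^ j * (\<Sum>k<?K. tail_term e d k \<sigma>) - R\<bar> \<le> 2"
    proof -
      have term_diff: "2 ^ j * (?w k * (\<Sum>\<tau>\<in>strings k. d (\<tau> @ \<sigma>))) - ?w k * (\<Sum>\<tau>\<in>strings k. real (f (\<tau> @ \<sigma>) j)) =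
          ?w k * (\<Sum>\<tau>\<in>strings k. 2 ^ j * d (\<tau> @ \<sigma>) - real (f (\<tau> @ \<sigma>) j))" for k
      proof -
        have "(\<Sum>\<tau>\<in>strings k. 2 ^ j * d (\<tau> @ \<sigma>) - real (f (\<tau> @ \<sigma>) j)) =
            2 ^ j * (\<Sum>\<tau>\<in>strings k. d (\<tau> @ \<sigma>)) - (\<Sum>\<tau>\<in>strings k. real (f (\<tau> @ \<sigma>) j))"
          by (simp only: sum_subtractf sum_distrib_left)
        then show ?thesis by (simp only: right_diff_distrib mult.left_commute)
      qed
      have "2 ^ j * (\<Sum>k<?K. tail_term e d k \<sigma>) - R =
          (\<Sum>k<?K. ?w k * (\<Sum>\<tau>\<in>strings k. 2 ^ j * d (\<tau> @ \<sigma>) - real (f (\<tau> @ \<sigma>) j)))"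
        unfolding R_def tail_term_def sum_distrib_left[of "2 ^ j" _ "{..<?K}"] sum_subtractf[symmetric]
        by (simp only: term_diff)
      then have "\<bar>2 ^ j * (\<Sum>k<?K. tail_term e d k \<sigma>) - R\<bar> \<le> (\<Sum>k<?K. \<bar>?w k * (\<Sum>\<tau>\<in>strings k. 2 ^ j * d (\<tau> @ \<sigma>) - real (f (\<tau> @ \<sigma>) j))\<bar>)"
        by (simp only: sum_abs)
      also have "\<dots> \<le> (\<Sum>k<?K. (1/2) ^ k)"
      proof (rule sum_mono)
        fix k
        have "\<bar>\<Sum>\<tau>\<in>strings k. 2 ^ j * d (\<tau> @ \<sigma>) - real (f (\<tau> @ \<sigma>) j)\<bar> \<le> (\<Sum>\<tau>\<in>strings k. 2)"
          by (rule order_trans[OF sum_abs]) (intro sum_mono approximatesD[OF f])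
        also have "\<dots> = 2 * 2 ^ k" by (simp add: card_strings)
        finally have "\<bar>?w k * (\<Sum>\<tau>\<in>strings k. 2 ^ j * d (\<tau> @ \<sigma>) - real (f (\<tau> @ \<sigma>) j))\<bar> \<le> ?w k * (2 * 2 ^ k)"
          unfolding abs_mult by (intro mult_mono) simp_all
        also have "\<dots> = (1/2) ^ k * (1/2) ^ e"
          by (simp add: power_add power_mult power2_eq_square power_one_over field_simps power_mult_distrib[symmetric])
        also have "\<dots> \<le> (1/2) ^ k * 1" by (intro mult_left_mono power_le_one) simp_all
        finally show "\<bar>?w k * (\<Sum>\<tau>\<in>strings k. 2 ^ j * d (\<tau> @ \<sigma>) - real (f (\<tau> @ \<sigma>) j))\<bar> \<le> (1/2) ^ k" by simp
      qed
      also have "\<dots> \<le> (\<Sum>k. (1/2) ^ k)" by (rule sum_le_suminf) (simp_all add: summable_geometric)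
      also have "\<dots> = 2" by (simp add: suminf_geometric)
      finally show ?thesis .
    qed
    moreover have R: "R = real (N \<sigma> j) / real (2 ^ (2 * ?K + 1 + e))"
    proof -
      have "?w k = 2 ^ (2 * (?K - k)) / 2 ^ (2 * ?K + 1 + e)" if "k < ?K" for k
      proof -
        have "2 * ?K + 1 + e = 2 * (?K - k) + (2 * k + 1 + e)" using that by simp
        then show ?thesis by (simp only: power_add[of _ "2 * (?K - k)"]) (simp add: power_one_over)
      qed
      then have "R = (\<Sum>k<?K. 2 ^ (2 * (?K - k)) / 2 ^ (2 * ?K + 1 + e) * (\<Sum>\<tau>\<in>strings k. real (f (\<tau> @ \<sigma>) j)))"
        unfolding R_def by (intro sum.cong refl arg_cong2[where f = "(*)"]) simp
      then show ?thesis by (simp add: N_def sum_divide_distrib)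
    qed
    moreover have "\<bar>R - real (F \<sigma> j)\<bar> \<le> 1"
      unfolding R F_def by (rule nat_div_error)
    ultimately show ?thesis using split tail by linarith
  qed
  ultimately show ?thesis using that unfolding approximates_def by blast
qed

end

text \<open>
  Bet like \<open>h\<close>, but start \<open>h\<close> anew with its initial capital after every cut and keep the surplus as
  savings. The sum is that of the gains of \<open>h\<close> on the individual bits, which keeps the value additive
  and hence easy to approximate, in contrast to multiplying the gains on the blocks.
\<close>

definition restart :: "(bool list \<Rightarrow> bool) \<Rightarrow> (bool list \<Rightarrow> real) \<Rightarrow> bool list \<Rightarrow> real" where
  "restart D h \<sigma> = h [] + (\<Sum>i<length \<sigma>.
     h (current_block D (take i \<sigma>) @ drop i (take (Suc i) \<sigma>)) - h (current_block D (take i \<sigma>)))"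

lemma restart_snoc: "restart D h (\<sigma> @ [b]) = restart D h \<sigma> + h (current_block D \<sigma> @ [b]) - h (current_block D \<sigma>)"
proof -
  have "(\<Sum>i<length \<sigma>. h (current_block D (take i (\<sigma> @ [b])) @ drop i (take (Suc i) (\<sigma> @ [b]))) - h (current_block D (take i (\<sigma> @ [b])))) =
      (\<Sum>i<length \<sigma>. h (current_block D (take i \<sigma>) @ drop i (take (Suc i) \<sigma>)) - h (current_block D (take i \<sigma>)))"
    by (intro sum.cong refl) simp
  then show ?thesis by (simp add: restart_def)
qed

text \<open>
  At a cut \<open>h\<close> has reached 2 and is reset to at most 1, so each block adds at least 1 to the savings.
\<close>

lemma restart_ge:
  assumes hit: "\<And>\<rho>. D \<rho> \<Longrightarrow> 2 \<le> h \<rho>" and start: "h [] \<le> 1"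
  shows "real (block_count D \<sigma>) + h (current_block D \<sigma>) \<le> restart D h \<sigma>"
proof (induction \<sigma> rule: rev_induct)
  case (snoc b \<sigma>)
  show ?case
  proof (cases "D (current_block D \<sigma> @ [b])")
    case True
    then show ?thesis
      using snoc hit[OF True] start by (simp add: restart_snoc block_count_snoc current_block_snoc)
  next
    case False
    then show ?thesis using snoc by (simp add: restart_snoc block_count_snoc current_block_snoc)
  qed
qed (simp add: restart_def)

lemma martingale_restart:
  assumes h: "martingale h" and "\<And>\<rho>. D \<rho> \<Longrightarrow> 2 \<le> h \<rho>" "h [] \<le> 1"
  shows "martingale (restart D h)"
  unfolding martingale_def
proof (intro allI conjI)
  fix \<sigma>
  show "0 \<le> restart D h \<sigma>"
    using restart_ge[of D h \<sigma>, OF assms(2,3)] martingaleD(1)[OF h, of "current_block D \<sigma>"] by linarith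
  show "restart D h \<sigma> = (restart D h (\<sigma> @ [False]) + restart D h (\<sigma> @ [True])) / 2"
    using martingaleD(2)[OF h, of "current_block D \<sigma>"] by (simp add: restart_snoc)
qed

lemma succeeds_on_restart:
  assumes h: "martingale h" and "\<And>\<rho>. D \<rho> \<Longrightarrow> 2 \<le> h \<rho>" "h [] \<le> 1" and Y: "\<And>n. Y \<in> blocks D n"
  shows "succeeds_on (restart D h) Y"
proof -
  have "(\<lambda>m. ereal (restart D h (prefix_of Y m))) \<longlonglongrightarrow> \<infinity>"
    unfolding tendsto_PInfty
  proof
    fix r :: real
    obtain n :: nat where n: "r < real n" using reals_Archimedean2 by blast
    obtain m where m: "n \<le> block_count D (prefix_of Y m)" using Y[of n] by (auto simp: blocks_def open_of_def)
    have "r < restart D h (prefix_of Y m')" if "m \<le> m'" for m'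
    proof -
      have "n \<le> block_count D (prefix_of Y m')" using m block_count_prefix_mono[OF that] by (rule order_trans)
      then show ?thesis
        using n restart_ge[of D h "prefix_of Y m'", OF assms(2,3)] martingaleD(1)[OF h, of "current_block D (prefix_of Y m')"]
        by linarith
    qed
    then show "\<forall>\<^sub>F m in sequentially. ereal r < ereal (restart D h (prefix_of Y m))"
      by (auto simp: eventually_sequentially)
  qed
  then show ?thesis unfolding succeeds_on_def by (intro lim_imp_Limsup) simp_all
qed

lemma computable_restart:
  assumes F: "approximates A F h 4" and D: "decidable A D" and nonneg: "\<And>\<sigma>. 0 \<le> restart D h \<sigma>"
  shows "computable_real_fun A (restart D h)"
proof (rule computable_real_fun_of_error)
  let ?u = "\<lambda>\<sigma> i. current_block D (take i \<sigma>) @ drop i (take (Suc i) \<sigma>)" and ?v = "\<lambda>\<sigma> i. current_block D (take i \<sigma>)"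
  let ?G = "\<lambda>\<sigma> k. F [] k + (\<Sum>i<length \<sigma>. F (?u \<sigma> i) k) - (\<Sum>i<length \<sigma>. F (?v \<sigma> i) k)"
  show "recfn A 2 (\<lambda>xs. ?G (string_of (xs ! 0)) (xs ! 1))"
    by (intro recfn_approximates[OF F] recfn_current_block[OF D] string_intros recfn_intros) simp_all
  show "\<bar>2 ^ k * restart D h \<sigma> - real (?G \<sigma> k)\<bar> \<le> 2 ^ (length \<sigma> + 3)" for \<sigma> k
  proof -
    let ?e = "\<lambda>\<rho>. 2 ^ k * h \<rho> - real (F \<rho> k)"
    let ?x = "real (F [] k) + (\<Sum>i<length \<sigma>. real (F (?u \<sigma> i) k)) - (\<Sum>i<length \<sigma>. real (F (?v \<sigma> i) k))"
    have diff: "2 ^ k * restart D h \<sigma> - ?x = ?e [] + (\<Sum>i<length \<sigma>. ?e (?u \<sigma> i) - ?e (?v \<sigma> i))"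
      unfolding restart_def by (simp add: distrib_left sum_distrib_left sum_subtractf right_diff_distrib)
    have "\<bar>2 ^ k * restart D h \<sigma> - ?x\<bar> \<le> \<bar>?e []\<bar> + (\<Sum>i<length \<sigma>. \<bar>?e (?u \<sigma> i) - ?e (?v \<sigma> i)\<bar>)"
      unfolding diff by (intro order_trans[OF abs_triangle_ineq] add_left_mono sum_abs)
    also have "\<dots> \<le> 4 + (\<Sum>i<length \<sigma>. 8)"
    proof (intro add_mono sum_mono)
      show "\<bar>?e []\<bar> \<le> 4" by (rule approximatesD[OF F])
      show "\<bar>?e (?u \<sigma> i) - ?e (?v \<sigma> i)\<bar> \<le> 8" for i
        using approximatesD[OF F, of k "?u \<sigma> i"] approximatesD[OF F, of k "?v \<sigma> i"] by linarith
    qed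
    also have "\<dots> \<le> 8 * (real (length \<sigma>) + 1)" by simp
    also have "\<dots> \<le> 8 * 2 ^ length \<sigma>"
    proof -
      have "length \<sigma> < 2 ^ length \<sigma>" by (rule less_exp)
      then have "Suc (length \<sigma>) \<le> 2 ^ length \<sigma>" by (rule Suc_leI)
      then have "real (Suc (length \<sigma>)) \<le> real (2 ^ length \<sigma>)" by (simp only: of_nat_le_iff)
      then show ?thesis by simp
    qed
    finally have "\<bar>2 ^ k * restart D h \<sigma> - ?x\<bar> \<le> 2 ^ (length \<sigma> + 3)" by (simp add: power_add)
    moreover have "0 \<le> 2 ^ k * restart D h \<sigma>" using nonneg by simp
    moreover have "real (?G \<sigma> k) = max 0 ?x"
    proof -
      have "real (a - b) = max 0 (real a - real b)" for a b :: nat by (simp add: max_def of_nat_diff)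
      from this[of "F [] k + (\<Sum>i<length \<sigma>. F (?u \<sigma> i) k)" "\<Sum>i<length \<sigma>. F (?v \<sigma> i) k"]
      show ?thesis by simp
    qed
    ultimately show ?thesis by linarith
  qed
qed

text \<open>
  Blocks are the strings on which the mixture of the tails of \<open>d\<close> is seen to reach 2. The threshold 6
  for an approximation with error 4 guarantees the value 2 and is passed whenever the value is at
  least 10, which happens along every tail of \<open>X\<close>.
\<close>

theorem CR_failure_by_blocks:
  assumes "X \<notin> CR A"
  shows "\<exists>D. (\<forall>k. tail k X \<in> blocks D 1) \<and> (\<forall>Y. (\<forall>n. Y \<in> blocks D n) \<longrightarrow> Y \<notin> CR A)"
proof -
  obtain d where d: "martingale d" "computable_real_fun A d" "succeeds_on d X"
    using assms by (auto simp: CR_def)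
  obtain f where f: "approximates A f d 2"
    using computable_real_fun_approximates[OF d(2) martingaleD(1)[OF d(1)]] by blast
  obtain e :: nat where "d [] < 2 ^ e" using real_arch_pow[of 2 "d []"] by auto
  then interpret tail_mixture d e by unfold_locales (use d(1) in auto)
  define h where "h = tail_martingale e d"
  have h: "martingale h" "h [] \<le> 1"
    unfolding h_def by (rule tail_martingale, rule tail_martingale_Nil)
  obtain F where F: "approximates A F h 4"
    using tail_martingale_approximates[OF f] unfolding h_def by blast
  define D where "D \<sigma> \<longleftrightarrow> 6 \<le> F \<sigma> 0" for \<sigma>
  have hit: "2 \<le> h \<sigma>" if "D \<sigma>" for \<sigma>
    using that approximatesD[OF F, of 0 \<sigma>] by (simp add: D_def)
  have D: "decidable A D"
    unfolding decidable_def D_def by (intro recfn_approximates[OF F] string_intros recfn_intros) simp_all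
  have "tail k X \<in> blocks D 1" for k
  proof -
    \<comment> \<open>\<open>10\<close> divided by the weight with which the tails starting at \<open>k\<close> enter the mixture.\<close>
    define C :: real where "C = 10 * 2 ^ (2 * k + 1 + e)"
    have "\<exists>m>k. C < d (prefix_of X m)"
    proof (rule ccontr)
      assume "\<not> ?thesis"
      then have "d (prefix_of X m) \<le> C" if "k < m" for m
        using that by (auto simp: not_less dest: spec[of _ m])
      then have "\<forall>\<^sub>F m in sequentially. ereal (d (prefix_of X m)) \<le> ereal C"
        by (intro eventually_mono[OF eventually_gt_at_top[of k]]) simp
      then have "limsup (\<lambda>m. ereal (d (prefix_of X m))) \<le> ereal C" by (rule Limsup_bounded)
      then show False using d(3) by (simp add: succeeds_on_def)
    qed
    then obtain m where m: "k < m" "C < d (prefix_of X m)" by blast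
    have "prefix_of X m = prefix_of X k @ prefix_of (tail k X) (m - k)"
      using prefix_of_tail[of X k "m - k"] m(1) by simp
    then have "(1/2) ^ (2 * k + 1 + e) * d (prefix_of X m) \<le> h (prefix_of (tail k X) (m - k))"
      using tail_martingale_ge[of "prefix_of X k" "prefix_of (tail k X) (m - k)"] by (simp add: h_def)
    moreover have "10 \<le> (1/2) ^ (2 * k + 1 + e) * d (prefix_of X m)"
      using m(2) by (simp add: C_def power_one_over field_simps)
    ultimately have "D (prefix_of (tail k X) (m - k))"
      using approximatesD[OF F, of 0 "prefix_of (tail k X) (m - k)"] unfolding D_def by simp
    then show ?thesis unfolding blocks_1 using m(1) by (intro CollectI exI[of _ "m - k"]) simp
  qed
  moreover have "Y \<notin> CR A" if "\<forall>n. Y \<in> blocks D n" for Y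
  proof -
    have "martingale (restart D h)" by (rule martingale_restart[OF h(1) hit h(2)])
    moreover have "computable_real_fun A (restart D h)"
      by (rule computable_restart[OF F D martingaleD(1)[OF \<open>martingale (restart D h)\<close>]])
    moreover have "succeeds_on (restart D h) Y"
      by (rule succeeds_on_restart[OF h(1) hit h(2)]) (use that in auto)
    ultimately show ?thesis unfolding CR_def by blast
  qed
  ultimately show ?thesis by blast
qed

section \<open>The lowness classes coincide\<close>

lemma Low_pair_eq:
  assumes "\<And>A X. X \<notin> S A \<Longrightarrow> \<exists>D. (\<forall>k. tail k X \<in> blocks D 1) \<and> (\<forall>Y. (\<forall>n. Y \<in> blocks D n) \<longrightarrow> Y \<notin> S A)"
  shows "Low_pair W2R S = Low_pair MLR S"
  unfolding Low_pair_def using lowness_transfer[OF assms] W2R_subset_MLR by blast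

theorem corollary4p3:
  "Low_pair W2R MLR = Low MLR \<and>
   Low_pair W2R CR = Low_pair MLR CR \<and>
   Low_pair W2R SR = Low_pair MLR SR"
proof (intro conjI)
  have "Low_pair MLR MLR = Low MLR"
    unfolding Low_pair_def Low_def using MLR_oracle by blast
  then show "Low_pair W2R MLR = Low MLR" using Low_pair_eq[OF MLR_failure_by_blocks] by simp
  show "Low_pair W2R CR = Low_pair MLR CR" by (rule Low_pair_eq[OF CR_failure_by_blocks])
  show "Low_pair W2R SR = Low_pair MLR SR" by (rule Low_pair_eq[OF SR_failure_by_blocks])
qed

end
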